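(* Let $n\ge5$. There exists a constant $\alpha_n>0$, depending only on $n$ and with $1+\alpha_n\le\frac{n}{n-2}$, such that for every $p\in[1,1+\alpha_n)$ and every smooth bounded domain $\Omega\subset\mathbb{R}^n$ the following statement (A1) is true: there exist constants $C>0$ and $\delta>0$ such that every $x\in\Omega$ with $\mathbf{d}(x)<\delta$ satisfies $$\partial_{n_x}\widetilde H(x,x)\ \ge\ C\,\mathbf{d}(x)^{1-(n-2)p},$$ where $\partial_{n_x}\widetilde H(x,x):=n_x\cdot\nabla_1\widetilde H(x,x)$.
   Context: $\mathbf d(x)=\mathrm{dist}(x,\partial\Omega)$. For $x\in\Omega$ with $\mathbf d(x)$ small, $n_x\in S^{n-1}$ is the unique direction with $x+\mathbf d(x)n_x\in\partial\Omega$. For a function $f(x,y)$, $\nabla_1f(x,y):=\nabla_af(a,y)|_{a=x}$ (gradient in the first variable), so $\nabla_1 \widetilde H(x,x)=\nabla_a\widetilde H(a,x)|_{a=x}$. $G$ is the Green function of $-\Delta$ on $\Omega$ with Dirichlet boundary condition, and $G(x,y)=\frac{c_n}{|x-y|^{n-2}}-H(x,y)$ with $c_n=\frac{1}{(n-2)|S^{n-1}|}$; thus $H(\cdot,y)$ is harmonic in $\Omega$ with $H(x,y)=\frac{c_n}{|x-y|^{n-2}}$ for $x\in\partial\Omega$. For $p\in[1,\frac n{n-2})$, $\widetilde G:\Omega\times\Omega\to\mathbb R$ is defined by $-\Delta_x\widetilde G(x,y)=G^p(x,y)$ for $x\in\Omega$, $\widetilde G(x,y)=0$ for $x\in\partial\Omega$,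 and its $C^1$ regular part is $$\widetilde H(x,y)=\begin{cases}\dfrac{\alpha_1}{|x-y|^{p(n-2)-2}}-\widetilde G(x,y),&p\in[1,\frac{n-1}{n-2}),\\[2mm]\dfrac{\alpha_1}{|x-y|^{p(n-2)-2}}-\dfrac{\alpha_2H(x,y)}{|x-y|^{(n-2)p-n}}-\widetilde G(x,y),&p\in[\frac{n-1}{n-2},\frac n{n-2}),\end{cases}$$ $$\alpha_1=\frac{c_n^p}{[(n-2)p-2][n-(n-2)p]},\qquad\alpha_2=\frac{p\,c_n^{p-1}}{[(n-2)p-n][2n-2-(n-2)p]},$$ extended by continuity to $x=y$; for each $y$, $\widetilde H(\cdot,y)$ is $C^1$ in $\Omega$. *)

theory Defs
  imports "HOL-Analysis.Analysis"
begin

text \<open>The functions below are only ever differentiated on open sets.\<close>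

primrec Ck_on :: "nat \<Rightarrow> ('a::euclidean_space \<Rightarrow> real) \<Rightarrow> 'a set \<Rightarrow> bool" where
  "Ck_on 0 f S \<longleftrightarrow> continuous_on S f"
| "Ck_on (Suc k) f S \<longleftrightarrow> (\<forall>x\<in>S. f differentiable (at x)) \<and>
     (\<forall>b\<in>Basis. Ck_on k (\<lambda>x. frechet_derivative f (at x) b) S)"

definition Cinf_on :: "('a::euclidean_space \<Rightarrow> real) \<Rightarrow> 'a set \<Rightarrow> bool" where
  "Cinf_on f S \<longleftrightarrow> (\<forall>k. Ck_on k f S)"

definition gradient :: "('a::euclidean_space \<Rightarrow> real) \<Rightarrow> 'a \<Rightarrow> 'a" where
  "gradient f x = (THE D. GDERIV f x :> D)"

definition laplacian :: "('a::euclidean_space \<Rightarrow> real) \<Rightarrow> 'a \<Rightarrow> real" where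
  "laplacian f x =
     (\<Sum>b\<in>Basis. frechet_derivative (\<lambda>z. frechet_derivative f (at z) b) (at x) b)"

definition harmonic_on :: "'a::euclidean_space set \<Rightarrow> ('a \<Rightarrow> real) \<Rightarrow> bool" where
  "harmonic_on S f \<longleftrightarrow> Ck_on 2 f S \<and> (\<forall>x\<in>S. laplacian f x = 0)"

text \<open>Smoothness of the boundary is expressed by local defining functions; the sign condition
  places the domain locally on one side of its boundary.\<close>

definition smooth_bounded_domain :: "'a::euclidean_space set \<Rightarrow> bool" where
  "smooth_bounded_domain \<Omega> \<longleftrightarrow>
     open \<Omega> \<and> connected \<Omega> \<and> bounded \<Omega> \<and> \<Omega> \<noteq> {} \<and>
     (\<forall>z\<in>frontier \<Omega>. \<exists>U \<rho>. open U \<and> z \<in> U \<and> Cinf_on \<rho> U \<and>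
        (\<forall>x\<in>U. gradient \<rho> x \<noteq> 0) \<and>
        \<Omega> \<inter> U = {x\<in>U. \<rho> x < 0} \<and> frontier \<Omega> \<inter> U = {x\<in>U. \<rho> x = 0})"

definition bdry_dist :: "'a::euclidean_space set \<Rightarrow> 'a \<Rightarrow> real" where
  "bdry_dist \<Omega> x = infdist x (frontier \<Omega>)"

definition bdry_dir :: "'a::euclidean_space set \<Rightarrow> 'a \<Rightarrow> 'a" where
  "bdry_dir \<Omega> x = (THE \<nu>. norm \<nu> = 1 \<and> x + bdry_dist \<Omega> x *\<^sub>R \<nu> \<in> frontier \<Omega>)"

text \<open>The dimension, as a real number, is passed as an argument. The area of the unit sphere
  in dimension \<open>n\<close> is \<open>n\<close> times the volume of the unit ball.\<close>

definition c_const :: "real \<Rightarrow> real" where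
  "c_const n = 1 / ((n - 2) * (n * unit_ball_vol n))"

definition \<alpha>1_const :: "real \<Rightarrow> real \<Rightarrow> real" where
  "\<alpha>1_const n p = c_const n powr p / (((n - 2) * p - 2) * (n - (n - 2) * p))"

definition \<alpha>2_const :: "real \<Rightarrow> real \<Rightarrow> real" where
  "\<alpha>2_const n p =
     p * c_const n powr (p - 1) / (((n - 2) * p - n) * (2 * n - 2 - (n - 2) * p))"

text \<open>The regular part \<open>H\<close> of the Dirichlet Green function of \<open>-\<Delta>\<close>.  It determines the Green
  function, and is itself uniquely determined on \<open>closure \<Omega> \<times> \<Omega>\<close>.\<close>

definition is_green_regular_part ::
    "(real^'n) set \<Rightarrow> (real^'n \<Rightarrow> real^'n \<Rightarrow> real) \<Rightarrow> bool" where
  "is_green_regular_part \<Omega> H \<longleftrightarrow>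
     (\<forall>y\<in>\<Omega>. continuous_on (closure \<Omega>) (\<lambda>x. H x y) \<and> harmonic_on \<Omega> (\<lambda>x. H x y) \<and>
        (\<forall>x\<in>frontier \<Omega>. H x y = c_const CARD('n) / norm (x - y) ^ (CARD('n) - 2)))"

definition green :: "(real^'n \<Rightarrow> real^'n \<Rightarrow> real) \<Rightarrow> real^'n \<Rightarrow> real^'n \<Rightarrow> real" where
  "green H x y = c_const CARD('n) / norm (x - y) ^ (CARD('n) - 2) - H x y"

definition test_function :: "'a::euclidean_space set \<Rightarrow> ('a \<Rightarrow> real) \<Rightarrow> bool" where
  "test_function \<Omega> \<phi> \<longleftrightarrow>
     Cinf_on \<phi> UNIV \<and> compact (closure {x. \<phi> x \<noteq> 0}) \<and> closure {x. \<phi> x \<noteq> 0} \<subseteq> \<Omega>"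

text \<open>The problem \<open>-\<Delta> u = G(\<cdot>,y)\<^sup>p\<close> in \<open>\<Omega>\<close>, \<open>u = 0\<close> on \<open>\<partial>\<Omega>\<close>, for \<open>u = Gt(\<cdot>,y)\<close>.  The right-hand
  side is integrable but singular at \<open>y\<close>, so the equation is meant in the sense of distributions
  on all of \<open>\<Omega>\<close> (a pointwise equation off \<open>y\<close> would leave point sources at \<open>y\<close> undetermined).
  The boundary values are attained continuously.  The value at \<open>x = y\<close> is irrelevant.\<close>

definition is_green_tilde ::
    "(real^'n) set \<Rightarrow> real \<Rightarrow> (real^'n \<Rightarrow> real^'n \<Rightarrow> real) \<Rightarrow> (real^'n \<Rightarrow> real^'n \<Rightarrow> real) \<Rightarrow> bool"
  where
  "is_green_tilde \<Omega> p G Gt \<longleftrightarrow>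
     (\<forall>y\<in>\<Omega>. continuous_on (closure \<Omega> - {y}) (\<lambda>x. Gt x y) \<and>
        (\<forall>x\<in>frontier \<Omega>. Gt x y = 0) \<and>
        set_integrable lborel \<Omega> (\<lambda>x. Gt x y) \<and>
        (\<forall>\<phi>. test_function \<Omega> \<phi> \<longrightarrow>
           (LINT x:\<Omega>|lborel. Gt x y * (- laplacian \<phi> x)) =
           (LINT x:\<Omega>|lborel. G x y powr p * \<phi> x)))"

definition H_tilde_off_diag ::
    "real \<Rightarrow> (real^'n \<Rightarrow> real^'n \<Rightarrow> real) \<Rightarrow> (real^'n \<Rightarrow> real^'n \<Rightarrow> real) \<Rightarrow>
     real^'n \<Rightarrow> real^'n \<Rightarrow> real" where
  "H_tilde_off_diag p H Gt x y =
     (let n = real CARD('n) in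
      if p < (n - 1) / (n - 2)
      then \<alpha>1_const n p / norm (x - y) powr (p * (n - 2) - 2) - Gt x y
      else \<alpha>1_const n p / norm (x - y) powr (p * (n - 2) - 2)
           - \<alpha>2_const n p * H x y / norm (x - y) powr ((n - 2) * p - n) - Gt x y)"

definition H_tilde ::
    "real \<Rightarrow> (real^'n \<Rightarrow> real^'n \<Rightarrow> real) \<Rightarrow> (real^'n \<Rightarrow> real^'n \<Rightarrow> real) \<Rightarrow>
     real^'n \<Rightarrow> real^'n \<Rightarrow> real" where
  "H_tilde p H Gt x y =
     (if x = y then Lim (at y) (\<lambda>a. H_tilde_off_diag p H Gt a y) else H_tilde_off_diag p H Gt x y)"

definition normal_deriv_H_tilde ::
    "(real^'n) set \<Rightarrow> real \<Rightarrow> (real^'n \<Rightarrow> real^'n \<Rightarrow> real) \<Rightarrow> (real^'n \<Rightarrow> real^'n \<Rightarrow> real) \<Rightarrow>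
     real^'n \<Rightarrow> real" where
  "normal_deriv_H_tilde \<Omega> p H Gt x = bdry_dir \<Omega> x \<bullet> gradient (\<lambda>a. H_tilde p H Gt a x) x"

end

theory Submission
  imports Defs
begin

text \<open>For \<open>p < (n - 1) / (n - 2)\<close> only the first case of the regular part occurs.  Put
  \<open>s = (n - 2) p - 2\<close> and \<open>d = dist(y, \<partial>\<Omega>)\<close>, let \<open>y'\<close> be the reflection of \<open>y\<close> in the tangent plane at
  the boundary point nearest to \<open>y\<close>, and \<open>W(a) = \<alpha>\<^sub>1 |a - y'|^(-s)\<close>.  For \<open>p = 1\<close> and \<open>\<Omega>\<close> a half space
  \<open>W\<close> is the regular part itself, and \<open>\<partial>\<^sub>\<nu> W(y) = \<alpha>\<^sub>1 s (2 d)^(-s - 1)\<close> has exactly the claimed order.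
  In general the Laplacian of \<open>D = H(\<cdot>, y) - W\<close> (with \<open>H\<close> the regular part) and the boundary values of
  \<open>D\<close> are smaller than the natural scale by a factor \<open>\<omega> = O(p - 1) + o(1)\<close> as \<open>d \<rightarrow> 0\<close>: the first term
  comes from \<open>(a + b)^p - a^p - b^p = O(p - 1)\<close>, the second from the curvature of \<open>\<partial>\<Omega>\<close>.  Comparison
  with the superharmonic barrier \<open>(|a - y|^(3/2) + d^(3/2))^(-2 s / 3)\<close> bounds \<open>D\<close> by a multiple of
  \<open>\<omega> d^(-s)\<close> near \<open>y\<close>, and a potential representation then bounds \<open>\<nabla>D(y)\<close> by a multiple of
  \<open>\<omega> d^(-s - 1)\<close>.  So \<open>\<partial>\<^sub>\<nu> W\<close> dominates once \<open>p - 1\<close> and \<open>d\<close> are small.\<close>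

subsection \<open>Functions of class \<open>C\<^sup>k\<close> and their Laplacians\<close>

text \<open>Let \<open>h\<close> be the regular part of \<open>G(., y)\<close>,
  \<open>\<Gamma> = c |a - y|^(2 - n)\<close> and \<open>E = c |a - y'|^(2 - n)\<close>. Since
  \<open>(n - 2) p = s + 2\<close>, the value of \<open>\<alpha>\<^sub>1\<close> is the one for
  which \<open>\<alpha>\<^sub>1 |a - y|^(-s)\<close> has source \<open>\<Gamma>^p\<close> and
  \<open>W\<close> has source \<open>E^p\<close>, so \<open>D\<close> has the source
  \<open>\<Gamma>^p - (\<Gamma> - h)^p - E^p\<close>. For \<open>p > 1\<close> it is unbounded at
  \<open>y\<close> and the equation is distributional: that \<open>D\<close> extends to
  \<open>y\<close> and has a gradient there must be proved. This and the comparison with the barrier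
  come from one identity, got by testing with the difference of two smoothed Newtonian kernels and
  shrinking the inner radius; it plays the part of the mean value formula and of the Newtonian
  potential at once. Dimension \<open>n >= 5\<close> enters through \<open>s >= n - 4 >= 1\<close>,
  which together with small \<open>p - 1\<close> gives \<open>s (n - 2 - s) >= 1\<close>. The
  constants follow the quantifiers: the gradient bound has a factor depending on \<open>n\<close>
  alone, this fixes the range of \<open>p\<close> and a tolerance \<open>e\<close> for the boundary
  values, and only then does the curvature of the domain fix how small \<open>d\<close> must
  be.\<close>

lemma Ck_on_cong:
  assumes "open S" "\<And>x. x \<in> S \<Longrightarrow> f x = g x"
  shows "Ck_on k f S \<longleftrightarrow> Ck_on k g S"
  using assms(2)
proof (induction k arbitrary: f g)
  case 0
  then show ?case by (auto cong: continuous_on_cong)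
next
  case (Suc k)
  have d: "f differentiable (at x) \<longleftrightarrow> g differentiable (at x)" if "x \<in> S" for x
    by (metis (full_types) Suc.prems assms(1) differentiable_def has_derivative_transform_within_open that)
  have "Ck_on k (\<lambda>x. frechet_derivative f (at x) b) S \<longleftrightarrow> Ck_on k (\<lambda>x. frechet_derivative g (at x) b) S"
    if "\<forall>x\<in>S. f differentiable (at x)" for b
    by (rule Suc.IH) (metis (no_types, lifting) Suc.prems assms(1) frechet_derivative_transform_within_open that)
  with d show ?case by (auto)
qed

text \<open>\<open>Ck_on\<close> is phrased with the choice operator
  \<open>frechet_derivative\<close>. On an open set it can be replaced by an explicit derivative, so
  that inductions on \<open>k\<close> run on formulas.\<close>

lemma Ck_on_SucI:
  assumes "open S" "\<And>x. x \<in> S \<Longrightarrow> (f has_derivative f' x) (at x)"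
    and "\<And>b. b \<in> Basis \<Longrightarrow> Ck_on k (\<lambda>x. f' x b) S"
  shows "Ck_on (Suc k) f S"
proof -
  have e: "f' x = frechet_derivative f (at x)" if "x \<in> S" for x
    using assms(2)[OF that] by (rule frechet_derivative_at)
  have "Ck_on k (\<lambda>x. frechet_derivative f (at x) b) S" if "b \<in> Basis" for b
    using assms(3)[OF that] Ck_on_cong[OF assms(1), of "\<lambda>x. f' x b" "\<lambda>x. frechet_derivative f (at x) b"] e by auto
  then show ?thesis using assms(2) by (auto simp: differentiable_def)
qed

lemma Ck_on_SucD:
  assumes "Ck_on (Suc k) f S"
  shows "x \<in> S \<Longrightarrow> (f has_derivative frechet_derivative f (at x)) (at x)"
    "b \<in> Basis \<Longrightarrow> Ck_on k (\<lambda>x. frechet_derivative f (at x) b) S"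
  using assms frechet_derivative_works by auto

lemma Ck_on_imp_continuous_on: "Ck_on k f S \<Longrightarrow> continuous_on S f"
  by (cases k) (auto intro!: continuous_at_imp_continuous_on differentiable_imp_continuous_within)

lemma Ck_on_Suc_imp: "Ck_on (Suc k) f S \<Longrightarrow> Ck_on k f S"
proof (induction k arbitrary: f)
  case 0
  then show ?case using Ck_on_imp_continuous_on[OF 0] by simp
next
  case (Suc k)
  then show ?case by auto
qed

lemma Ck_on_subset: "Ck_on k f S \<Longrightarrow> T \<subseteq> S \<Longrightarrow> Ck_on k f T"
  by (induction k arbitrary: f) (auto intro: continuous_on_subset)

lemma Ck_on_const: "open S \<Longrightarrow> Ck_on k (\<lambda>x. c) S"
proof (induction k arbitrary: c)
  case (Suc k)
  then show ?case by (intro Ck_on_SucI[where f'="\<lambda>x h. 0"]) auto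
qed auto

lemma Ck_on_linear:
  assumes "bounded_linear f" "open S" shows "Ck_on k f S"
proof (cases k)
  case 0
  then show ?thesis using assms by (simp add: linear_continuous_on)
next
  case (Suc j)
  show ?thesis unfolding Suc
    by (rule Ck_on_SucI[where f'="\<lambda>x. f"]) (auto intro!: assms Ck_on_const bounded_linear_imp_has_derivative)
qed

lemma Ck_on_add:
  assumes "open S" "Ck_on k f S" "Ck_on k g S"
  shows "Ck_on k (\<lambda>x. f x + g x) S"
  using assms(2,3)
proof (induction k arbitrary: f g)
  case 0
  then show ?case by (auto intro: continuous_intros)
next
  case (Suc k)
  note D = Ck_on_SucD[OF Suc.prems(1)] Ck_on_SucD[OF Suc.prems(2)]
  show ?case
    by (rule Ck_on_SucI[where f'="\<lambda>x h. frechet_derivative f (at x) h + frechet_derivative g (at x) h"])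
      (intro assms(1) has_derivative_add Suc.IH D; assumption)+
qed

lemma Ck_on_mult:
  assumes "open S" "Ck_on k f S" "Ck_on k g S"
  shows "Ck_on k (\<lambda>x. f x * g x) S"
  using assms(2,3)
proof (induction k arbitrary: f g)
  case 0
  then show ?case by (auto intro: continuous_intros)
next
  case (Suc k)
  note D = Ck_on_SucD[OF Suc.prems(1)] Ck_on_SucD[OF Suc.prems(2)]
  have k: "Ck_on k f S" "Ck_on k g S" using Suc.prems Ck_on_Suc_imp by blast+
  show ?case
  proof (rule Ck_on_SucI[where f'="\<lambda>x h. f x * frechet_derivative g (at x) h + frechet_derivative f (at x) h * g x"])
    show "((\<lambda>x. f x * g x) has_derivative (\<lambda>h. f x * frechet_derivative g (at x) h + frechet_derivative f (at x) h * g x)) (at x)"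
      if "x \<in> S" for x by (rule has_derivative_mult[OF D(1)[OF that] D(3)[OF that]])
    show "Ck_on k (\<lambda>x. f x * frechet_derivative g (at x) b + frechet_derivative f (at x) b * g x) S" if "b \<in> Basis" for b
      by (intro Ck_on_add assms(1) Suc.IH k D that)
  qed fact
qed

lemma Ck_on_cmult: "open S \<Longrightarrow> Ck_on k f S \<Longrightarrow> Ck_on k (\<lambda>x. c * f x) S"
  by (intro Ck_on_mult Ck_on_const)

lemma Ck_on_diff:
  assumes "open S" "Ck_on k f S" "Ck_on k g S"
  shows "Ck_on k (\<lambda>x. f x - g x) S"
  using Ck_on_add[OF assms(1,2) Ck_on_cmult[OF assms(1,3), of "-1"]] by simp

lemma Ck_on_sum:
  assumes "open S" "finite I" "\<And>i. i \<in> I \<Longrightarrow> Ck_on k (f i) S"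
  shows "Ck_on k (\<lambda>x. \<Sum>i\<in>I. f i x) S"
  using assms(2,3) by (induction I) (auto intro: Ck_on_const Ck_on_add assms(1))

text \<open>The chain rule leaves the product of \<open>g' (q x)\<close> and a derivative of
  \<open>q\<close>. The induction hypothesis is applied to \<open>g'\<close> with the same
  \<open>q\<close>, which is smoother than required, and the product rule does the rest.\<close>

lemma Ck_on_compose:
  fixes g :: "real \<Rightarrow> real" and q :: "'a::euclidean_space \<Rightarrow> real"
  assumes "open S" "Ck_on k q S" "open T" "Ck_on k g T" "\<And>x. x \<in> S \<Longrightarrow> q x \<in> T"
  shows "Ck_on k (\<lambda>x. g (q x)) S"
  using assms(2,4)
proof (induction k arbitrary: g)
  case 0
  then show ?case using assms(5) by (auto intro!: continuous_on_compose2[of T g S q])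
next
  case (Suc k)
  note D = Ck_on_SucD[OF Suc.prems(1)] Ck_on_SucD[OF Suc.prems(2)]
  show ?case
  proof (rule Ck_on_SucI[where f'="\<lambda>x h. frechet_derivative g (at (q x)) 1 * frechet_derivative q (at x) h"])
    fix x assume x: "x \<in> S"
    have "((\<lambda>x. g (q x)) has_derivative (\<lambda>h. frechet_derivative g (at (q x)) (frechet_derivative q (at x) h))) (at x)"
      by (rule has_derivative_compose[OF D(1)[OF x] D(3)[OF assms(5)[OF x]]])
    moreover have "frechet_derivative g (at (q x)) t = frechet_derivative g (at (q x)) 1 * t" for t
      using linear_scale[OF has_derivative_linear[OF D(3)[OF assms(5)[OF x]]], of t 1] by simp
    ultimately show "((\<lambda>x. g (q x)) has_derivative (\<lambda>h. frechet_derivative g (at (q x)) 1 * frechet_derivative q (at x) h)) (at x)"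
      by (metis (no_types, lifting) ext)
  next
    fix b :: 'a assume b: "b \<in> Basis"
    have "Ck_on k q S" using Suc.prems(1) Ck_on_Suc_imp by blast
    moreover have "Ck_on k (\<lambda>t. frechet_derivative g (at t) 1) T" using D(4)[of 1] by simp
    ultimately have "Ck_on k (\<lambda>x. frechet_derivative g (at (q x)) 1) S" by (rule Suc.IH)
    then show "Ck_on k (\<lambda>x. frechet_derivative g (at (q x)) 1 * frechet_derivative q (at x) b) S"
      using D(2)[OF b] by (rule Ck_on_mult[OF assms(1)])
  qed fact
qed

lemma Ck_on_real_SucI:
  fixes f :: "real \<Rightarrow> real"
  assumes "open S" "\<And>x. x \<in> S \<Longrightarrow> (f has_real_derivative f' x) (at x)" "Ck_on k f' S"
  shows "Ck_on (Suc k) f S"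
  by (rule Ck_on_SucI[where f'="\<lambda>x h. f' x * h"])
    (use assms in \<open>auto simp: has_field_derivative_def\<close>)

lemma Ck_on_real_SucD:
  fixes f :: "real \<Rightarrow> real"
  assumes "Ck_on (Suc k) f S"
  obtains f' where "\<And>x. x \<in> S \<Longrightarrow> (f has_real_derivative f' x) (at x)" "Ck_on k f' S"
proof
  note D = Ck_on_SucD[OF assms]
  show "Ck_on k (\<lambda>t. frechet_derivative f (at t) 1) S" using D(2)[of 1] by simp
  show "(f has_real_derivative frechet_derivative f (at x) 1) (at x)" if "x \<in> S" for x
  proof -
    have "frechet_derivative f (at x) t = frechet_derivative f (at x) 1 * t" for t
      using linear_scale[OF has_derivative_linear[OF D(1)[OF that]], of t 1] by simp
    then show ?thesis unfolding has_field_derivative_def using D(1)[OF that] by (metis (no_types, lifting) ext)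
  qed
qed

lemma Ck_on_powr: "Ck_on k (\<lambda>t::real. t powr a) {0<..}"
proof (induction k arbitrary: a)
  case 0
  then show ?case by (auto intro!: continuous_intros)
next
  case (Suc k)
  show ?case
    by (rule Ck_on_real_SucI[where f'="\<lambda>t. a * t powr (a - 1)"])
      (auto intro!: derivative_eq_intros Ck_on_cmult Suc)
qed

lemma Ck_on_dist_square: "open S \<Longrightarrow> Ck_on k (\<lambda>x::'a::euclidean_space. (norm (x - y))\<^sup>2) S"
proof -
  assume "open S"
  have "(\<lambda>x. (norm (x - y))\<^sup>2) = (\<lambda>x. x \<bullet> y * (-2) + (y \<bullet> y + (\<Sum>b\<in>Basis. (x \<bullet> b) * (x \<bullet> b))))"
    by (simp add: fun_eq_iff power2_norm_eq_inner inner_diff inner_commute flip: euclidean_inner)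
  then show ?thesis
    by (simp only:) (intro Ck_on_add Ck_on_mult Ck_on_sum Ck_on_const Ck_on_linear bounded_linear_inner_left \<open>open S\<close> finite_Basis)
qed

lemma laplacian_eq:
  assumes "open S" "x \<in> S" "\<And>z. z \<in> S \<Longrightarrow> (f has_derivative f' z) (at z)"
    "\<And>b. b \<in> Basis \<Longrightarrow> ((\<lambda>z. f' z b) has_derivative f'' b) (at x)"
  shows "laplacian f x = (\<Sum>b\<in>Basis. f'' b b)"
proof -
  have "frechet_derivative (\<lambda>z. frechet_derivative f (at z) b) (at x) b = f'' b b" if "b \<in> Basis" for b
  proof -
    have "((\<lambda>z. frechet_derivative f (at z) b) has_derivative f'' b) (at x)"
      using has_derivative_transform_within_open[OF assms(4)[OF that] assms(1,2)]
        frechet_derivative_at[OF assms(3)] by fastforce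
    then show ?thesis by (metis frechet_derivative_at)
  qed
  then show ?thesis unfolding laplacian_def by simp
qed

lemma laplacian_cong:
  assumes "open S" "x \<in> S" "Ck_on 2 f S" "\<And>z. z \<in> S \<Longrightarrow> f z = g z"
  shows "laplacian f x = laplacian g x"
proof -
  have f: "Ck_on (Suc (Suc 0)) f S" using assms(3) by (simp add: numeral_2_eq_2)
  note D = Ck_on_SucD[OF f]
  have 1: "(g has_derivative frechet_derivative f (at z)) (at z)" if "z \<in> S" for z
    using has_derivative_transform_within_open[OF D(1) assms(1)] that assms(4) by blast
  have 2: "((\<lambda>z. frechet_derivative f (at z) b) has_derivative
      frechet_derivative (\<lambda>z. frechet_derivative f (at z) b) (at x)) (at x)" if "b \<in> Basis" for b
    using Ck_on_SucD(1)[OF D(2)[OF that]] assms(2) by blast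
  show ?thesis
    using laplacian_eq[OF assms(1,2) 1 2] by (simp add: laplacian_def)
qed

lemma laplacian_lincomb:
  assumes "open S" "x \<in> S" "Ck_on 2 f S" "Ck_on 2 g S"
  shows "laplacian (\<lambda>z. c * f z + d * g z) x = c * laplacian f x + d * laplacian g x"
proof -
  have f: "Ck_on (Suc (Suc 0)) f S" and g: "Ck_on (Suc (Suc 0)) g S"
    using assms(3,4) by (simp_all add: numeral_2_eq_2)
  note D = Ck_on_SucD[OF f] Ck_on_SucD[OF g]
  have "laplacian (\<lambda>z. c * f z + d * g z) x = (\<Sum>b\<in>Basis.
     c * frechet_derivative (\<lambda>z. frechet_derivative f (at z) b) (at x) b +
     d * frechet_derivative (\<lambda>z. frechet_derivative g (at z) b) (at x) b)"
    by (rule laplacian_eq[OF assms(1,2), where f'="\<lambda>z h. c * frechet_derivative f (at z) h + d * frechet_derivative g (at z) h"])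
      (use D(1,3) Ck_on_SucD(1)[OF D(2)] Ck_on_SucD(1)[OF D(4)] assms(2) in \<open>auto intro!: has_derivative_add has_derivative_mult_right\<close>)
  then show ?thesis by (simp add: laplacian_def sum.distrib sum_distrib_left)
qed

lemma has_derivative_norm_square:
  "((\<lambda>x::'a::euclidean_space. (norm (x - y))\<^sup>2) has_derivative (\<lambda>h. 2 * ((x - y) \<bullet> h))) (at x)"
  unfolding power2_norm_eq_inner
  by (auto intro!: derivative_eq_intros simp: inner_commute)

lemma has_derivative_radial:
  fixes x y :: "'a::euclidean_space"
  assumes "(h has_real_derivative h') (at ((norm (x - y))\<^sup>2))"
  shows "((\<lambda>x. h ((norm (x - y))\<^sup>2)) has_derivative (\<lambda>v. h' * (2 * ((x - y) \<bullet> v)))) (at x)"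
  using has_derivative_compose[OF has_derivative_norm_square assms[unfolded has_field_derivative_def]] by simp

text \<open>Profiles are taken in the squared distance because that function is smooth at
  \<open>y\<close> too; no case \<open>x = y\<close> has to be split off. In the sum over the basis
  \<open>h'\<close> contributes \<open>2\<close> per direction, and the squares of the coordinates
  in the \<open>h''\<close> terms add up to the squared norm.\<close>

lemma laplacian_radial:
  fixes x y :: "'a::euclidean_space" and h h' :: "real \<Rightarrow> real"
  assumes T: "open T" "(norm (x - y))\<^sup>2 \<in> T"
    and h: "\<And>t. t \<in> T \<Longrightarrow> (h has_real_derivative h' t) (at t)"
    and h': "(h' has_real_derivative h'') (at ((norm (x - y))\<^sup>2))"
  shows "laplacian (\<lambda>x. h ((norm (x - y))\<^sup>2)) x =
    4 * (norm (x - y))\<^sup>2 * h'' + 2 * real DIM('a) * h' ((norm (x - y))\<^sup>2)"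
proof -
  let ?q = "\<lambda>x. (norm (x - y))\<^sup>2"
  have o: "open (?q -` T)" by (rule open_vimage[OF T(1)]) (intro continuous_intros)
  have d2: "((\<lambda>z. h' (?q z) * (2 * ((z - y) \<bullet> b))) has_derivative
     (\<lambda>v. h' (?q x) * (2 * (v \<bullet> b)) + h'' * (2 * ((x - y) \<bullet> v)) * (2 * ((x - y) \<bullet> b)))) (at x)" for b
    by (rule has_derivative_mult[OF has_derivative_radial[OF h']]) (auto intro!: derivative_eq_intros)
  have "laplacian (\<lambda>x. h (?q x)) x = (\<Sum>b\<in>Basis. h' (?q x) * (2 * (b \<bullet> b)) + h'' * (2 * ((x - y) \<bullet> b)) * (2 * ((x - y) \<bullet> b)))"
    by (rule laplacian_eq[OF o, where f'="\<lambda>z v. h' (?q z) * (2 * ((z - y) \<bullet> v))"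
        and f''="\<lambda>b v. h' (?q x) * (2 * (v \<bullet> b)) + h'' * (2 * ((x - y) \<bullet> v)) * (2 * ((x - y) \<bullet> b))"])
      (use T(2) in simp, rule has_derivative_radial, rule h, simp, rule d2)
  also have "\<dots> = (\<Sum>b\<in>(Basis::'a set). 2 * h' (?q x) + 4 * h'' * (((x - y) \<bullet> b) * ((x - y) \<bullet> b)))"
    by (rule sum.cong) (auto simp: inner_Basis algebra_simps)
  also have "\<dots> = 2 * real DIM('a) * h' (?q x) + 4 * h'' * ?q x"
    by (simp add: sum.distrib power2_norm_eq_inner euclidean_inner[of "x - y" "x - y"] flip: sum_distrib_left)
  finally show ?thesis by (simp add: algebra_simps)
qed

lemma Ck_on_Un: "open S \<Longrightarrow> open T \<Longrightarrow> Ck_on k f S \<Longrightarrow> Ck_on k f T \<Longrightarrow> Ck_on k f (S \<union> T)"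
  by (induction k arbitrary: f) (auto intro: continuous_on_open_Un)

section \<open>Flat functions and the profile of a smoothed Newtonian kernel\<close>

text \<open>The function \<open>exp (- 1 / t)\<close> continued by zero. The prefactors
  \<open>(1 / t) ^ j\<close> make the family stable under differentiation, so smoothness is proved
  for all \<open>j\<close> in one induction.\<close>

definition flat :: "nat \<Rightarrow> real \<Rightarrow> real" where
  "flat j t = (if t > 0 then (1 / t) ^ j * exp (- (1 / t)) else 0)"

text \<open>The exponential series at \<open>1 / t\<close> dominates its single term of order
  \<open>j + 2\<close>. The two spare powers of \<open>t\<close> make the difference quotient at the
  origin vanish in the limit.\<close>

lemma flat_le: "\<bar>flat j t\<bar> \<le> fact (j + 2) * t\<^sup>2"
proof (cases "t > 0")
  case True
  have "(1 / t) ^ (j + 2) /\<^sub>R fact (j + 2) \<le> exp (1 / t)"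
    using sum_le_suminf[OF summable_exp_generic[of "1 / t"], of "{j + 2}"] True
    unfolding exp_def by (simp only: sum.insert sum.empty finite.intros) (simp add: exp_def)
  then have "(1 / t) ^ (j + 2) \<le> fact (j + 2) * exp (1 / t)"
    using mult_left_mono[of "(1 / t) ^ (j + 2) /\<^sub>R fact (j + 2)" "exp (1 / t)" "fact (j + 2)"]
    unfolding real_scaleR_def mult.assoc[symmetric] by (metis fact_ge_zero fact_nonzero mult_1 right_inverse)
  then have "(1 / t) ^ (j + 2) * (exp (- (1 / t)) * t\<^sup>2) \<le> fact (j + 2) * exp (1 / t) * (exp (- (1 / t)) * t\<^sup>2)"
    by (rule mult_right_mono) simp
  moreover have "(1 / t) ^ (j + 2) * (exp (- (1 / t)) * t\<^sup>2) = (1 / t) ^ j * exp (- (1 / t))"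
    using True by (simp only: power_add) (simp add: field_simps)
  moreover have "exp (1 / t) * exp (- (1 / t)) = 1"
    by (simp flip: exp_add)
  ultimately have "(1 / t) ^ j * exp (- (1 / t)) \<le> fact (j + 2) * t\<^sup>2"
    by (metis (no_types, lifting) mult.assoc mult.left_neutral)
  with True show ?thesis by (simp add: flat_def)
qed (simp add: flat_def)

lemma DERIV_flat: "(flat j has_real_derivative flat (j + 2) t - j * flat (j + 1) t) (at t)"
proof -
  consider "t > 0" | "t < 0" | "t = 0" by linarith
  then show ?thesis
  proof cases
    case 1
    have "((\<lambda>t. (1 / t) ^ j * exp (- (1 / t))) has_real_derivative flat (j + 2) t - j * flat (j + 1) t) (at t)"
    proof -
      have u: "((\<lambda>t. 1 / t) has_real_derivative - ((1 / t)\<^sup>2)) (at t)"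
        using 1 by (auto intro!: derivative_eq_intros simp: power2_eq_square)
      show ?thesis
      proof (cases j)
        case 0
        show ?thesis
          using DERIV_fun_exp[OF DERIV_minus[OF u]] 1 by (simp add: 0 flat_def mult.commute power2_eq_square)
      next
        case (Suc i)
        show ?thesis
          by (rule DERIV_cong[OF DERIV_mult[OF DERIV_power[OF u, of j] DERIV_fun_exp[OF DERIV_minus[OF u]]]]) (use 1 in \<open>simp add: Suc flat_def algebra_simps power2_eq_square del: power_one_over\<close>)
      qed
    qed
    then show ?thesis
      by (rule has_field_derivative_transform_within_open[where S="{0<..}"]) (use 1 in \<open>auto simp: flat_def\<close>)
  next
    case 2
    have "((\<lambda>t. 0) has_real_derivative flat (j + 2) t - j * flat (j + 1) t) (at t)"
      using 2 by (simp add: flat_def)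
    then show ?thesis
      by (rule has_field_derivative_transform_within_open[where S="{..<0}"]) (use 2 in \<open>auto simp: flat_def\<close>)
  next
    case 3
    have "((\<lambda>h. (flat j (0 + h) - flat j 0) / h) \<longlongrightarrow> 0) (at 0)"
    proof (rule Lim_null_comparison)
      show "\<forall>\<^sub>F h in at 0. norm ((flat j (0 + h) - flat j 0) / h) \<le> fact (j + 2) * \<bar>h\<bar>"
        unfolding eventually_at_filter
      proof (rule always_eventually, intro allI impI)
        fix h :: real assume "h \<noteq> 0"
        then show "norm ((flat j (0 + h) - flat j 0) / h) \<le> fact (j + 2) * \<bar>h\<bar>"
          using flat_le[of j h]
          by (simp add: flat_def[of _ 0] abs_divide pos_divide_le_eq power2_eq_square mult.assoc del: fact_Suc)
      qed
      show "((\<lambda>h. fact (j + 2) * \<bar>h\<bar>) \<longlongrightarrow> (0::real)) (at 0)"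
        by (rule tendsto_eq_intros | simp)+
    qed
    then show ?thesis using 3 by (simp add: DERIV_def flat_def[of _ 0])
  qed
qed

lemma Ck_on_flat: "Ck_on k (flat j) UNIV"
proof (induction k arbitrary: j)
  case 0
  show ?case using DERIV_flat by (auto intro!: continuous_at_imp_continuous_on DERIV_isCont)
next
  case (Suc k)
  show ?case
    by (rule Ck_on_real_SucI[where f'="\<lambda>t. flat (j + 2) t - j * flat (j + 1) t"])
      (intro open_UNIV DERIV_flat Ck_on_diff Ck_on_cmult Suc)+
qed

lemma real_antiderivative:
  fixes f :: "real \<Rightarrow> real"
  assumes "continuous_on UNIV f"
  obtains F where "\<And>x. (F has_real_derivative f x) (at x)"
  using einterval_antiderivative[of "-\<infinity>" "\<infinity>" f] assms
  by (auto simp: continuous_on_eq_continuous_at has_real_derivative_iff_has_vector_derivative)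

lemma DERIV_zero_const:
  fixes f :: "real \<Rightarrow> real"
  assumes "a \<le> b" "\<And>x. a \<le> x \<Longrightarrow> x \<le> b \<Longrightarrow> (f has_real_derivative 0) (at x)"
  shows "f a = f b"
  by (rule antisym[OF DERIV_nonneg_imp_nondecreasing[OF assms(1)] DERIV_nonpos_imp_nonincreasing[OF assms(1)]])
    (use assms(2) in blast)+

text \<open>\<open>\<Theta> (|x|\<^sup>2)\<close> is a smooth radial function on \<open>\<real>\<^sup>m\<close> that equals \<open>|x|^(2 - m)\<close> outside the unit ball,
  and \<open>E (|x|\<^sup>2)\<close> is minus its Laplacian.\<close>

lemma ex_newton_profile:
  fixes m :: real
  assumes "m > 2"
  shows "\<exists>\<Theta> \<Theta>1 \<Theta>2 E. (\<forall>k. Ck_on k \<Theta> UNIV) \<and> (\<forall>k. Ck_on k E UNIV) \<and>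
    (\<forall>t. (\<Theta> has_real_derivative \<Theta>1 t) (at t)) \<and> (\<forall>t. (\<Theta>1 has_real_derivative \<Theta>2 t) (at t)) \<and>
    (\<forall>t\<ge>1. \<Theta> t = t powr (1 - m / 2)) \<and> (\<forall>t>0. 0 \<le> \<Theta> t \<and> \<Theta> t \<le> t powr (1 - m / 2)) \<and>
    (\<forall>t. E t = - (4 * t * \<Theta>2 t + 2 * m * \<Theta>1 t)) \<and> (\<forall>t. E t \<ge> 0) \<and>
    (\<forall>t. 1/4 < t \<longrightarrow> t < 1 \<longrightarrow> E t > 0) \<and> (\<forall>t\<ge>1. E t = 0)"
proof -
  \<comment> \<open>\<open>b\<close> is a bump on \<open>(1/4, 1)\<close> and its primitive
    \<open>w\<close> climbs from \<open>0\<close> to the constant \<open>w 1\<close>. Multiplying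
    the derivative of \<open>t powr (1 - m / 2)\<close> by the cutoff \<open>w t / w 1\<close> and
    integrating back gives \<open>\<Theta>\<close>: the singularity is gone and nothing changes for
    \<open>t >= 1\<close>.\<close>
  define b where "b t = flat 0 (t - 1/4) * flat 0 (1 - t)" for t
  have b: "Ck_on k b UNIV" for k
    unfolding b_def
    by (intro Ck_on_mult open_UNIV Ck_on_compose[OF _ _ _ Ck_on_flat] Ck_on_diff Ck_on_const Ck_on_linear bounded_linear_ident) auto
  have b0: "b t \<ge> 0" "t \<le> 1/4 \<Longrightarrow> b t = 0" "t \<ge> 1 \<Longrightarrow> b t = 0" "1/4 < t \<Longrightarrow> t < 1 \<Longrightarrow> b t > 0" for t
    by (auto simp: b_def flat_def)
  obtain w0 where w0: "(w0 has_real_derivative b t) (at t)" for t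
    using real_antiderivative Ck_on_imp_continuous_on[OF b] by blast
  define w where "w t = w0 t - w0 (1/4)" for t
  have w: "(w has_real_derivative b t) (at t)" for t
    unfolding w_def by (auto intro!: derivative_eq_intros w0)
  have w_mono: "w s \<le> w t" if "s \<le> t" for s t
    by (rule DERIV_nonneg_imp_nondecreasing[OF that]) (use w b0 in blast)
  have wl: "w t = 0" if "t \<le> 1/4" for t
    using DERIV_zero_const[OF that, of w] w b0(2) by (metis w_def diff_self)
  have wr: "w t = w 1" if "t \<ge> 1" for t
    using DERIV_zero_const[OF that, of w] w b0(3) by metis
  have w0: "w t \<ge> 0" for t using w_mono[of "1/4" t] wl by (cases "t \<le> 1/4") auto
  have w1: "w t \<le> w 1" for t using w_mono[of t 1] wr[of t] by linarith
  have wpos: "w 1 > 0"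
  proof -
    have "w (1/2) < w (3/4)"
      by (rule DERIV_pos_imp_increasing) (use w b0(4) in force)+
    with w0[of "1/2"] w1[of "3/4"] show ?thesis by linarith
  qed
  have Ckw: "Ck_on k w UNIV" for k
    using Ck_on_real_SucI[OF open_UNIV w b] by (rule Ck_on_Suc_imp)
  define v where "v t = w t * t powr (- (m / 2))" for t
  have Ckv: "Ck_on k v UNIV" for k
  proof -
    have "Ck_on k v {0<..}" unfolding v_def
      by (intro Ck_on_mult open_greaterThan Ck_on_subset[OF Ckw] Ck_on_powr) auto
    moreover have "Ck_on k v {..<1/4}"
      by (subst Ck_on_cong[where g="\<lambda>_. 0"]) (auto simp: v_def wl intro: Ck_on_const)
    ultimately have "Ck_on k v ({0<..} \<union> {..<1/4})" by (intro Ck_on_Un) auto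
    moreover have "{0<..} \<union> {..<1/4} = (UNIV :: real set)" by auto
    ultimately show ?thesis by simp
  qed
  obtain v' where v': "(v has_real_derivative v' t) (at t)" for t
    using Ck_on_real_SucD[OF Ckv[of "Suc 0"]] by (metis UNIV_I)
  obtain F where F: "(F has_real_derivative v t) (at t)" for t
    using real_antiderivative Ck_on_imp_continuous_on[OF Ckv] by blast
  \<comment> \<open>Normalised so that \<open>- w 1 / c = 1 - m / 2\<close>: then
    \<open>\<Theta>\<close> and \<open>t powr (1 - m / 2)\<close> have the same slope for
    \<open>t >= 1\<close>. The summand \<open>1\<close> in \<open>\<Theta>\<close> matches the
    values at \<open>t = 1\<close>.\<close>
  define c where "c = w 1 * 2 / (m - 2)"
  have c: "c > 0" using wpos assms by (simp add: c_def)
  define \<Theta> where "\<Theta> t = (F 1 - F t) / c + 1" for t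
  have \<Theta>: "(\<Theta> has_real_derivative (- v t / c)) (at t)" for t
    unfolding \<Theta>_def using c by (auto intro!: derivative_eq_intros F)
  have \<Theta>1: "((\<lambda>t. - v t / c) has_real_derivative (- v' t / c)) (at t)" for t
    using c by (auto intro!: derivative_eq_intros v')
  have Ck\<Theta>: "Ck_on k \<Theta> UNIV" for k
  proof (rule Ck_on_Suc_imp, rule Ck_on_real_SucI[OF open_UNIV \<Theta>])
    show "Ck_on k (\<lambda>t. - v t / c) UNIV" using Ck_on_cmult[OF open_UNIV Ckv, where c="- 1 / c"] by simp
  qed
  have d: "((\<lambda>t. \<Theta> t - t powr (1 - m / 2)) has_real_derivative ((w 1 - w t) * t powr (- (m / 2)) / c)) (at t)" if "t > 0" for t
    using that c assms by (auto intro!: derivative_eq_intros \<Theta> simp: v_def c_def field_simps)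
  have big: "\<Theta> t = t powr (1 - m / 2)" if "t \<ge> 1" for t
  proof -
    have "\<Theta> 1 - 1 powr (1 - m / 2) = \<Theta> t - t powr (1 - m / 2)"
      by (rule DERIV_zero_const[OF that, of "\<lambda>t. \<Theta> t - t powr (1 - m / 2)"])
        (metis (no_types) d wr diff_self div_0 mult_zero_left less_le_trans zero_less_one)
    then show ?thesis by (simp add: \<Theta>_def)
  qed
  have small: "\<Theta> t \<le> t powr (1 - m / 2)" if "t > 0" for t
  proof (cases "t \<ge> 1")
    case False
    have "\<Theta> t - t powr (1 - m / 2) \<le> \<Theta> 1 - 1 powr (1 - m / 2)"
    proof (rule DERIV_nonneg_imp_nondecreasing[of t 1 "\<lambda>t. \<Theta> t - t powr (1 - m / 2)"])
      fix x assume "t \<le> x"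
      then have "x > 0" using that by linarith
      moreover have "(w 1 - w x) * x powr (- (m / 2)) / c \<ge> 0"
        using w1[of x] c by (intro divide_nonneg_pos mult_nonneg_nonneg) auto
      ultimately show "\<exists>y. ((\<lambda>t. \<Theta> t - t powr (1 - m / 2)) has_real_derivative y) (at x) \<and> 0 \<le> y"
        using d by blast
    qed (use False in simp)
    then show ?thesis by (simp add: \<Theta>_def)
  qed (simp add: big)
  have pos: "\<Theta> t \<ge> 0" for t
  proof (cases "t \<ge> 1")
    case False
    have "\<Theta> 1 \<le> \<Theta> t"
    proof (rule DERIV_nonpos_imp_nonincreasing[of t 1 \<Theta>])
      fix x
      have "- v x / c \<le> 0"
        using w0[of x] c by (simp add: v_def)
      then show "\<exists>y. (\<Theta> has_real_derivative y) (at x) \<and> y \<le> 0" using \<Theta> by blast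
    qed (use False in simp)
    then show ?thesis by (simp add: \<Theta>_def)
  qed (simp add: big)
  define E where "E t = - (4 * t * (- v' t / c) + 2 * m * (- v t / c))" for t
  \<comment> \<open>\<open>t powr (1 - m / 2)\<close> is the profile of a harmonic function, so the
    terms containing \<open>w\<close> itself cancel and only its derivative \<open>b\<close>
    survives. This gives both the sign and the support of \<open>E\<close>.\<close>
  have E1: "E t = 4 * b t * t powr (1 - m / 2) / c" if "t > 0" for t
  proof -
    have "(v has_real_derivative (b t * t powr (- (m / 2)) - m / 2 * w t * t powr (- (m / 2) - 1))) (at t)"
      unfolding v_def using that by (auto intro!: derivative_eq_intros w)
    then have "v' t = b t * t powr (- (m / 2)) - m / 2 * w t * t powr (- (m / 2) - 1)"
      using v' DERIV_unique by blast
    moreover have p: "t powr (1 - m / 2) = t * (t * t powr (- (m / 2) - 1))" "t powr (- (m / 2)) = t * t powr (- (m / 2) - 1)"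
      using powr_add[of t 1 "- (m / 2)"] powr_add[of t 1 "- (m / 2) - 1"] that by simp_all
    ultimately have "E t = - (4 * t * (- (b t * (t * P) - m / 2 * w t * P) / c) + 2 * m * (- (w t * (t * P)) / c))"
      if "P = t powr (- (m / 2) - 1)" for P
      unfolding E_def v_def that by simp
    then show ?thesis unfolding p using c by (simp add: field_simps)
  qed
  have E2: "E t = 0" if "t \<le> 0" for t
  proof -
    have "((\<lambda>_. 0) has_real_derivative v' t) (at t)"
    proof (rule has_field_derivative_transform_within_open[OF v'])
      show "t \<in> {..<1/4}" using that by simp
      show "v s = 0" if "s \<in> {..<1/4}" for s using wl[of s] that by (simp add: v_def)
    qed simp
    then have "v' t = 0" using DERIV_const DERIV_unique by blast
    then show ?thesis using wl[of t] that by (simp add: E_def v_def)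
  qed
  have CkE: "Ck_on k E UNIV" for k
  proof -
    have "Ck_on k E {0<..}"
    proof (subst Ck_on_cong[where g="\<lambda>t. (4 / c) * (b t * t powr (1 - m / 2))"])
      show "Ck_on k (\<lambda>t. (4 / c) * (b t * t powr (1 - m / 2))) {0<..}"
        by (intro Ck_on_cmult Ck_on_mult Ck_on_powr open_greaterThan Ck_on_subset[OF b] subset_UNIV)
    qed (simp_all add: E1)
    moreover have "Ck_on k E {..<1/4}"
    proof (subst Ck_on_cong[where g="\<lambda>_. 0"])
      show "E t = 0" if "t \<in> {..<1/4}" for t
        using E1[of t] E2[of t] b0(2)[of t] that by (cases "t > 0") auto
    qed (auto intro: Ck_on_const)
    ultimately have "Ck_on k E ({0<..} \<union> {..<1/4})" by (intro Ck_on_Un) auto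
    moreover have "{0<..} \<union> {..<1/4} = (UNIV :: real set)" by auto
    ultimately show ?thesis by simp
  qed
  have Epos: "E t \<ge> 0" for t
    using E1[of t] E2[of t] b0(1)[of t] c by (cases "t > 0") simp_all
  have Epos': "E t > 0" if "1/4 < t" "t < 1" for t
    using E1[of t] b0(4)[of t] c that by simp
  have E0: "E t = 0" if "t \<ge> 1" for t
    using E1[of t] b0(3)[of t] that by simp
  show ?thesis
    apply (rule exI[of _ \<Theta>], rule exI[of _ "\<lambda>t. - v t / c"], rule exI[of _ "\<lambda>t. - v' t / c"], rule exI[of _ E])
    apply (intro conjI allI impI)
    subgoal by (rule Ck\<Theta>)
    subgoal by (rule CkE)
    subgoal by (rule \<Theta>)
    subgoal by (rule \<Theta>1)
    subgoal by (rule big)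
    subgoal by (rule pos)
    subgoal by (rule small)
    subgoal by (simp add: E_def)
    subgoal by (rule Epos)
    subgoal by (rule Epos')
    subgoal by (rule E0)
    done
qed

subsection \<open>Integration by parts\<close>

lemma integrable_indicator_cball:
  "integrable lborel (\<lambda>x::'a::euclidean_space. M * indicator (cball c R) x :: real)"
  using emeasure_lborel_cball_finite[of c R]
  by (intro integrable_mult_right integrable_real_indicator) auto

lemma integrable_bounded_support:
  fixes f :: "'a::euclidean_space \<Rightarrow> real"
  assumes "f \<in> borel_measurable borel" "\<And>x. \<bar>f x\<bar> \<le> M" "\<And>x. R \<le> norm x \<Longrightarrow> f x = 0"
  shows "integrable lborel f"
proof (rule Bochner_Integration.integrable_bound)
  show "integrable lborel (\<lambda>x::'a. M * indicator (cball 0 R) x)"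
    by (rule integrable_indicator_cball)
  show "AE x in lborel. norm (f x) \<le> norm (M * indicator (cball 0 R) x)"
    using assms(2,3) by (intro AE_I2) (force simp: indicator_def intro: order_trans[OF assms(2)])
qed (use assms in auto)

lemma continuous_bounded_support:
  fixes f :: "'a::euclidean_space \<Rightarrow> real"
  assumes "continuous_on UNIV f" "\<And>x. R \<le> norm x \<Longrightarrow> f x = 0"
  obtains M where "M > 0" "\<And>x. \<bar>f x\<bar> \<le> M"
proof -
  have "bounded (f ` cball 0 R)"
    by (intro compact_imp_bounded compact_continuous_image continuous_on_subset[OF assms(1)]) auto
  then obtain M where M: "M > 0" "\<And>x. x \<in> cball 0 R \<Longrightarrow> \<bar>f x\<bar> \<le> M"
    unfolding bounded_pos by auto
  have "\<bar>f x\<bar> \<le> M" for x using M assms(2)[of x] by (cases "norm x \<le> R") auto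
  with M(1) that show ?thesis by blast
qed

lemma integrable_continuous_bounded_support:
  fixes f :: "'a::euclidean_space \<Rightarrow> real"
  assumes "continuous_on UNIV f" "\<And>x. R \<le> norm x \<Longrightarrow> f x = 0"
  shows "integrable lborel f"
  using continuous_bounded_support[OF assms] integrable_bounded_support[of f] assms
    borel_measurable_continuous_onI by metis

lemma
  fixes f :: "'a::euclidean_space \<Rightarrow> real"
  shows integral_lborel_translate: "integral\<^sup>L lborel (\<lambda>x. f (c + x)) = integral\<^sup>L lborel f"
    and integrable_lborel_translate: "integrable lborel f \<Longrightarrow> integrable lborel (\<lambda>x. f (c + x))"
proof -
  have i: "integrable lborel (\<lambda>x. f (c + x))" if "integrable lborel f" for f :: "'a \<Rightarrow> real" and c
    using integrable_distr[of "(+) c" lborel lborel f] that lborel_distr_plus[of c]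
    by (simp cong: distr_cong)
  then show "integrable lborel f \<Longrightarrow> integrable lborel (\<lambda>x. f (c + x))" .
  show "integral\<^sup>L lborel (\<lambda>x. f (c + x)) = integral\<^sup>L lborel f"
  proof (cases "integrable lborel f")
    case True
    then have "f \<in> borel_measurable borel" by auto
    then show ?thesis using integral_distr[of "(+) c" lborel lborel f] lborel_distr_plus[of c]
      by (simp cong: distr_cong)
  next
    case False
    then have "\<not> integrable lborel (\<lambda>x. f (c + x))"
      using i[of "\<lambda>x. f (c + x)" "- c"] by (auto simp: add.assoc[symmetric])
    with False show ?thesis by (simp add: not_integrable_integral_eq)
  qed
qed

lemma has_derivative_zero_outside:
  fixes F :: "'a::euclidean_space \<Rightarrow> real"
  assumes "(F has_derivative F') (at x)" "\<And>x. R \<le> norm x \<Longrightarrow> F x = 0" "R < norm x"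
  shows "F' = (\<lambda>h. 0)"
proof -
  have "((\<lambda>_. 0) has_derivative F') (at x)"
    by (rule has_derivative_transform_within_open[OF assms(1), of "- cball 0 R"]) (use assms in auto)
  then show ?thesis by (rule has_derivative_unique) simp
qed

text \<open>A difference quotient in direction \<open>b\<close> has integral zero by translation
  invariance of Lebesgue measure. The mean value theorem bounds the quotients, and their supports
  lie in one ball, so dominated convergence passes to the derivative.\<close>

lemma integral_partial_derivative_eq_0:
  fixes F :: "'a::euclidean_space \<Rightarrow> real"
  assumes F: "\<And>x. (F has_derivative F' x) (at x)" and c: "continuous_on UNIV (\<lambda>x. F' x b)"
    and R: "\<And>x. R \<le> norm x \<Longrightarrow> F x = 0"
  shows "integrable lborel (\<lambda>x. F' x b)" "integral\<^sup>L lborel (\<lambda>x. F' x b) = 0"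
proof -
  \<comment> \<open>Radius \<open>R + 1\<close>, not \<open>R\<close>: the derivative of
    \<open>F\<close> is known to vanish only in the open exterior of the ball, since
    \<open>F\<close> is locally zero there but not on the sphere.\<close>
  have z: "F' x b = 0" if "R + 1 \<le> norm x" for x
    using has_derivative_zero_outside[OF F R, where x=x] that by simp
  show "integrable lborel (\<lambda>x. F' x b)"
    by (rule integrable_continuous_bounded_support[OF c z])
  obtain M where M: "M > 0" "\<And>x. \<bar>F' x b\<bar> \<le> M"
    using continuous_bounded_support[OF c z] by blast
  have cF: "continuous_on UNIV F" by (intro continuous_at_imp_continuous_on ballI has_derivative_continuous[OF F])
  have iF: "integrable lborel F" by (rule integrable_continuous_bounded_support[OF cF R])
  define e where "e k = 1 / real (Suc k)" for k
  have e: "e k > 0" "e k \<le> 1" for k by (auto simp: e_def)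
  have e0: "e \<longlonglongrightarrow> 0" unfolding e_def using LIMSEQ_inverse_real_of_nat by (simp add: inverse_eq_divide)
  let ?g = "\<lambda>k x. (F (e k *\<^sub>R b + x) - F x) / e k"
  have line: "((\<lambda>t. F (t *\<^sub>R b + x)) has_real_derivative F' (t *\<^sub>R b + x) b) (at t)" for t x
  proof -
    have "((\<lambda>t. F (t *\<^sub>R b + x)) has_derivative (\<lambda>h. F' (t *\<^sub>R b + x) (h *\<^sub>R b))) (at t)"
      by (rule has_derivative_compose[OF _ F]) (auto intro!: derivative_eq_intros)
    then show ?thesis
      using linear_scale[OF has_derivative_linear[OF F]] by (simp add: has_field_derivative_def mult.commute[of _ "F' _ b"])
  qed
  have bnd: "\<bar>?g k x\<bar> \<le> M" for k x
  proof -
    obtain t where "F (e k *\<^sub>R b + x) - F (0 *\<^sub>R b + x) = (e k - 0) * F' (t *\<^sub>R b + x) b"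
      using MVT2[of 0 "e k" "\<lambda>t. F (t *\<^sub>R b + x)" "\<lambda>t. F' (t *\<^sub>R b + x) b"] line e by blast
    then show ?thesis using M(2)[of "t *\<^sub>R b + x"] e[of k] by simp
  qed
  have supp: "?g k x = 0" if "norm x > R + norm b" for k x
  proof -
    have "norm (e k *\<^sub>R b) \<le> norm b" using e[of k] by (simp add: mult_left_le_one_le)
    moreover have "norm x \<le> norm (e k *\<^sub>R b + x) + norm (e k *\<^sub>R b)"
      by (metis add.commute add_diff_cancel norm_triangle_sub add.commute norm_triangle_ineq4)
    moreover have "R \<le> norm x" using that norm_ge_zero[of b] by linarith
    ultimately show ?thesis using R that by simp
  qed
  have "(\<lambda>k. integral\<^sup>L lborel (?g k)) \<longlonglongrightarrow> integral\<^sup>L lborel (\<lambda>x. F' x b)"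
  proof (rule integral_dominated_convergence[where w="\<lambda>x. M * indicator (cball 0 (R + norm b)) x"])
    have mF: "F \<in> borel_measurable borel" using cF by (rule borel_measurable_continuous_onI)
    then show "?g k \<in> borel_measurable lborel" for k by measurable
    show "(\<lambda>x. F' x b) \<in> borel_measurable lborel" using c borel_measurable_continuous_onI by auto
    show "integrable lborel (\<lambda>x::'a. M * indicator (cball 0 (R + norm b)) x)"
      by (rule integrable_indicator_cball)
    show "AE x in lborel. norm (?g k x) \<le> M * indicator (cball 0 (R + norm b)) x" for k
      using bnd supp M(1) by (intro AE_I2) (auto simp: indicator_def not_le)
    show "AE x in lborel. (\<lambda>k. ?g k x) \<longlonglongrightarrow> F' x b"
    proof (intro AE_I2)
      fix x
      have "((\<lambda>h. (F (h *\<^sub>R b + x) - F x) / h) \<longlongrightarrow> F' x b) (at 0)"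
        using line[of x 0] by (simp add: DERIV_def)
      moreover have "filterlim e (at 0) sequentially"
        using e0 e by (auto simp: filterlim_at less_imp_neq[symmetric])
      ultimately show "(\<lambda>k. ?g k x) \<longlonglongrightarrow> F' x b"
        using filterlim_compose by blast
    qed
  qed
  moreover have "integral\<^sup>L lborel (?g k) = 0" for k
    using iF integrable_lborel_translate[OF iF] integral_lborel_translate[of F] by simp
  ultimately have "(\<lambda>k. 0) \<longlonglongrightarrow> integral\<^sup>L lborel (\<lambda>x. F' x b)" by (simp only:)
  then show "integral\<^sup>L lborel (\<lambda>x. F' x b) = 0" by (simp add: LIMSEQ_const_iff)
qed

lemma continuous_on_laplacian: "Ck_on 2 u S \<Longrightarrow> continuous_on S (laplacian u)"
  unfolding laplacian_def by (auto simp: numeral_2_eq_2 intro!: continuous_on_sum)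

lemma laplacian_zero_outside:
  fixes \<phi> :: "'a::euclidean_space \<Rightarrow> real"
  assumes "Ck_on 2 \<phi> UNIV" "\<And>x. R \<le> norm x \<Longrightarrow> \<phi> x = 0" "R < norm x"
  shows "laplacian \<phi> x = 0"
proof -
  have "laplacian \<phi> x = laplacian (\<lambda>_. 0::real) x"
    by (rule laplacian_cong[of "- cball 0 R"]) (use assms Ck_on_subset[OF assms(1)] in auto)
  also have "\<dots> = 0" using laplacian_eq[of UNIV x "\<lambda>_. 0" "\<lambda>_ _. 0" "\<lambda>_ _. 0"] by simp
  finally show ?thesis .
qed

text \<open>Green's second identity: the difference of the integrands is the divergence with
  components \<open>u * d_b \<phi> - d_b u * \<phi>\<close>, each of which has bounded support
  because \<open>\<phi>\<close> does.\<close>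

lemma integral_laplacian_swap:
  fixes u \<phi> :: "'a::euclidean_space \<Rightarrow> real"
  assumes u: "Ck_on 2 u UNIV" and \<phi>: "Ck_on 2 \<phi> UNIV" and R: "\<And>x. R \<le> norm x \<Longrightarrow> \<phi> x = 0"
  shows "integral\<^sup>L lborel (\<lambda>x. u x * laplacian \<phi> x) = integral\<^sup>L lborel (\<lambda>x. laplacian u x * \<phi> x)"
proof -
  have u2: "Ck_on (Suc (Suc 0)) u UNIV" and \<phi>2: "Ck_on (Suc (Suc 0)) \<phi> UNIV"
    using u \<phi> by (simp_all add: numeral_2_eq_2)
  let ?d = "\<lambda>f b x. frechet_derivative f (at x) b"
  note D = Ck_on_SucD[OF u2] Ck_on_SucD[OF \<phi>2]
  note E = Ck_on_SucD[OF D(2)] Ck_on_SucD[OF D(4)]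
  define P where "P b x = u x * ?d (?d \<phi> b) b x - ?d (?d u b) b x * \<phi> x" for b x
  have "integrable lborel (P b) \<and> integral\<^sup>L lborel (P b) = 0" if b: "b \<in> Basis" for b
  proof -
    define F where "F x = u x * ?d \<phi> b x - ?d u b x * \<phi> x" for x
    define F' where "F' x h = (u x * frechet_derivative (?d \<phi> b) (at x) h + frechet_derivative u (at x) h * ?d \<phi> b x)
      - (?d u b x * frechet_derivative \<phi> (at x) h + frechet_derivative (?d u b) (at x) h * \<phi> x)" for x h
    have F: "(F has_derivative F' x) (at x)" for x
      unfolding F_def F'_def
      by (intro has_derivative_diff has_derivative_mult D(1,3) E(1,3) UNIV_I b)
    have P: "F' x b = P b x" for x by (simp add: F'_def P_def algebra_simps)
    have c: "continuous_on UNIV (\<lambda>x. F' x b)"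
      unfolding P P_def using E(2,4)[OF b b] Ck_on_imp_continuous_on[OF u] Ck_on_imp_continuous_on[OF \<phi>]
      by (auto intro!: continuous_intros)
    have Z: "F x = 0" if "R + 1 \<le> norm x" for x
      using that R[of x] has_derivative_zero_outside[OF D(3)[OF UNIV_I] R, where x=x] by (simp add: F_def)
    show ?thesis
      using integral_partial_derivative_eq_0[of F F' b "R + 1", OF F c Z] by (simp add: P)
  qed
  then have "integral\<^sup>L lborel (\<lambda>x. \<Sum>b\<in>Basis. P b x) = 0" by (simp add: integral_sum)
  moreover have "(\<Sum>b\<in>Basis. P b x) = u x * laplacian \<phi> x - laplacian u x * \<phi> x" for x
    by (simp add: P_def laplacian_def sum_subtractf sum_distrib_left sum_distrib_right)
  moreover have "integrable lborel (\<lambda>x. u x * laplacian \<phi> x)"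
    by (rule integrable_continuous_bounded_support[of _ "R + 1"])
      (auto intro!: continuous_intros continuous_on_laplacian u \<phi> Ck_on_imp_continuous_on[OF u] laplacian_zero_outside[OF \<phi> R])
  moreover have "integrable lborel (\<lambda>x. laplacian u x * \<phi> x)"
    by (rule integrable_continuous_bounded_support[of _ R])
      (auto intro!: continuous_intros continuous_on_laplacian u \<phi> Ck_on_imp_continuous_on[OF \<phi>] R)
  ultimately show ?thesis by simp
qed

text \<open>The constant comes from summing over dyadic annuli; it is not sharp.\<close>

definition riesz_const :: "real \<Rightarrow> real \<Rightarrow> real" where
  "riesz_const n \<beta> = 2 powr \<beta> * unit_ball_vol n / (1 - 2 powr (\<beta> - n))"

lemma two_powr_neg_less_1: "a < 0 \<Longrightarrow> 2 powr a < (1::real)"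
  using powr_less_mono[of a 0 "2::real"] by simp

lemma riesz_const_pos: "0 \<le> n \<Longrightarrow> \<beta> < n \<Longrightarrow> riesz_const n \<beta> > 0"
  by (auto simp: riesz_const_def intro!: divide_pos_pos mult_pos_pos two_powr_neg_less_1)

text \<open>On the dyadic annulus with outer radius \<open>r / 2 ^ k\<close> the integrand is at
  most \<open>(r / 2 ^ Suc k) powr (- \<beta>)\<close>, and the annulus is enlarged to the full
  ball. The resulting series is geometric with ratio \<open>2 powr (\<beta> - n)\<close>, which is
  below one as \<open>\<beta> < n\<close>.\<close>

lemma nn_integral_riesz:
  fixes c :: "'a::euclidean_space" and \<beta> :: real
  assumes "0 \<le> \<beta>" "\<beta> < DIM('a)" "r > 0"
  shows "(\<integral>\<^sup>+x. ennreal (indicator (ball c r) x * norm (x - c) powr (- \<beta>)) \<partial>lborel)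
    \<le> ennreal (riesz_const DIM('a) \<beta> * r powr (DIM('a) - \<beta>))"
proof -
  let ?n = "real DIM('a)"
  define T where "T k x = ennreal ((r / 2 ^ Suc k) powr (- \<beta>)) * indicator (ball c (r / 2 ^ k)) x" for k and x :: 'a
  have le: "ennreal (indicator (ball c r) x * norm (x - c) powr (- \<beta>)) \<le> (\<Sum>k. T k x)" for x
  proof (cases "x \<in> ball c r \<and> x \<noteq> c")
    case True
    define m where "m = norm (x - c)"
    have m: "0 < m" "m < r" using True by (auto simp: m_def dist_norm norm_minus_commute)
    obtain k0 where "(1/2) ^ k0 < m / r" using real_arch_pow_inv[of "m / r" "1/2"] m assms(3) by auto
    then have ex: "r / 2 ^ k0 \<le> m" using assms(3) by (simp add: power_one_over field_simps)
    define k where "k = (LEAST k. r / 2 ^ k \<le> m)"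
    have k1: "r / 2 ^ k \<le> m" unfolding k_def using ex by (rule LeastI)
    have "k \<noteq> 0" using k1 m by (intro notI) simp
    then obtain j where j: "k = Suc j" using not0_implies_Suc by blast
    have "\<not> r / 2 ^ j \<le> m" using not_less_Least[of j "\<lambda>k. r / 2 ^ k \<le> m"] j k_def by simp
    then have in_b: "x \<in> ball c (r / 2 ^ j)" by (simp add: m_def dist_norm norm_minus_commute)
    have "m powr (- \<beta>) \<le> (r / 2 ^ Suc j) powr (- \<beta>)"
      using k1 j assms m by (intro powr_mono2') auto
    then have "ennreal (indicator (ball c r) x * norm (x - c) powr (- \<beta>)) \<le> T j x"
      using True in_b by (simp add: T_def m_def ennreal_leI)
    also have "\<dots> \<le> (\<Sum>k. T k x)"
      using sum_le_suminf[of "\<lambda>k. T k x" "{j}"] by simp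
    finally show ?thesis .
  qed auto
  have T_int: "(\<integral>\<^sup>+x. T k x \<partial>lborel) = ennreal (2 powr \<beta> * unit_ball_vol ?n * r powr (?n - \<beta>) * (2 powr (\<beta> - ?n)) ^ k)" for k
  proof -
    have "(\<integral>\<^sup>+x. T k x \<partial>lborel) = ennreal ((r / 2 ^ Suc k) powr (- \<beta>)) * ennreal (unit_ball_vol ?n * (r / 2 ^ k) ^ DIM('a))"
      using assms unfolding T_def by (subst nn_integral_cmult_indicator) (auto simp: emeasure_ball)
    also have "\<dots> = ennreal ((r / 2 ^ Suc k) powr (- \<beta>) * (unit_ball_vol ?n * (r / 2 ^ k) ^ DIM('a)))"
      using assms by (subst ennreal_mult) auto
    also have "(r / 2 ^ Suc k) powr (- \<beta>) * (unit_ball_vol ?n * (r / 2 ^ k) ^ DIM('a)) =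
       2 powr \<beta> * unit_ball_vol ?n * r powr (?n - \<beta>) * (2 powr (\<beta> - ?n)) ^ k"
    proof -
      have 1: "r / 2 ^ Suc k = r * 2 powr (- (1 + real k))" "r / 2 ^ k = r * 2 powr (- real k)"
        using powr_realpow[of 2 "Suc k"] powr_realpow[of 2 k]
        unfolding powr_minus_divide of_nat_Suc by (simp_all del: power_Suc)
      have 2: "(r / 2 ^ k) ^ DIM('a) = (r / 2 ^ k) powr ?n" using assms by (simp add: powr_realpow)
      have 3: "(2 powr (\<beta> - ?n)) ^ k = 2 powr ((\<beta> - ?n) * real k)"
        by (subst powr_realpow[symmetric]) (simp_all add: powr_powr)
      have 4: "r powr (?n - \<beta>) = r powr (- \<beta>) * r powr ?n"
        by (simp flip: powr_add)
      have 5: "2 powr \<beta> * 2 powr ((\<beta> - ?n) * k) = 2 powr (- (1 + real k) * (- \<beta>)) * 2 powr (- real k * ?n)"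
        by (simp add: algebra_simps flip: powr_add)
      have 6: "(r * 2 powr a) powr b = r powr b * 2 powr (a * b)" for a b
        using assms by (simp add: powr_mult powr_powr)
      have "2 powr \<beta> * unit_ball_vol ?n * r powr (?n - \<beta>) * 2 powr ((\<beta> - ?n) * k) =
          (2 powr \<beta> * 2 powr ((\<beta> - ?n) * k)) * unit_ball_vol ?n * (r powr (- \<beta>) * r powr ?n)"
        unfolding 4 by (simp only: ac_simps)
      then show ?thesis unfolding 2 3 unfolding 1 6 5 by (simp only: ac_simps)
    qed
    finally show ?thesis .
  qed
  have "(\<integral>\<^sup>+x. ennreal (indicator (ball c r) x * norm (x - c) powr (- \<beta>)) \<partial>lborel) \<le> (\<integral>\<^sup>+x. (\<Sum>k. T k x) \<partial>lborel)"
    by (intro nn_integral_mono le)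
  also have "\<dots> = (\<Sum>k. \<integral>\<^sup>+x. T k x \<partial>lborel)"
  proof (rule nn_integral_suminf)
    show "T k \<in> borel_measurable lborel" for k
      unfolding T_def
      by (intro borel_measurable_times_ennreal borel_measurable_const borel_measurable_indicator) simp
  qed
  also have "\<dots> = ennreal (2 powr \<beta> * unit_ball_vol ?n * r powr (?n - \<beta>) * (1 / (1 - 2 powr (\<beta> - ?n))))"
    unfolding T_int
  proof (rule suminf_ennreal_eq)
    show "0 \<le> 2 powr \<beta> * unit_ball_vol ?n * r powr (?n - \<beta>) * (2 powr (\<beta> - ?n)) ^ k" for k
      by (intro mult_nonneg_nonneg zero_le_power unit_ball_vol_nonneg) simp_all
    have "norm ((2::real) powr (\<beta> - ?n)) < 1"
      using two_powr_neg_less_1[of "\<beta> - ?n"] assms by simp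
    from sums_mult[OF geometric_sums[OF this]]
    show "(\<lambda>k. 2 powr \<beta> * unit_ball_vol ?n * r powr (?n - \<beta>) * (2 powr (\<beta> - ?n)) ^ k) sums
      (2 powr \<beta> * unit_ball_vol ?n * r powr (?n - \<beta>) * (1 / (1 - 2 powr (\<beta> - ?n))))" .
  qed
  finally show ?thesis unfolding riesz_const_def by (simp add: mult_ac)
qed

lemma
  fixes c :: "'a::euclidean_space" and \<beta> :: real
  assumes "0 \<le> \<beta>" "\<beta> < DIM('a)" "r > 0"
  shows integrable_riesz: "integrable lborel (\<lambda>x. indicator (ball c r) x * norm (x - c) powr (- \<beta>))"
    and integral_riesz: "integral\<^sup>L lborel (\<lambda>x. indicator (ball c r) x * norm (x - c) powr (- \<beta>))
      \<le> riesz_const DIM('a) \<beta> * r powr (DIM('a) - \<beta>)"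
proof -
  show 1: "integrable lborel (\<lambda>x. indicator (ball c r) x * norm (x - c) powr (- \<beta>))"
  proof (rule integrableI_nonneg)
    show "(\<lambda>x. indicator (ball c r) x * norm (x - c) powr (- \<beta>)) \<in> borel_measurable lborel"
      unfolding measurable_lborel1
      by (intro borel_measurable_times borel_measurable_indicator powr_real_measurable borel_measurable_norm
        borel_measurable_diff) auto
    show "(\<integral>\<^sup>+x. ennreal (indicator (ball c r) x * norm (x - c) powr (- \<beta>)) \<partial>lborel) < \<infinity>"
      using nn_integral_riesz[OF assms, of c] by (simp add: le_less_trans)
  qed auto
  have "ennreal (integral\<^sup>L lborel (\<lambda>x. indicator (ball c r) x * norm (x - c) powr (- \<beta>)))
    \<le> ennreal (riesz_const DIM('a) \<beta> * r powr (DIM('a) - \<beta>))"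
    using nn_integral_riesz[OF assms, of c] nn_integral_eq_integral[OF 1] by simp
  then show "integral\<^sup>L lborel (\<lambda>x. indicator (ball c r) x * norm (x - c) powr (- \<beta>))
      \<le> riesz_const DIM('a) \<beta> * r powr (DIM('a) - \<beta>)"
    using riesz_const_pos[of "DIM('a)" \<beta>] assms by (subst (asm) ennreal_le_iff) auto
qed

section \<open>Integrability near a pole and distributional Laplacians of radial functions\<close>

lemma borel_measurable_except_point:
  fixes f :: "'a::euclidean_space \<Rightarrow> real"
  assumes "continuous_on (- {y}) f"
  shows "f \<in> borel_measurable borel"
proof -
  have "(\<lambda>x. if x \<in> - {y} then f x else f y) \<in> borel_measurable borel"
    by (rule borel_measurable_continuous_on_if) (use assms in auto)
  moreover have "(\<lambda>x. if x \<in> - {y} then f x else f y) = f" by auto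
  ultimately show ?thesis by simp
qed

lemma integrable_riesz_bound:
  fixes f :: "'a::euclidean_space \<Rightarrow> real" and \<beta> :: real
  assumes "f \<in> borel_measurable borel" "0 \<le> \<beta>" "\<beta> < DIM('a)" "r > 0"
    and "\<And>x. x \<noteq> y \<Longrightarrow> x \<in> ball y r \<Longrightarrow> \<bar>f x\<bar> \<le> A * norm (x - y) powr (- \<beta>)" "\<And>x. x \<notin> ball y r \<Longrightarrow> f x = 0"
  shows "integrable lborel f"
proof (rule Bochner_Integration.integrable_bound)
  show "integrable lborel (\<lambda>x. A * (indicator (ball y r) x * norm (x - y) powr (- \<beta>)))"
    by (intro integrable_mult_right integrable_riesz assms)
  have "AE x in lborel. x \<noteq> y" by (rule AE_lborel_singleton)
  then show "AE x in lborel. norm (f x) \<le> norm (A * (indicator (ball y r) x * norm (x - y) powr (- \<beta>)))"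
  proof eventually_elim
    case (elim x)
    show ?case
      using assms(5)[OF elim] assms(6)[of x] by (cases "x \<in> ball y r") (auto intro: order_trans)
  qed
qed (use assms in auto)

text \<open>The profile is shifted to \<open>h (q + e)\<close>, which is smooth at the pole, so the
  classical identity applies; then \<open>e\<close> tends to zero. The condition
  \<open>2 * \<beta> < n\<close> on the size of the derivatives dominates the limit and is what
  excludes a point source at \<open>y\<close>.\<close>

lemma radial_weak_laplacian:
  fixes y :: "'a::euclidean_space" and \<phi> :: "'a \<Rightarrow> real" and \<beta> \<gamma> A R :: real
    and h h1 h2 :: "real \<Rightarrow> real"
  assumes h: "\<And>t. t > 0 \<Longrightarrow> (h has_real_derivative h1 t) (at t)"
    and h1: "\<And>t. t > 0 \<Longrightarrow> (h1 has_real_derivative h2 t) (at t)"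
    and h2: "continuous_on {0<..} h2"
    and \<gamma>: "0 \<le> \<gamma>" "2 * \<gamma> < DIM('a)" and \<beta>: "0 \<le> \<beta>" "2 * \<beta> < DIM('a)"
    and bh: "\<And>t. t > 0 \<Longrightarrow> \<bar>h t\<bar> \<le> A * t powr (- \<gamma>)"
    and bh1: "\<And>t. t > 0 \<Longrightarrow> \<bar>h1 t\<bar> \<le> A * t powr (- \<beta>)"
    and bh2: "\<And>t. t > 0 \<Longrightarrow> \<bar>h2 t\<bar> \<le> A * t powr (- \<beta> - 1)"
    and \<phi>: "Ck_on 2 \<phi> UNIV" and R: "\<And>x. R \<le> norm x \<Longrightarrow> \<phi> x = 0"
  defines "L \<equiv> \<lambda>t::real. 4 * t * h2 t + 2 * real DIM('a) * h1 t"
  shows "integrable lborel (\<lambda>x. h ((norm (x - y))\<^sup>2) * laplacian \<phi> x)" (is ?i1)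
    and "integrable lborel (\<lambda>x. L ((norm (x - y))\<^sup>2) * \<phi> x)" (is ?i2)
    and "integral\<^sup>L lborel (\<lambda>x. h ((norm (x - y))\<^sup>2) * laplacian \<phi> x) =
      integral\<^sup>L lborel (\<lambda>x. L ((norm (x - y))\<^sup>2) * \<phi> x)" (is ?eq)
proof -
  let ?n = "real DIM('a)"
  define q where "q x = (norm (x - y))\<^sup>2" for x
  have q: "q x > 0" if "x \<noteq> y" for x using that by (simp add: q_def)
  have q0: "q x \<ge> 0" for x by (simp add: q_def)
  have cq: "continuous_on S q" for S unfolding q_def by (intro continuous_intros)
  have qp: "q x powr a = norm (x - y) powr (2 * a)" if "x \<noteq> y" for x a
    using that powr_powr[of "norm (x - y)" 2 a] by (simp add: q_def)
  define r where "r = \<bar>R\<bar> + norm y + 2"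
  have r: "r > 0" unfolding r_def using norm_ge_zero[of y] by linarith
  have out: "\<phi> x = 0" "laplacian \<phi> x = 0" if "x \<notin> ball y r" for x
  proof -
    have "norm x \<ge> \<bar>R\<bar> + 2" using that norm_triangle_ineq4[of x y] by (simp add: r_def dist_norm norm_minus_commute)
    then show "\<phi> x = 0" "laplacian \<phi> x = 0" using R[of x] laplacian_zero_outside[OF \<phi> R] by auto
  qed
  have c\<phi>: "continuous_on UNIV \<phi>" "continuous_on UNIV (laplacian \<phi>)"
    using Ck_on_imp_continuous_on[OF \<phi>] continuous_on_laplacian[OF \<phi>] by auto
  obtain M0 where M0: "M0 > 0" "\<And>x. \<bar>\<phi> x\<bar> \<le> M0"
    using continuous_bounded_support[OF c\<phi>(1) R] by blast
  have "laplacian \<phi> x = 0" if "R + 1 \<le> norm x" for x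
    using laplacian_zero_outside[OF \<phi> R] that by simp
  then obtain M1 where M1: "M1 > 0" "\<And>x. \<bar>laplacian \<phi> x\<bar> \<le> M1"
    using continuous_bounded_support[OF c\<phi>(2)] by blast
  define M where "M = max M0 M1"
  have M: "M > 0" "\<bar>\<phi> x\<bar> \<le> M" "\<bar>laplacian \<phi> x\<bar> \<le> M" for x
    using M0 M1(1) M0(2)[of x] M1(2)[of x] by (auto simp: M_def le_max_iff_disj)
  have ch: "continuous_on {0<..} h" "continuous_on {0<..} h1"
    using h h1 by (auto intro!: continuous_at_imp_continuous_on DERIV_isCont)
  have cL: "continuous_on {0<..} L" unfolding L_def by (intro continuous_intros ch h2)
  have A: "A \<ge> 0" using bh1[of 1] by simp
  \<comment> \<open>Two arguments \<open>s <= t\<close> are needed because only the profile is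
    shifted: the Laplacian of \<open>h (q + e)\<close> is
    \<open>4 q h2 (q + e) + 2 n h1 (q + e)\<close>, with an unshifted factor \<open>q\<close>, and
    hence not \<open>L (q + e)\<close>.\<close>
  have bL': "\<bar>4 * s * h2 t + 2 * ?n * h1 t\<bar> \<le> (4 + 2 * ?n) * A * t powr (- \<beta>)" if "t > 0" "0 \<le> s" "s \<le> t" for s t
  proof -
    have "\<bar>s * h2 t\<bar> \<le> t * (A * t powr (- \<beta> - 1))"
      unfolding abs_mult using that bh2[OF that(1)] A by (intro mult_mono) auto
    also have "\<dots> = A * t powr (- \<beta>)" using that by (simp add: powr_diff)
    finally have "\<bar>4 * s * h2 t\<bar> \<le> 4 * (A * t powr (- \<beta>))" by (simp add: abs_mult)
    moreover have "\<bar>2 * ?n * h1 t\<bar> \<le> 2 * ?n * (A * t powr (- \<beta>))"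
      unfolding abs_mult using bh1[OF that(1)] by (intro mult_mono) auto
    ultimately show ?thesis by (simp add: algebra_simps)
  qed
  have m1: "(\<lambda>x. h (q x) * laplacian \<phi> x) \<in> borel_measurable borel"
    by (rule borel_measurable_except_point[of y])
      (intro continuous_intros continuous_on_compose2[OF ch(1)] cq continuous_on_subset[OF c\<phi>(2)]; use q in auto)
  have m2: "(\<lambda>x. L (q x) * \<phi> x) \<in> borel_measurable borel"
    by (rule borel_measurable_except_point[of y])
      (intro continuous_intros continuous_on_compose2[OF cL] cq continuous_on_subset[OF c\<phi>(1)]; use q in auto)
  have b1: "\<bar>h (q x + e) * laplacian \<phi> x\<bar> \<le> A * M * norm (x - y) powr (- (2 * \<gamma>))" if "x \<noteq> y" "e \<ge> 0" for x e
  proof -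
    have "\<bar>h (q x + e)\<bar> \<le> A * (q x + e) powr (- \<gamma>)" using bh q[OF that(1)] that(2) by simp
    also have "\<dots> \<le> A * q x powr (- \<gamma>)"
      using q[OF that(1)] that(2) \<gamma> A by (intro mult_left_mono powr_mono2') auto
    finally have "\<bar>h (q x + e) * laplacian \<phi> x\<bar> \<le> A * q x powr (- \<gamma>) * M"
      unfolding abs_mult using M A by (intro mult_mono) auto
    then show ?thesis using qp[OF that(1)] by (simp add: mult_ac)
  qed
  have b2: "\<bar>(4 * q x * h2 (q x + e) + 2 * ?n * h1 (q x + e)) * \<phi> x\<bar> \<le> (4 + 2 * ?n) * A * M * norm (x - y) powr (- (2 * \<beta>))"
    if "x \<noteq> y" "e \<ge> 0" for x e
  proof -
    have "\<bar>4 * q x * h2 (q x + e) + 2 * ?n * h1 (q x + e)\<bar> \<le> (4 + 2 * ?n) * A * (q x + e) powr (- \<beta>)"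
      using bL'[of "q x + e" "q x"] q[OF that(1)] that(2) by simp
    also have "\<dots> \<le> (4 + 2 * ?n) * A * q x powr (- \<beta>)"
      using q[OF that(1)] that(2) \<beta> A by (intro mult_left_mono powr_mono2') auto
    finally have "\<bar>(4 * q x * h2 (q x + e) + 2 * ?n * h1 (q x + e)) * \<phi> x\<bar> \<le> (4 + 2 * ?n) * A * q x powr (- \<beta>) * M"
      unfolding abs_mult[of _ "\<phi> x"] using M A by (intro mult_mono) auto
    then show ?thesis using qp[OF that(1)] by (simp add: mult_ac)
  qed
  have i1: "integrable lborel (\<lambda>x. h (q x) * laplacian \<phi> x)"
    by (rule integrable_riesz_bound[where \<beta>="2 * \<gamma>" and r=r and y=y and A="A * M"])
      (use m1 \<gamma> r b1[of _ 0] out in auto)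
  then show ?i1 by (simp add: q_def)
  have i2: "integrable lborel (\<lambda>x. L (q x) * \<phi> x)"
    by (rule integrable_riesz_bound[where \<beta>="2 * \<beta>" and r=r and y=y and A="(4 + 2 * ?n) * A * M"])
      (use m2 \<beta> r b2[of _ 0] out in \<open>auto simp: L_def\<close>)
  then show ?i2 by (simp add: q_def)
  define e where "e k = 1 / real (Suc k)" for k
  have e: "e k > 0" for k by (auto simp: e_def)
  have e0: "e \<longlonglongrightarrow> 0" unfolding e_def using LIMSEQ_inverse_real_of_nat by (simp add: inverse_eq_divide)
  have swap: "integral\<^sup>L lborel (\<lambda>x. h (q x + e k) * laplacian \<phi> x) =
     integral\<^sup>L lborel (\<lambda>x. (4 * q x * h2 (q x + e k) + 2 * ?n * h1 (q x + e k)) * \<phi> x)" for k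
  proof -
    let ?u = "\<lambda>x. h (q x + e k)"
    have Ckh: "Ck_on 2 h {0<..}"
      unfolding numeral_2_eq_2
      by (rule Ck_on_real_SucI[OF _ h], simp, simp, rule Ck_on_real_SucI[OF _ h1]) (auto intro: h2)
    have "Ck_on 2 ?u UNIV"
      by (rule Ck_on_compose[OF open_UNIV _ _ Ckh])
        (use e q0 in \<open>auto simp: q_def intro!: Ck_on_add Ck_on_dist_square Ck_on_const add_nonneg_pos\<close>)
    moreover have "laplacian ?u x = 4 * q x * h2 (q x + e k) + 2 * ?n * h1 (q x + e k)" for x
    proof -
      have "laplacian (\<lambda>x. (\<lambda>t. h (t + e k)) ((norm (x - y))\<^sup>2)) x =
        4 * (norm (x - y))\<^sup>2 * h2 ((norm (x - y))\<^sup>2 + e k) + 2 * ?n * (\<lambda>t. h1 (t + e k)) ((norm (x - y))\<^sup>2)"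
      proof (rule laplacian_radial[where T="{- e k<..}" and h="\<lambda>t. h (t + e k)" and h'="\<lambda>t. h1 (t + e k)"])
        show "(norm (x - y))\<^sup>2 \<in> {- e k<..}" using e[of k] by (simp add: less_le_trans[of _ 0])
        show "((\<lambda>t. h (t + e k)) has_real_derivative h1 (t + e k)) (at t)" if "t \<in> {- e k<..}" for t
          using h[of "t + e k"] that by (simp add: DERIV_shift add.commute)
        show "((\<lambda>t. h1 (t + e k)) has_real_derivative h2 ((norm (x - y))\<^sup>2 + e k)) (at ((norm (x - y))\<^sup>2))"
          using h1[of "(norm (x - y))\<^sup>2 + e k"] e[of k] by (simp add: DERIV_shift add_nonneg_pos)
      qed simp
      then show ?thesis by (simp add: q_def)
    qed
    ultimately show ?thesis using integral_laplacian_swap[OF _ \<phi> R, of ?u] by simp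
  qed
  have AEy: "AE x in lborel. x \<noteq> y" by (rule AE_lborel_singleton)
  have conv: "(\<lambda>k. f (q x + e k)) \<longlonglongrightarrow> f (q x)" if "continuous_on {0<..} f" "x \<noteq> y" for f :: "real \<Rightarrow> real" and x
  proof -
    have "isCont f (q x)" using that q by (simp add: continuous_on_eq_continuous_at)
    moreover have "(\<lambda>k. q x + e k) \<longlonglongrightarrow> q x" using tendsto_add[OF tendsto_const e0] by simp
    ultimately show ?thesis by (rule isCont_tendsto_compose)
  qed
  have "(\<lambda>k. integral\<^sup>L lborel (\<lambda>x. h (q x + e k) * laplacian \<phi> x)) \<longlonglongrightarrow> integral\<^sup>L lborel (\<lambda>x. h (q x) * laplacian \<phi> x)"
  proof (rule integral_dominated_convergence[where w="\<lambda>x. A * M * (indicator (ball y r) x * norm (x - y) powr (- (2 * \<gamma>)))"])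
    show "integrable lborel (\<lambda>x. A * M * (indicator (ball y r) x * norm (x - y) powr (- (2 * \<gamma>))))"
      by (intro integrable_mult_right integrable_riesz) (use \<gamma> r in auto)
    show "AE x in lborel. (\<lambda>k. h (q x + e k) * laplacian \<phi> x) \<longlonglongrightarrow> h (q x) * laplacian \<phi> x"
      using AEy by eventually_elim (intro tendsto_mult conv ch tendsto_const)
    show "AE x in lborel. norm (h (q x + e k) * laplacian \<phi> x) \<le> A * M * (indicator (ball y r) x * norm (x - y) powr (- (2 * \<gamma>)))" for k
      using AEy
    proof eventually_elim
      case (elim x)
      then show ?case using b1[OF elim, of "e k"] e[of k] out[of x] by (cases "x \<in> ball y r") auto
    qed
    show "(\<lambda>x. h (q x + e k) * laplacian \<phi> x) \<in> borel_measurable lborel" for k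
      unfolding measurable_lborel2
      by (rule borel_measurable_continuous_onI)
        (intro continuous_intros continuous_on_compose2[OF ch(1)] cq c\<phi>; use q0 e in \<open>auto intro!: add_nonneg_pos\<close>)
  qed (use m1 in simp)
  moreover have "(\<lambda>k. integral\<^sup>L lborel (\<lambda>x. (4 * q x * h2 (q x + e k) + 2 * ?n * h1 (q x + e k)) * \<phi> x)) \<longlonglongrightarrow> integral\<^sup>L lborel (\<lambda>x. L (q x) * \<phi> x)"
  proof (rule integral_dominated_convergence[where w="\<lambda>x. (4 + 2 * ?n) * A * M * (indicator (ball y r) x * norm (x - y) powr (- (2 * \<beta>)))"])
    show "integrable lborel (\<lambda>x. (4 + 2 * ?n) * A * M * (indicator (ball y r) x * norm (x - y) powr (- (2 * \<beta>))))"
      by (intro integrable_mult_right integrable_riesz) (use \<beta> r in auto)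
    show "AE x in lborel. (\<lambda>k. (4 * q x * h2 (q x + e k) + 2 * ?n * h1 (q x + e k)) * \<phi> x) \<longlonglongrightarrow> L (q x) * \<phi> x"
      unfolding L_def using AEy by eventually_elim (intro tendsto_mult tendsto_add conv ch h2 tendsto_const)
    show "AE x in lborel. norm ((4 * q x * h2 (q x + e k) + 2 * ?n * h1 (q x + e k)) * \<phi> x) \<le> (4 + 2 * ?n) * A * M * (indicator (ball y r) x * norm (x - y) powr (- (2 * \<beta>)))" for k
      using AEy
    proof eventually_elim
      case (elim x)
      then show ?case using b2[OF elim, of "e k"] e[of k] out[of x] by (cases "x \<in> ball y r") auto
    qed
    show "(\<lambda>x. (4 * q x * h2 (q x + e k) + 2 * ?n * h1 (q x + e k)) * \<phi> x) \<in> borel_measurable lborel" for k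
      unfolding measurable_lborel2
      by (rule borel_measurable_continuous_onI)
        (intro continuous_intros continuous_on_compose2[OF ch(2)] continuous_on_compose2[OF h2] cq c\<phi>; use q0 e in \<open>auto intro!: add_nonneg_pos\<close>)
  qed (use m2 in simp)
  ultimately have "integral\<^sup>L lborel (\<lambda>x. h (q x) * laplacian \<phi> x) = integral\<^sup>L lborel (\<lambda>x. L (q x) * \<phi> x)"
    unfolding swap by (rule LIMSEQ_unique)
  then show ?eq by (simp add: q_def)
qed

lemma not_AE_lborel_ball:
  assumes "AE x in lborel. x \<notin> ball (c::'a::euclidean_space) r" "r > 0"
  shows False
proof -
  have "emeasure lborel (ball c r) = 0"
    using assms(1) by (subst (asm) AE_iff_measurable[OF _ refl]) (auto simp: ball_def)
  moreover have "unit_ball_vol (real DIM('a)) * r ^ DIM('a) > 0"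
    using assms(2) by (simp add: unit_ball_vol_pos)
  ultimately show False using assms(2) by (simp add: emeasure_ball ennreal_eq_0_iff)
qed

subsection \<open>The smoothed Newtonian kernel\<close>

text \<open>Fixes one output of \<open>ex_newton_profile\<close> for the dimension of
  \<open>'a\<close>. The profile functions live on the reals and do not mention the space, so the
  type enters through \<open>T\<close>.\<close>

locale newton_profile =
  fixes \<Theta> \<Theta>1 \<Theta>2 E :: "real \<Rightarrow> real" and T :: "'a::euclidean_space itself"
  assumes dim: "DIM('a) > 2"
    and smooth: "Ck_on k \<Theta> UNIV" "Ck_on k E UNIV"
    and deriv: "(\<Theta> has_real_derivative \<Theta>1 t) (at t)" "(\<Theta>1 has_real_derivative \<Theta>2 t) (at t)"
    and far: "1 \<le> t \<Longrightarrow> \<Theta> t = t powr (1 - real DIM('a) / 2)"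
    and bound: "0 < t \<Longrightarrow> 0 \<le> \<Theta> t" "0 < t \<Longrightarrow> \<Theta> t \<le> t powr (1 - real DIM('a) / 2)"
    and E_eq: "E t = - (4 * t * \<Theta>2 t + 2 * real DIM('a) * \<Theta>1 t)"
    and E_nonneg: "0 \<le> E t" and E_pos: "1/4 < t \<Longrightarrow> t < 1 \<Longrightarrow> 0 < E t" and E_far: "1 \<le> t \<Longrightarrow> E t = 0"
begin

text \<open>\<open>N R\<close> is \<open>|x|^(2 - n)\<close> smoothed inside the ball of radius \<open>R\<close>, and \<open>\<eta> R = - \<Delta> (N R)\<close> is an
  approximate identity of total mass \<open>\<kappa>\<close>.  The exact value of \<open>\<kappa>\<close> is irrelevant; only
  \<open>\<kappa> > 0\<close> is used.\<close>

definition N :: "real \<Rightarrow> 'a \<Rightarrow> real" where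
  "N R x = R powr (2 - real DIM('a)) * \<Theta> ((norm x)\<^sup>2 / R\<^sup>2)"

definition \<eta> :: "real \<Rightarrow> 'a \<Rightarrow> real" where
  "\<eta> R x = R powr (- real DIM('a)) * E ((norm x)\<^sup>2 / R\<^sup>2)"

definition \<kappa> :: real where "\<kappa> = integral\<^sup>L lborel (\<eta> 1)"

lemma Ck_N: "Ck_on k (\<lambda>x. N R (x - a)) UNIV"
  unfolding N_def divide_inverse
  by (intro Ck_on_cmult Ck_on_compose[OF _ _ open_UNIV smooth(1)] Ck_on_mult Ck_on_dist_square Ck_on_const) auto

lemma Ck_\<eta>: "Ck_on k (\<lambda>x. \<eta> R (x - a)) UNIV"
  unfolding \<eta>_def divide_inverse
  by (intro Ck_on_cmult Ck_on_compose[OF _ _ open_UNIV smooth(2)] Ck_on_mult Ck_on_dist_square Ck_on_const) auto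

lemma scaled_square_powr:
  assumes "R > 0" "x \<noteq> 0"
  shows "R powr (2 - real DIM('a)) * ((norm (x::'a))\<^sup>2 / R\<^sup>2) powr (1 - real DIM('a) / 2) = norm x powr (2 - real DIM('a))"
proof -
  have "(norm x)\<^sup>2 / R\<^sup>2 = (norm x / R) powr 2" using assms by (simp add: power_divide)
  then have "((norm x)\<^sup>2 / R\<^sup>2) powr (1 - real DIM('a) / 2) = (norm x / R) powr (2 - real DIM('a))"
    using powr_powr[of "norm x / R" 2 "1 - real DIM('a) / 2"] by (simp add: algebra_simps)
  then show ?thesis using assms by (simp add: powr_divide)
qed

lemma N_far:
  assumes "R > 0" "R \<le> norm x" shows "N R x = norm x powr (2 - real DIM('a))"
proof -
  have "1 \<le> (norm x)\<^sup>2 / R\<^sup>2" using assms by (simp add: power_mono)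
  moreover have "x \<noteq> 0" using assms by auto
  ultimately show ?thesis
    unfolding N_def using scaled_square_powr[OF assms(1)] by (simp only: far)
qed

lemma N_bound:
  assumes "R > 0" "x \<noteq> 0"
  shows "0 \<le> N R x" "N R x \<le> norm x powr (2 - real DIM('a))"
proof -
  have t: "(norm x)\<^sup>2 / R\<^sup>2 > 0" using assms by simp
  show "0 \<le> N R x" using bound(1)[OF t] by (simp add: N_def)
  show "N R x \<le> norm x powr (2 - real DIM('a))"
    unfolding N_def scaled_square_powr[OF assms, symmetric]
    using bound(2)[OF t] by (intro mult_left_mono) auto
qed

lemma \<eta>_nonneg: "0 \<le> \<eta> R x" by (simp add: \<eta>_def E_nonneg)

lemma \<eta>_far: "R > 0 \<Longrightarrow> R \<le> norm x \<Longrightarrow> \<eta> R x = 0"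
  unfolding \<eta>_def by (subst E_far) (auto simp: power_mono divide_simps)

lemma \<eta>_pos: "R > 0 \<Longrightarrow> R / 2 < norm x \<Longrightarrow> norm x < R \<Longrightarrow> 0 < \<eta> R x"
proof -
  assume R: "R > 0" "R / 2 < norm x" "norm x < R"
  have "(R / 2)\<^sup>2 < (norm x)\<^sup>2" "(norm x)\<^sup>2 < R\<^sup>2" using R by (auto intro!: power_strict_mono)
  then have "0 < E ((norm x)\<^sup>2 / R\<^sup>2)" using R by (intro E_pos) (auto simp: divide_simps power_divide)
  then show ?thesis using R by (simp add: \<eta>_def)
qed

lemma laplacian_N:
  assumes "R > 0" shows "laplacian (\<lambda>x. N R (x - a)) x = - \<eta> R (x - a)"
proof -
  let ?c = "R powr (2 - real DIM('a))"
  have d: "((\<lambda>t. ?c * \<Theta> (t / R\<^sup>2)) has_real_derivative (?c * \<Theta>1 (t / R\<^sup>2) / R\<^sup>2)) (at t)"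
    "((\<lambda>t. ?c * \<Theta>1 (t / R\<^sup>2) / R\<^sup>2) has_real_derivative (?c * \<Theta>2 (t / R\<^sup>2) / R\<^sup>2 / R\<^sup>2)) (at t)" for t
    using DERIV_cmult[OF DERIV_chain2[OF deriv(1) DERIV_cdivide[OF DERIV_ident]], of ?c "R\<^sup>2" t]
      DERIV_cdivide[OF DERIV_cmult[OF DERIV_chain2[OF deriv(2) DERIV_cdivide[OF DERIV_ident]], of ?c "R\<^sup>2" t], of "R\<^sup>2"]
    by simp_all
  have "laplacian (\<lambda>x. (\<lambda>t. ?c * \<Theta> (t / R\<^sup>2)) ((norm (x - a))\<^sup>2)) x =
    4 * (norm (x - a))\<^sup>2 * (?c * \<Theta>2 ((norm (x - a))\<^sup>2 / R\<^sup>2) / R\<^sup>2 / R\<^sup>2) + 2 * real DIM('a) * (\<lambda>t. ?c * \<Theta>1 (t / R\<^sup>2) / R\<^sup>2) ((norm (x - a))\<^sup>2)"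
    by (rule laplacian_radial[where T=UNIV]) (use d in auto)
  moreover have "R powr (- real DIM('a)) = ?c / R\<^sup>2"
    using assms by (simp add: powr_diff powr_minus_divide)
  ultimately show ?thesis
    unfolding N_def \<eta>_def E_eq by (simp add: algebra_simps)
qed

lemma laplacian_N_diff:
  assumes "R > 0" "r > 0"
  shows "laplacian (\<lambda>x. N r (x - a) - N R (x - a)) x = \<eta> R (x - a) - \<eta> r (x - a)"
  using laplacian_lincomb[OF open_UNIV UNIV_I Ck_N Ck_N, of 1 r a "-1" R a x] assms
  by (simp add: laplacian_N)

lemma Ck_N_diff: "Ck_on k (\<lambda>x. N r (x - a) - N R (x - a)) UNIV"
  by (intro Ck_on_diff Ck_N open_UNIV)

lemma N_diff_far: "0 < r \<Longrightarrow> r \<le> R \<Longrightarrow> R \<le> norm (x - a) \<Longrightarrow> N r (x - a) - N R (x - a) = 0"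
  by (simp add: N_far)

text \<open>A single kernel \<open>N R\<close> decays but has no compact support. Two of them
  coincide outside the larger ball, so their difference is an admissible test function; this is the
  only kind of test function that the representation formula uses.\<close>

lemma test_function_N_diff:
  assumes "0 < r" "r \<le> R" "cball a R \<subseteq> \<Omega>"
  shows "test_function \<Omega> (\<lambda>x. N r (x - a) - N R (x - a))"
proof -
  have "{x. N r (x - a) - N R (x - a) \<noteq> 0} \<subseteq> cball a R"
  proof
    fix x assume "x \<in> {x. N r (x - a) - N R (x - a) \<noteq> 0}"
    then show "x \<in> cball a R"
      using N_diff_far[OF assms(1,2), of x a] by (cases "R \<le> norm (x - a)") (auto simp: dist_norm norm_minus_commute)
  qed
  then have s: "closure {x. N r (x - a) - N R (x - a) \<noteq> 0} \<subseteq> cball a R"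
    by (intro closure_minimal) auto
  then have "compact (closure {x. N r (x - a) - N R (x - a) \<noteq> 0})"
    by (meson bounded_cball bounded_subset closed_closure compact_eq_bounded_closed)
  with s assms(3) Ck_N_diff show ?thesis unfolding test_function_def Cinf_on_def by blast
qed

lemma integrable_\<eta>: "R > 0 \<Longrightarrow> integrable lborel (\<lambda>x. \<eta> R (x - a))"
proof (rule integrable_continuous_bounded_support[where R="R + norm a"])
  show "continuous_on UNIV (\<lambda>x. \<eta> R (x - a))" using Ck_on_imp_continuous_on[OF Ck_\<eta>] .
  show "\<eta> R (x - a) = 0" if "R > 0" "R + norm a \<le> norm x" for x
    using \<eta>_far[of R "x - a"] that norm_triangle_ineq2[of x a] by linarith
qed

text \<open>Independence of \<open>R\<close> and of the centre: \<open>\<eta> R - \<eta> r\<close>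
  is the Laplacian of a function with bounded support, and integrating it against the constant
  \<open>1\<close> gives zero. Translation invariance moves the centre.\<close>

lemma integral_\<eta>:
  assumes "R > 0" shows "integral\<^sup>L lborel (\<lambda>x. \<eta> R (x - a)) = \<kappa>"
proof -
  have main: "integral\<^sup>L lborel (\<eta> r) = integral\<^sup>L lborel (\<eta> R)" if "0 < r" "r \<le> R" for r R
  proof -
    let ?\<phi> = "\<lambda>x. N r (x - 0) - N R (x - 0)"
    have "integral\<^sup>L lborel (\<lambda>x. 1 * laplacian ?\<phi> x) = integral\<^sup>L lborel (\<lambda>x. laplacian (\<lambda>_. 1) x * ?\<phi> x)"
      by (rule integral_laplacian_swap[where R=R]) (use that N_diff_far[of r R _ 0] Ck_N_diff[of 2 r 0 R] in \<open>auto intro: Ck_on_const\<close>)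
    moreover have "laplacian (\<lambda>_. 1) x = 0" for x :: 'a
      using laplacian_eq[of UNIV x "\<lambda>_. 1" "\<lambda>_ _. 0" "\<lambda>_ _. 0"] by simp
    ultimately have "integral\<^sup>L lborel (\<lambda>x. \<eta> R (x - 0) - \<eta> r (x - 0)) = 0"
      using laplacian_N_diff[of R r 0] that by simp
    then show ?thesis using integrable_\<eta>[of r 0] integrable_\<eta>[of R 0] that by simp
  qed
  have "integral\<^sup>L lborel (\<lambda>x. \<eta> R (x - a)) = integral\<^sup>L lborel (\<eta> R)"
    using integral_lborel_translate[of "\<eta> R" "- a"] by simp
  also have "\<dots> = \<kappa>" unfolding \<kappa>_def using main[of R 1] main[of 1 R] assms by (cases "R \<le> 1") auto
  finally show ?thesis .
qed

lemma \<kappa>_pos: "\<kappa> > 0"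
proof -
  have "\<kappa> \<ge> 0" unfolding \<kappa>_def by (simp add: \<eta>_nonneg)
  moreover have "\<kappa> \<noteq> 0"
  proof
    assume "\<kappa> = 0"
    then have "AE x in lborel. \<eta> 1 (x - 0) = 0"
      unfolding \<kappa>_def using integrable_\<eta>[of 1 0] by (subst (asm) integral_nonneg_eq_0_iff_AE) (auto simp: \<eta>_nonneg)
    obtain b :: 'a where b: "norm b = 1" using vector_choose_size[of 1] by auto
    have pos: "\<eta> 1 x > 0" if "x \<in> ball ((3/4) *\<^sub>R b) (1/8)" for x
    proof (rule \<eta>_pos)
      have n: "norm ((3/4) *\<^sub>R b) = 3/4" using b by simp
      show "1 / 2 < norm x" "norm x < 1"
        using that norm_triangle_ineq2[of "(3/4) *\<^sub>R b" x] norm_triangle_ineq2[of x "(3/4) *\<^sub>R b"] n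
        by (auto simp: dist_norm norm_minus_commute)
    qed simp
    have "AE x in lborel. x \<notin> ball ((3/4) *\<^sub>R b) (1/8)"
      using \<open>AE x in lborel. \<eta> 1 (x - 0) = 0\<close>
    proof eventually_elim
      case (elim x)
      then show ?case using pos[of x] by (intro notI) simp
    qed
    then show False by (rule not_AE_lborel_ball) simp
  qed
  ultimately show ?thesis by simp
qed

lemma \<eta>_bounded:
  assumes "R > 0"
  obtains M where "M > 0" "\<And>x. \<bar>\<eta> R (x - a)\<bar> \<le> M"
proof -
  have "\<eta> R (x - a) = 0" if "R + norm a \<le> norm x" for x
    using \<eta>_far[of R "x - a"] assms that norm_triangle_ineq2[of x a] by linarith
  with continuous_bounded_support[OF Ck_on_imp_continuous_on[OF Ck_\<eta>[of 0 R a]]] that show ?thesis by metis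
qed

lemma integrable_mult_\<eta>:
  assumes "integrable lborel u" "R > 0"
  shows "integrable lborel (\<lambda>x. u x * \<eta> R (x - a))"
proof -
  obtain M where M: "M > 0" "\<And>x. \<bar>\<eta> R (x - a)\<bar> \<le> M" using \<eta>_bounded[of R a] assms(2) by metis
  show ?thesis
  proof (rule Bochner_Integration.integrable_bound)
    show "integrable lborel (\<lambda>x. M * u x)" using assms(1) by (rule integrable_mult_right)
    show "(\<lambda>x. u x * \<eta> R (x - a)) \<in> borel_measurable lborel"
      using borel_measurable_integrable[OF assms(1)] borel_measurable_integrable[OF integrable_\<eta>[OF assms(2)]]
      by (rule borel_measurable_times)
    show "AE x in lborel. norm (u x * \<eta> R (x - a)) \<le> norm (M * u x)"
      using M(1) mult_right_mono[OF M(2), of "\<bar>u _\<bar>"] by (intro AE_I2) (simp add: abs_mult mult.commute)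
  qed
qed

lemma \<eta>_approximates:
  assumes u: "integrable lborel u" "isCont u a" and e: "e \<longlonglongrightarrow> 0" "\<And>k. e k > 0"
  shows "(\<lambda>k. integral\<^sup>L lborel (\<lambda>x. u x * \<eta> (e k) (x - a))) \<longlonglongrightarrow> \<kappa> * u a"
proof (rule LIMSEQ_I)
  fix \<delta> :: real assume \<delta>: "\<delta> > 0"
  define d where "d = \<delta> / (2 * \<kappa>)"
  have d: "d > 0" using \<delta> \<kappa>_pos by (simp add: d_def)
  then obtain r where r: "r > 0" "\<And>x. dist x a < r \<Longrightarrow> \<bar>u x - u a\<bar> < d"
    using u(2) unfolding continuous_at_eps_delta by (metis dist_real_def)
  obtain K where K: "\<And>k. k \<ge> K \<Longrightarrow> e k < r"
    using LIMSEQ_D[OF e(1) r(1)] e(2) by (auto simp: abs_of_pos)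
  show "\<exists>no. \<forall>k\<ge>no. norm (integral\<^sup>L lborel (\<lambda>x. u x * \<eta> (e k) (x - a)) - \<kappa> * u a) < \<delta>"
  proof (intro exI[of _ K] allI impI)
    fix k assume k: "k \<ge> K"
    let ?h = "\<lambda>x. \<eta> (e k) (x - a)"
    have i: "integrable lborel (\<lambda>x. u x * ?h x)" "integrable lborel ?h"
      using integrable_mult_\<eta>[OF u(1) e(2)] integrable_\<eta>[OF e(2)] by auto
    have "integral\<^sup>L lborel (\<lambda>x. u x * ?h x) - \<kappa> * u a = integral\<^sup>L lborel (\<lambda>x. u x * ?h x - u a * ?h x)"
      using i integral_\<eta>[OF e(2)[of k]] by simp
    moreover have "norm (integral\<^sup>L lborel (\<lambda>x. u x * ?h x - u a * ?h x)) \<le> integral\<^sup>L lborel (\<lambda>x. d * ?h x)"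
    proof (rule order_trans[OF integral_norm_bound], rule integral_mono)
      show "norm (u x * ?h x - u a * ?h x) \<le> d * ?h x" for x
      proof (cases "dist x a < e k")
        case True
        have "norm (u x * ?h x - u a * ?h x) = \<bar>u x - u a\<bar> * ?h x"
          by (simp add: left_diff_distrib[symmetric] abs_mult \<eta>_nonneg)
        also have "\<dots> \<le> d * ?h x"
          using r(2)[of x] True K[OF k] by (intro mult_right_mono) (auto simp: \<eta>_nonneg)
        finally show ?thesis .
      next
        case False
        then show ?thesis using \<eta>_far[OF e(2), of k "x - a"] by (simp add: dist_norm)
      qed
    qed (use i in auto)
    moreover have "integral\<^sup>L lborel (\<lambda>x. d * ?h x) = \<delta> / 2"
      using integral_\<eta>[OF e(2)[of k]] \<kappa>_pos by (simp add: d_def)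
    ultimately show "norm (integral\<^sup>L lborel (\<lambda>x. u x * \<eta> (e k) (x - a)) - \<kappa> * u a) < \<delta>"
      using \<delta> by simp
  qed
qed

text \<open>Testing with \<open>N r - N R\<close> gives the identity with \<open>\<eta> r\<close>
  and \<open>N r\<close> in place of \<open>\<kappa> * u a\<close> and the singular kernel. As
  \<open>r\<close> tends to zero, \<open>\<eta> r\<close> is an approximate identity, which needs
  continuity of \<open>u\<close> only at \<open>a\<close>, and
  \<open>0 <= N r <= |x - a|^(2 - n)\<close> dominates the other integral.\<close>

lemma weak_representation:
  assumes u: "integrable lborel u" "isCont u a" and f: "f \<in> borel_measurable borel"
    and fi: "integrable lborel (\<lambda>x. f x * norm (x - a) powr (2 - real DIM('a)))"
    and weak: "\<And>\<phi>. test_function \<Omega> \<phi> \<Longrightarrow> integral\<^sup>L lborel (\<lambda>x. u x * laplacian \<phi> x) = - integral\<^sup>L lborel (\<lambda>x. f x * \<phi> x)"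
    and R: "R > 0" "cball a R \<subseteq> \<Omega>"
  shows "\<kappa> * u a = integral\<^sup>L lborel (\<lambda>x. u x * \<eta> R (x - a)) +
    integral\<^sup>L lborel (\<lambda>x. f x * (norm (x - a) powr (2 - real DIM('a)) - N R (x - a)))"
proof -
  let ?p = "\<lambda>x. norm (x - a) powr (2 - real DIM('a))"
  define e where "e k = R / real (Suc k)" for k
  have e: "e k > 0" "e k \<le> R" for k using R by (auto simp: e_def divide_le_eq)
  have e0: "e \<longlonglongrightarrow> 0"
    unfolding e_def using tendsto_mult[OF tendsto_const LIMSEQ_inverse_real_of_nat, of R] by (simp add: divide_inverse)
  have eq: "integral\<^sup>L lborel (\<lambda>x. u x * \<eta> (e k) (x - a)) = integral\<^sup>L lborel (\<lambda>x. u x * \<eta> R (x - a)) +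
     integral\<^sup>L lborel (\<lambda>x. f x * (N (e k) (x - a) - N R (x - a)))" for k
    using weak[OF test_function_N_diff[OF e(1) e(2) R(2)], of k] integrable_mult_\<eta>[OF u(1) e(1)[of k]] integrable_mult_\<eta>[OF u(1) R(1)]
    by (simp add: laplacian_N_diff R e right_diff_distrib)
  have AEa: "AE x in lborel. x \<noteq> a" by (rule AE_lborel_singleton)
  have mN: "(\<lambda>x. N r (x - a)) \<in> borel_measurable borel" for r
    by (rule borel_measurable_continuous_onI[OF Ck_on_imp_continuous_on[OF Ck_N]])
  have mp: "?p \<in> borel_measurable borel"
    by (intro powr_real_measurable borel_measurable_norm borel_measurable_diff) auto
  have "(\<lambda>k. integral\<^sup>L lborel (\<lambda>x. f x * (N (e k) (x - a) - N R (x - a)))) \<longlonglongrightarrow>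
     integral\<^sup>L lborel (\<lambda>x. f x * (?p x - N R (x - a)))"
  proof (rule integral_dominated_convergence[where w="\<lambda>x. norm (f x * ?p x)"])
    show "(\<lambda>x. f x * (?p x - N R (x - a))) \<in> borel_measurable lborel"
      "(\<lambda>x. f x * (N (e k) (x - a) - N R (x - a))) \<in> borel_measurable lborel" for k
      unfolding measurable_lborel2 using f mN mp by (intro borel_measurable_times borel_measurable_diff; simp)+
    show "integrable lborel (\<lambda>x. norm (f x * ?p x))" using fi by (rule integrable_norm)
    show "AE x in lborel. (\<lambda>k. f x * (N (e k) (x - a) - N R (x - a))) \<longlonglongrightarrow> f x * (?p x - N R (x - a))"
      using AEa
    proof eventually_elim
      case (elim x)
      then have "norm (x - a) > 0" by simp
      then have "eventually (\<lambda>k. e k < norm (x - a)) sequentially" using e0 by (rule order_tendstoD(2)[rotated])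
      then have "eventually (\<lambda>k. f x * (N (e k) (x - a) - N R (x - a)) = f x * (?p x - N R (x - a))) sequentially"
        by eventually_elim (simp add: N_far e)
      then show ?case by (rule tendsto_eventually)
    qed
    show "AE x in lborel. norm (f x * (N (e k) (x - a) - N R (x - a))) \<le> norm (f x * ?p x)" for k
      using AEa
    proof eventually_elim
      case (elim x)
      then have "\<bar>N (e k) (x - a) - N R (x - a)\<bar> \<le> ?p x"
        using N_bound[OF e(1)[of k], of "x - a"] N_bound[OF R(1), of "x - a"] by simp
      then show ?case by (auto simp: abs_mult intro: mult_left_mono)
    qed
  qed
  from tendsto_add[OF tendsto_const this] have "(\<lambda>k. integral\<^sup>L lborel (\<lambda>x. u x * \<eta> (e k) (x - a))) \<longlonglongrightarrow>
     integral\<^sup>L lborel (\<lambda>x. u x * \<eta> R (x - a)) + integral\<^sup>L lborel (\<lambda>x. f x * (?p x - N R (x - a)))"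
    unfolding eq .
  then show ?thesis using \<eta>_approximates[OF u e0 e(1)] LIMSEQ_unique by blast
qed

text \<open>Among the points where a negative minimum is attained, take one closest to the frontier.
  The mean inequality with the nonnegative weight \<open>\<eta> \<rho>\<close> forces
  \<open>u\<close> to equal the minimum almost everywhere where the weight is positive. A point of
  that annulus on the segment to the nearest frontier point is closer to the frontier, hence no
  minimum point, and by continuity neither is a small ball around it.\<close>

lemma min_principle:
  assumes \<Omega>: "open \<Omega>" "bounded \<Omega>" and u: "continuous_on (closure \<Omega>) u"
    and mean: "\<And>a R. a \<in> \<Omega> \<Longrightarrow> R > 0 \<Longrightarrow> cball a R \<subseteq> \<Omega> \<Longrightarrow>
      integral\<^sup>L lborel (\<lambda>x. indicator \<Omega> x * u x * \<eta> R (x - a)) \<le> \<kappa> * u a"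
    and bd: "\<And>x. x \<in> frontier \<Omega> \<Longrightarrow> 0 \<le> u x" and x: "x \<in> \<Omega>"
  shows "0 \<le> u x"
proof (rule ccontr)
  assume "\<not> 0 \<le> u x"
  have K: "compact (closure \<Omega>)" using \<Omega>(2) by simp
  obtain x0 where x0: "x0 \<in> closure \<Omega>" "\<And>y. y \<in> closure \<Omega> \<Longrightarrow> u x0 \<le> u y"
    using continuous_attains_inf[OF K _ u] x closure_subset by blast
  define m where "m = u x0"
  have m: "m < 0" using x0(2)[of x] x closure_subset[of \<Omega>] \<open>\<not> 0 \<le> u x\<close> by (auto simp: m_def)
  define Z where "Z = {y \<in> closure \<Omega>. u y = m}"
  have Z: "compact Z" "x0 \<in> Z"
    unfolding Z_def using x0 continuous_closed_preimage_constant[OF u, of m] K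
    by (auto simp: m_def compact_eq_bounded_closed elim: bounded_subset)
  have Z\<Omega>: "Z \<subseteq> \<Omega>" using bd m by (force simp: Z_def closure_Un_frontier)
  have fr: "frontier \<Omega> \<noteq> {}" "closed (frontier \<Omega>)"
    using frontier_eq_empty[of \<Omega>] x \<Omega>(2) not_bounded_UNIV by auto
  obtain a where a: "a \<in> Z" "\<And>y. y \<in> Z \<Longrightarrow> infdist a (frontier \<Omega>) \<le> infdist y (frontier \<Omega>)"
    using continuous_attains_inf[OF Z(1), of "\<lambda>y. infdist y (frontier \<Omega>)"] Z(2) continuous_on_infdist[OF continuous_on_id]
    by (metis empty_iff)
  obtain z where z: "z \<in> frontier \<Omega>" "infdist a (frontier \<Omega>) = dist a z"
    using infdist_attains_inf[OF fr(2,1)] by blast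
  define R where "R = dist a z"
  have a\<Omega>: "a \<in> \<Omega>" using a Z\<Omega> by auto
  have "z \<notin> \<Omega>" using z(1) \<Omega>(1) by (simp add: frontier_def interior_open)
  then have R: "R > 0" using a\<Omega> by (auto simp: R_def)
  \<comment> \<open>The weight \<open>\<eta> \<rho>\<close> is known to be positive for distances
    between \<open>2/5 R\<close> and \<open>4/5 R\<close>. The point \<open>w\<close> below sits at
    \<open>3/4 R\<close>, which leaves a margin \<open>R / 20\<close>, more than the radius
    \<open>R / 25\<close> allowed later.\<close>
  define \<rho> where "\<rho> = (4/5) * R"
  have \<rho>: "\<rho> > 0" "\<rho> < R" using R by (auto simp: \<rho>_def)
  have sub: "cball a \<rho> \<subseteq> \<Omega>"
  proof (rule ccontr)
    assume "\<not> cball a \<rho> \<subseteq> \<Omega>"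
    then have "cball a \<rho> - \<Omega> \<noteq> {}" by auto
    moreover have "a \<in> cball a \<rho> \<inter> \<Omega>" using a\<Omega> \<rho> by simp
    ultimately have "cball a \<rho> \<inter> frontier \<Omega> \<noteq> {}"
      using connected_Int_frontier[OF connected_cball, of a \<rho> \<Omega>] by blast
    then obtain w where "w \<in> cball a \<rho>" "w \<in> frontier \<Omega>" by blast
    then have "R \<le> \<rho>" using z(2) infdist_le[of w "frontier \<Omega>" a] by (auto simp: R_def)
    then show False using \<rho> by simp
  qed
  let ?w = "\<lambda>x. indicator \<Omega> x * u x - indicator \<Omega> x * m"
  have iu: "integrable lborel (\<lambda>x. indicator \<Omega> x * u x)"
  proof -
    obtain B where B: "\<And>y. y \<in> closure \<Omega> \<Longrightarrow> \<bar>u y\<bar> \<le> B"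
      using compact_imp_bounded[OF compact_continuous_image[OF u K]] by (auto simp: bounded_iff)
    have 1: "\<bar>indicator \<Omega> x * u x\<bar> \<le> max B 0" for x
      using B[of x] closure_subset[of \<Omega>] by (auto simp: indicator_def le_max_iff_disj)
    obtain r where r: "\<And>y. y \<in> \<Omega> \<Longrightarrow> norm y \<le> r" using \<Omega>(2) by (auto simp: bounded_iff)
    have 2: "indicator \<Omega> x * u x = 0" if "r + 1 \<le> norm x" for x
      using r[of x] that by (auto simp: indicator_def)
    have "(\<lambda>x. indicator \<Omega> x * u x) \<in> borel_measurable borel"
      using borel_measurable_continuous_on_indicator[of \<Omega> u] \<Omega>(1) continuous_on_subset[OF u closure_subset] by simp
    then show ?thesis using 1 2 by (rule integrable_bounded_support)
  qed
  have i\<eta>: "integrable lborel (\<lambda>x. \<eta> \<rho> (x - a))" by (rule integrable_\<eta>[OF \<rho>(1)])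
  have in\<Omega>: "indicator \<Omega> x * \<eta> \<rho> (x - a) = \<eta> \<rho> (x - a)" for x
  proof (cases "x \<in> cball a \<rho>")
    case True
    then show ?thesis using sub by auto
  next
    case False
    then show ?thesis using \<eta>_far[OF \<rho>(1), of "x - a"] by (simp add: dist_norm norm_minus_commute)
  qed
  have g: "?w x * \<eta> \<rho> (x - a) = indicator \<Omega> x * u x * \<eta> \<rho> (x - a) - m * \<eta> \<rho> (x - a)" for x
    using in\<Omega>[of x] by (simp add: left_diff_distrib algebra_simps)
  have ig: "integrable lborel (\<lambda>x. ?w x * \<eta> \<rho> (x - a))"
    unfolding g using integrable_mult_\<eta>[OF iu \<rho>(1)] i\<eta> by simp
  have g0: "0 \<le> ?w x * \<eta> \<rho> (x - a)" for x
    using x0(2)[of x] closure_subset[of \<Omega>] \<eta>_nonneg[of \<rho> "x - a"] by (auto simp: indicator_def m_def)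
  have "integral\<^sup>L lborel (\<lambda>x. ?w x * \<eta> \<rho> (x - a)) = integral\<^sup>L lborel (\<lambda>x. indicator \<Omega> x * u x * \<eta> \<rho> (x - a)) - m * \<kappa>"
    unfolding g using integrable_mult_\<eta>[OF iu \<rho>(1)] i\<eta> integral_\<eta>[OF \<rho>(1)] by simp
  also have "\<dots> \<le> \<kappa> * u a - m * \<kappa>" using mean[OF a\<Omega> \<rho>(1) sub] by simp
  also have "\<dots> = 0" using a(1) by (simp add: Z_def)
  finally have "integral\<^sup>L lborel (\<lambda>x. ?w x * \<eta> \<rho> (x - a)) = 0"
    by (intro antisym Bochner_Integration.integral_nonneg g0)
  then have AE0: "AE x in lborel. ?w x * \<eta> \<rho> (x - a) = 0"
    using integral_nonneg_eq_0_iff_AE[OF ig] g0 by simp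
  define w where "w = a + (3/4) *\<^sub>R (z - a)"
  have nw: "norm (w - a) = 3/4 * R" by (simp add: w_def R_def dist_norm norm_minus_commute)
  have w\<Omega>: "w \<in> \<Omega>" using sub nw R by (auto simp: dist_norm norm_minus_commute \<rho>_def)
  have "w \<notin> Z"
  proof
    assume "w \<in> Z"
    then have "R \<le> infdist w (frontier \<Omega>)" using a(2) z(2) by (simp add: R_def)
    also have "\<dots> \<le> dist w z" using z(1) by (rule infdist_le)
    also have "\<dots> = R / 4"
    proof -
      have "w - z = (1/4) *\<^sub>R (a - z)" by (simp add: w_def algebra_simps flip: scaleR_add_left)
      then show ?thesis by (simp add: dist_norm R_def)
    qed
    finally show False using R by simp
  qed
  then have uw: "u w > m" using x0(2)[of w] w\<Omega> closure_subset[of \<Omega>] by (force simp: Z_def m_def)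
  have "isCont u w" using continuous_on_subset[OF u closure_subset] w\<Omega> \<Omega>(1) continuous_on_eq_continuous_at by blast
  then obtain r1 where r1_pos: "r1 > 0" and r1_dist: "\<And>y. dist y w < r1 \<Longrightarrow> dist (u y) (u w) < u w - m"
    using uw unfolding continuous_at_eps_delta by (metis diff_gt_0_iff_gt)
  have r1: "r1 > 0" "\<And>y. dist y w < r1 \<Longrightarrow> u y > m"
    using r1_pos r1_dist by (force simp: dist_real_def)+
  obtain r2 where r2: "r2 > 0" "ball w r2 \<subseteq> \<Omega>" using \<Omega>(1) w\<Omega> openE by blast
  define r where "r = min (R / 25) (min r1 r2)"
  have r: "r > 0" using r1 r2 R by (simp add: r_def)
  have pos: "?w y * \<eta> \<rho> (y - a) > 0" if "y \<in> ball w r" for y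
  proof -
    have y: "dist y w < r1" "y \<in> \<Omega>" "norm (y - w) < R / 25" using that r2 by (auto simp: r_def dist_norm norm_minus_commute)
    have "\<bar>norm (y - a) - norm (w - a)\<bar> \<le> norm (y - w)" using norm_triangle_ineq3[of "y - a" "w - a"] by simp
    then have "\<eta> \<rho> (y - a) > 0" using y(3) nw R \<rho>(1) by (intro \<eta>_pos) (auto simp: \<rho>_def)
    then show ?thesis using r1(2)[OF y(1)] y(2) by simp
  qed
  have "AE x in lborel. x \<notin> ball w r" using AE0
  proof eventually_elim
    case (elim x)
    then show ?case using pos[of x] by (metis less_irrefl)
  qed
  then show False using r by (rule not_AE_lborel_ball)
qed

end

subsection \<open>Gradients of potentials\<close>

text \<open>Differentiation under the integral at the single point \<open>y\<close>. The Lipschitz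
  bound and the bound on \<open>v\<close> dominate the normalised remainder by \<open>2 * g\<close>;
  pointwise differentiability may fail at \<open>x = y\<close>, a null set.\<close>

lemma
  fixes K :: "'a::euclidean_space \<Rightarrow> 'a \<Rightarrow> real" and v :: "'a \<Rightarrow> 'a"
  assumes r: "r > 0" and K: "\<And>a. dist a y < r \<Longrightarrow> integrable lborel (\<lambda>x. K x a)"
    and v: "v \<in> borel_measurable borel" "\<And>x. norm (v x) \<le> g x" and g: "integrable lborel g"
    and der: "\<And>x. x \<noteq> y \<Longrightarrow> (K x has_derivative (\<lambda>h. v x \<bullet> h)) (at y)"
    and lip: "\<And>x a. dist a y < r \<Longrightarrow> \<bar>K x a - K x y\<bar> \<le> norm (a - y) * g x"
  shows has_derivative_integral_dominated:
      "((\<lambda>a. integral\<^sup>L lborel (\<lambda>x. K x a)) has_derivative (\<lambda>h. integral\<^sup>L lborel v \<bullet> h)) (at y)"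
    and norm_integral_dominated: "norm (integral\<^sup>L lborel v) \<le> integral\<^sup>L lborel g"
proof -
  have iv: "integrable lborel v"
    by (rule Bochner_Integration.integrable_bound[OF g]) (use v in \<open>auto intro!: AE_I2 intro: order_trans[OF _ abs_ge_self]\<close>)
  show "norm (integral\<^sup>L lborel v) \<le> integral\<^sup>L lborel g"
    by (rule order_trans[OF integral_norm_bound integral_mono]) (use iv g v in auto)
  let ?F = "\<lambda>a. integral\<^sup>L lborel (\<lambda>x. K x a)" and ?D = "\<lambda>h. integral\<^sup>L lborel v \<bullet> h"
  let ?q = "\<lambda>a x. (1 / norm (a - y)) *\<^sub>R (K x a - (K x y + v x \<bullet> (a - y)))"
  have Ky: "integrable lborel (\<lambda>x. K x y)" using K[of y] r by simp
  have "((\<lambda>a. (1 / norm (a - y)) *\<^sub>R (?F a - (?F y + ?D (a - y)))) \<longlongrightarrow> 0) (at y)"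
  proof (subst tendsto_at_iff_sequentially, intro allI impI)
    fix X :: "nat \<Rightarrow> 'a" assume X: "\<forall>i. X i \<in> UNIV - {y}" "X \<longlonglongrightarrow> y"
    define Q where "Q k x = (if dist (X k) y < r then ?q (X k) x else 0)" for k x
    have "(\<lambda>k. integral\<^sup>L lborel (Q k)) \<longlonglongrightarrow> integral\<^sup>L lborel (\<lambda>x::'a. 0::real)"
    proof (rule integral_dominated_convergence[where w="\<lambda>x. 2 * g x"])
      show "Q k \<in> borel_measurable lborel" for k
      proof (cases "dist (X k) y < r")
        case True
        then show ?thesis
          using borel_measurable_integrable[OF K[OF True]] borel_measurable_integrable[OF Ky] v(1)
          unfolding Q_def by (auto intro!: borel_measurable_scaleR borel_measurable_diff borel_measurable_add borel_measurable_inner)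
      qed (simp add: Q_def[abs_def])
      show "integrable lborel (\<lambda>x. 2 * g x)" using g by simp
      show "AE x in lborel. (\<lambda>k. Q k x) \<longlonglongrightarrow> 0"
        using AE_lborel_singleton[of y]
      proof eventually_elim
        case (elim x)
        have "((\<lambda>a. ?q a x) \<longlongrightarrow> 0) (at y)"
          using der[OF elim] by (simp add: has_derivative_within)
        moreover have "filterlim X (at y) sequentially" using X by (auto simp: filterlim_at)
        ultimately have "(\<lambda>k. ?q (X k) x) \<longlonglongrightarrow> 0" by (rule filterlim_compose)
        moreover have "eventually (\<lambda>k. ?q (X k) x = Q k x) sequentially"
          using tendstoD[OF X(2) r] by eventually_elim (simp add: Q_def)
        ultimately show ?case by (rule Lim_transform_eventually)
      qed
      show "AE x in lborel. norm (Q k x) \<le> 2 * g x" for k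
      proof (intro AE_I2)
        fix x
        have n: "norm (X k - y) > 0" using X(1) by (metis DiffE singletonI zero_less_norm_iff right_minus_eq)
        have g0: "g x \<ge> 0" using v(2)[of x] norm_ge_zero order_trans by blast
        show "norm (Q k x) \<le> 2 * g x"
        proof (cases "dist (X k) y < r")
          case True
          have "\<bar>v x \<bullet> (X k - y)\<bar> \<le> g x * norm (X k - y)"
            using Cauchy_Schwarz_ineq2[of "v x" "X k - y"] mult_right_mono[OF v(2)[of x], of "norm (X k - y)"] by simp
          then have "\<bar>K x (X k) - (K x y + v x \<bullet> (X k - y))\<bar> \<le> norm (X k - y) * (2 * g x)"
            using lip[OF True, of x] by (simp add: algebra_simps)
          then show ?thesis using True n by (simp add: Q_def divide_le_eq mult.commute)
        qed (use g0 in \<open>simp add: Q_def\<close>)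
      qed
    qed simp
    moreover have "eventually (\<lambda>k. integral\<^sup>L lborel (Q k) =
        (1 / norm (X k - y)) *\<^sub>R (?F (X k) - (?F y + ?D (X k - y)))) sequentially"
      using tendstoD[OF X(2) r]
    proof eventually_elim
      case (elim k)
      then have "Q k = ?q (X k)" by (auto simp: Q_def)
      then show ?case using K[OF elim] Ky iv by simp
    qed
    ultimately have "(\<lambda>k. (1 / norm (X k - y)) *\<^sub>R (?F (X k) - (?F y + ?D (X k - y)))) \<longlonglongrightarrow> 0"
      using Lim_transform_eventually by fastforce
    then show "((\<lambda>a. (1 / norm (a - y)) *\<^sub>R (?F a - (?F y + ?D (a - y)))) \<circ> X) \<longlonglongrightarrow> 0" by (simp add: o_def)
  qed
  then show "(?F has_derivative ?D) (at y)"
    by (simp add: has_derivative_within bounded_linear_inner_right)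
qed

text \<open>For \<open>x\<close> in the support and \<open>a\<close> within \<open>R\<close> of
  \<open>y\<close> the scaled argument has norm below \<open>4\<close>, so a gradient bound for
  \<open>k\<close> on one fixed ball makes the kernel Lipschitz in \<open>a\<close> with factor
  \<open>L / R\<close>. In this way the constant \<open>L\<close> does not depend on the
  scale.\<close>

lemma differentiable_smooth_potential:
  fixes k :: "'a::euclidean_space \<Rightarrow> real"
  assumes k: "\<And>z. (k has_derivative (\<lambda>h. G z \<bullet> h)) (at z)" and G: "continuous_on UNIV G"
    and L: "\<And>z. norm z \<le> 4 \<Longrightarrow> norm (G z) \<le> L"
    and R: "R > 0" and u: "integrable lborel u" "\<And>x. x \<notin> ball y (2 * R) \<Longrightarrow> u x = 0"
  obtains D where "((\<lambda>a. integral\<^sup>L lborel (\<lambda>x. u x * k ((x - a) /\<^sub>R R))) has_derivative (\<lambda>h. D \<bullet> h)) (at y)"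
    "norm D \<le> L / R * integral\<^sup>L lborel (\<lambda>x. \<bar>u x\<bar>)"
proof -
  let ?K = "\<lambda>x a. u x * k ((x - a) /\<^sub>R R)"
  let ?v = "\<lambda>x. - (u x / R) *\<^sub>R G ((x - y) /\<^sub>R R)"
  let ?g = "\<lambda>x. L / R * \<bar>u x\<bar>"
  have L0: "L \<ge> 0" using order_trans[OF norm_ge_zero L[of 0]] by simp
  have mu: "u \<in> borel_measurable borel" using u(1) by auto
  have ck: "continuous_on UNIV k" using k by (auto intro!: continuous_at_imp_continuous_on has_derivative_continuous)
  have ball4: "norm ((x - a) /\<^sub>R R) \<le> 4" if "x \<in> ball y (2 * R)" "dist a y < R" for x a
  proof -
    have "norm (x - a) \<le> dist x y + dist a y" using dist_triangle2[of x a y] by (simp add: dist_norm)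
    then have "norm (x - a) \<le> 4 * R" using that R by (simp add: dist_commute)
    then show ?thesis using R by (simp add: divide_le_eq divide_inverse_commute[symmetric] mult.commute)
  qed
  have lip: "\<bar>k w - k z\<bar> \<le> L * norm (w - z)" if "norm w \<le> 4" "norm z \<le> 4" for w z
  proof -
    have "norm (k w - k z) \<le> L * norm (w - z)"
    proof (rule differentiable_bound[of "cball 0 4" k "\<lambda>z h. G z \<bullet> h"])
      show "onorm (\<lambda>h. G x \<bullet> h) \<le> L" if "x \<in> cball 0 4" for x
      proof (rule onorm_bound[OF L0])
        show "norm (G x \<bullet> h) \<le> L * norm h" for h
          using Cauchy_Schwarz_ineq2[of "G x" h] mult_right_mono[OF L[of x], of "norm h"] that by simp
      qed
    qed (use that in \<open>auto intro: has_derivative_at_withinI[OF k]\<close>)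
    then show ?thesis by simp
  qed
  have 1: "integrable lborel (\<lambda>x. ?K x a)" if "dist a y < R" for a
  proof -
    obtain B where B: "\<And>z. z \<in> cball 0 4 \<Longrightarrow> \<bar>k z\<bar> \<le> B"
      using compact_imp_bounded[OF compact_continuous_image[OF continuous_on_subset[OF ck] compact_cball], of 0 4]
      unfolding bounded_iff by (metis imageI real_norm_def subset_UNIV)
    show ?thesis
    proof (rule Bochner_Integration.integrable_bound[where f="\<lambda>x. B * u x"])
      show "(\<lambda>x. ?K x a) \<in> borel_measurable lborel"
        unfolding measurable_lborel2
        by (intro borel_measurable_times mu borel_measurable_continuous_onI continuous_on_compose2[OF ck]) (auto intro!: continuous_intros)
      show "AE x in lborel. norm (?K x a) \<le> norm (B * u x)"
      proof (intro AE_I2)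
        fix x show "norm (?K x a) \<le> norm (B * u x)"
        proof (cases "x \<in> ball y (2 * R)")
          case True
          have "\<bar>k ((x - a) /\<^sub>R R)\<bar> \<le> \<bar>B\<bar>" using B[of "(x - a) /\<^sub>R R"] ball4[OF True that] by simp
          then show ?thesis using mult_left_mono[of _ "\<bar>B\<bar>" "\<bar>u x\<bar>"] by (simp add: abs_mult mult.commute[of "\<bar>B\<bar>"])
        qed (simp add: u)
      qed
    qed (use u in simp)
  qed
  have 2: "?v \<in> borel_measurable borel"
    by (intro borel_measurable_scaleR borel_measurable_uminus borel_measurable_divide mu borel_measurable_const
        borel_measurable_continuous_onI continuous_on_compose2[OF G]) (auto intro!: continuous_intros)
  have 3: "norm (?v x) \<le> ?g x" for x
  proof (cases "x \<in> ball y (2 * R)")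
    case True
    then have "norm (G ((x - y) /\<^sub>R R)) \<le> L" using L[OF ball4[of x y]] R by simp
    then have "\<bar>u x\<bar> / R * norm (G ((x - y) /\<^sub>R R)) \<le> \<bar>u x\<bar> / R * L" using R by (intro mult_left_mono) auto
    then show ?thesis using R by (simp add: mult_ac)
  qed (simp add: u)
  have 4: "integrable lborel ?g" using u by simp
  have 5: "(?K x has_derivative (\<lambda>h. ?v x \<bullet> h)) (at y)" for x
  proof -
    have "((\<lambda>a. k ((x - a) /\<^sub>R R)) has_derivative (\<lambda>h. G ((x - y) /\<^sub>R R) \<bullet> ((0 - h) /\<^sub>R R))) (at y)"
      by (rule has_derivative_compose[OF _ k]) (auto intro!: derivative_eq_intros)
    from has_derivative_mult_right[OF this, of "u x"] show ?thesis
      by (rule has_derivative_eq_rhs) (auto simp: fun_eq_iff divide_inverse)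
  qed
  have 6: "\<bar>?K x a - ?K x y\<bar> \<le> norm (a - y) * ?g x" if "dist a y < R" for x a
  proof (cases "x \<in> ball y (2 * R)")
    case True
    have "\<bar>k ((x - a) /\<^sub>R R) - k ((x - y) /\<^sub>R R)\<bar> \<le> L * norm ((x - a) /\<^sub>R R - (x - y) /\<^sub>R R)"
      by (rule lip) (use ball4[OF True that] ball4[OF True, of y] R in auto)
    also have "(x - a) /\<^sub>R R - (x - y) /\<^sub>R R = (y - a) /\<^sub>R R" by (simp add: algebra_simps)
    finally have "\<bar>k ((x - a) /\<^sub>R R) - k ((x - y) /\<^sub>R R)\<bar> \<le> L / R * norm (a - y)"
      using R by (simp add: norm_minus_commute divide_inverse mult_ac)
    then have "\<bar>u x\<bar> * \<bar>k ((x - a) /\<^sub>R R) - k ((x - y) /\<^sub>R R)\<bar> \<le> \<bar>u x\<bar> * (L / R * norm (a - y))"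
      by (intro mult_left_mono) auto
    then show ?thesis by (simp add: abs_mult[symmetric] right_diff_distrib mult_ac)
  qed (simp add: u)
  show thesis
  proof (rule that)
    show "(((\<lambda>a. integral\<^sup>L lborel (\<lambda>x. ?K x a))) has_derivative (\<lambda>h. integral\<^sup>L lborel ?v \<bullet> h)) (at y)"
      by (rule has_derivative_integral_dominated[OF R 1 2 3 4 5 6]) auto
    show "norm (integral\<^sup>L lborel ?v) \<le> L / R * integral\<^sup>L lborel (\<lambda>x. \<bar>u x\<bar>)"
      using norm_integral_dominated[of R y "\<lambda>x a. ?K x a" ?v ?g, OF R 1 2 3 4 5 6] by simp
  qed
qed

text \<open>The smaller of the two bases can carry both exponents. Used to split a product of
  singularities at two poles into a sum of singularities at one pole each.\<close>

lemma powr_minus_mult_le: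
  fixes s t :: real
  assumes "0 \<le> s" "0 \<le> t" "0 \<le> p" "0 \<le> q"
  shows "s powr (- p) * t powr (- q) \<le> s powr (- (p + q)) + t powr (- (p + q))"
proof (cases "s = 0 \<or> t = 0")
  case False
  then have st: "s > 0" "t > 0" using assms by auto
  show ?thesis
  proof (cases "s \<le> t")
    case True
    have "t powr (- q) \<le> s powr (- q)" using st True assms by (intro powr_mono2') auto
    then have "s powr (- p) * t powr (- q) \<le> s powr (- p) * s powr (- q)" by (intro mult_left_mono) auto
    then show ?thesis by (simp add: powr_add[symmetric] add_increasing2)
  next
    case False
    have "s powr (- p) \<le> t powr (- p)" using st False assms by (intro powr_mono2') auto
    then have "s powr (- p) * t powr (- q) \<le> t powr (- p) * t powr (- q)" by (intro mult_right_mono) auto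
    then show ?thesis by (simp add: powr_add[symmetric] add_increasing)
  qed
qed auto

text \<open>The mean value theorem evaluates the derivative between the two bases, hence bounds it
  by its value at the smaller one. The condition \<open>B <= 3 * A\<close> allows this to be written
  with \<open>B\<close> at the price of \<open>3 powr (m + 1)\<close>; it will hold because
  \<open>|x - y| <= 3 |x - a|\<close> as soon as \<open>|x - a| >= |a - y| / 2\<close>.\<close>

lemma powr_minus_diff_le:
  fixes A B m :: real
  assumes "0 < A" "0 < B" "0 \<le> m" "B \<le> 3 * A"
  shows "\<bar>A powr (- m) - B powr (- m)\<bar> \<le> m * 3 powr (m + 1) * \<bar>A - B\<bar> * B powr (- (m + 1))"
proof -
  have mvt: "\<bar>s powr (- m) - t powr (- m)\<bar> \<le> m * \<bar>s - t\<bar> * s powr (- (m + 1))" if st: "0 < s" "s < t" for s t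
  proof -
    have "\<exists>z. s < z \<and> z < t \<and> t powr (- m) - s powr (- m) = (t - s) * (- m * z powr (- m - 1))"
      using st by (intro MVT2) (auto intro!: derivative_eq_intros)
    then obtain z where z: "s < z" "z < t" "t powr (- m) - s powr (- m) = (t - s) * (- m * z powr (- m - 1))" by blast
    have "z powr (- m - 1) \<le> s powr (- m - 1)" using z st assms by (intro powr_mono2') auto
    then have "(t - s) * (m * z powr (- m - 1)) \<le> (t - s) * (m * s powr (- m - 1))"
      using st assms by (intro mult_left_mono) auto
    moreover have "\<bar>s powr (- m) - t powr (- m)\<bar> = (t - s) * (m * z powr (- m - 1))"
      using z(3) st assms by (simp add: abs_minus_commute[of "s powr _"])
    moreover have "- (m + 1) = - m - 1" by simp
    ultimately show ?thesis using st by (simp add: mult_ac)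
  qed
  have 3: "1 \<le> (3::real) powr (m + 1)" using assms by (intro ge_one_powr_ge_zero) auto
  consider "A = B" | "A < B" | "B < A" by linarith
  then show ?thesis
  proof cases
    case 2
    have "\<bar>A powr (- m) - B powr (- m)\<bar> \<le> m * \<bar>A - B\<bar> * A powr (- (m + 1))" using mvt[OF assms(1) 2] .
    also have "\<dots> \<le> m * \<bar>A - B\<bar> * (B / 3) powr (- (m + 1))"
      using assms by (intro mult_left_mono powr_mono2') auto
    also have "(B / 3) powr (- (m + 1)) = 3 powr (m + 1) * B powr (- (m + 1))"
    proof -
      have "(3::real) powr (m + 1) * 3 powr (- (m + 1)) = 1" by (simp flip: powr_add)
      then show ?thesis using assms by (simp add: powr_divide divide_eq_eq mult_ac)
    qed
    finally show ?thesis by (simp add: mult_ac)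
  next
    case 3
    have "\<bar>A powr (- m) - B powr (- m)\<bar> \<le> 1 * (m * \<bar>A - B\<bar> * B powr (- (m + 1)))"
      using mvt[OF assms(2) 3] by (simp add: abs_minus_commute)
    also have "\<dots> \<le> 3 powr (m + 1) * (m * \<bar>A - B\<bar> * B powr (- (m + 1)))"
      using \<open>1 \<le> 3 powr (m + 1)\<close> assms by (intro mult_right_mono) auto
    finally show ?thesis by (simp add: mult_ac)
  qed (use assms in simp)
qed

text \<open>In the worst case the poles \<open>a\<close> and \<open>y\<close> coincide and the
  exponents add up to \<open>n - 3/2\<close>, still below \<open>n\<close>.\<close>

lemma integrable_singular_potential:
  fixes f :: "'a::euclidean_space \<Rightarrow> real"
  assumes n: "DIM('a) \<ge> 3" and f: "f \<in> borel_measurable borel" and bf: "\<And>x. \<bar>f x\<bar> \<le> M * norm (x - y) powr (- (1/2))"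
    and supp: "bounded {x. f x \<noteq> 0}"
  shows "integrable lborel (\<lambda>x. f x * norm (x - a) powr (2 - real DIM('a)))"
proof -
  let ?n = "real DIM('a)"
  obtain r where r: "r > 0" "\<And>x. f x \<noteq> 0 \<Longrightarrow> norm x \<le> r" using supp by (auto simp: bounded_pos)
  define s where "s = r + norm a + norm y + 1"
  have s: "s > 0" using r norm_ge_zero[of a] norm_ge_zero[of y] unfolding s_def by linarith
  have out: "x \<in> ball c s" if "f x \<noteq> 0" "c \<in> {a, y}" for x c
  proof -
    have "norm c \<le> norm a + norm y" using that(2) by auto
    then have "norm (c - x) < s"
      using r(2)[OF that(1)] norm_triangle_ineq4[of c x] unfolding s_def by linarith
    then show ?thesis by (simp add: dist_norm)
  qed
  let ?w = "\<lambda>c x. indicator (ball c s) x * norm (x - c) powr (- (?n - 3/2))"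
  have iw: "integrable lborel (?w c)" for c :: 'a
    by (rule integrable_riesz) (use n s in auto)
  have M: "M \<ge> 0"
  proof -
    obtain b :: 'a where "norm b = 1" using vector_choose_size[of 1] by auto
    then show ?thesis using order_trans[OF abs_ge_zero bf[of "y + b"]] by simp
  qed
  show ?thesis
  proof (rule Bochner_Integration.integrable_bound[where f="\<lambda>x. M * (?w y x + ?w a x)"])
    show "integrable lborel (\<lambda>x. M * (?w y x + ?w a x))"
      by (intro integrable_mult_right Bochner_Integration.integrable_add iw)
    show "(\<lambda>x. f x * norm (x - a) powr (2 - ?n)) \<in> borel_measurable lborel"
      unfolding measurable_lborel2
      by (intro borel_measurable_times f powr_real_measurable borel_measurable_norm borel_measurable_diff) auto
    show "AE x in lborel. norm (f x * norm (x - a) powr (2 - ?n)) \<le> norm (M * (?w y x + ?w a x))"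
    proof (intro AE_I2)
      fix x show "norm (f x * norm (x - a) powr (2 - ?n)) \<le> norm (M * (?w y x + ?w a x))"
      proof (cases "f x = 0")
        case False
        have "\<bar>f x\<bar> * norm (x - a) powr (2 - ?n) \<le> M * norm (x - y) powr (- (1/2)) * norm (x - a) powr (2 - ?n)"
          using bf by (intro mult_right_mono) auto
        also have "\<dots> \<le> M * (norm (x - y) powr (- (1/2 + (?n - 2))) + norm (x - a) powr (- (1/2 + (?n - 2))))"
          using powr_minus_mult_le[of "norm (x - y)" "norm (x - a)" "1/2" "?n - 2"] n M
          by (simp add: mult.assoc mult_left_mono)
        also have "1/2 + (?n - 2) = ?n - 3/2" by simp
        finally show ?thesis using out[OF False, of a] out[OF False, of y] M by (simp add: abs_mult)
      qed simp
    qed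
  qed
qed

text \<open>The kernel is not Lipschitz in \<open>a\<close> near \<open>x = a\<close>, so no fixed
  function dominates the difference quotients. On the small ball
  \<open>|x - a| < |a - y| / 2\<close> the kernel is therefore frozen at its value for
  \<open>a = y\<close>. The modified potential is dominated by a multiple of
  \<open>|x - y|^(-(n - 1/2))\<close>, which is integrable, and the part removed is of order
  \<open>|a - y|^(3/2)\<close>, so its derivative at \<open>y\<close> is zero.\<close>

lemma differentiable_singular_potential:
  fixes f :: "'a::euclidean_space \<Rightarrow> real"
  assumes n: "DIM('a) \<ge> 3" and f: "f \<in> borel_measurable borel" and bf: "\<And>x. \<bar>f x\<bar> \<le> M * norm (x - y) powr (- (1/2))"
    and R: "R > 0" and supp: "\<And>x. x \<notin> ball y (2 * R) \<Longrightarrow> f x = 0"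
  obtains D where
    "((\<lambda>a. integral\<^sup>L lborel (\<lambda>x. f x * norm (x - a) powr (2 - real DIM('a)))) has_derivative (\<lambda>h. D \<bullet> h)) (at y)"
    "norm D \<le> M * (real DIM('a) - 2) * 3 powr (real DIM('a) - 1) * riesz_const DIM('a) (real DIM('a) - 1/2) * (2 * R) powr (1/2)"
proof -
  let ?n = "real DIM('a)"
  let ?p = "\<lambda>a x. norm (x - a) powr (2 - ?n)"
  have n3: "?n \<ge> 3" using n by simp
  have fy: "f y = 0" using bf[of y] by simp
  have M: "M \<ge> 0"
  proof -
    obtain b :: 'a where "norm b = 1" using vector_choose_size[of 1] by auto
    then show ?thesis using order_trans[OF abs_ge_zero bf[of "y + b"]] by simp
  qed
  have "bounded {x. f x \<noteq> 0}" by (rule bounded_subset[OF bounded_ball[of y "2 * R"]]) (use supp in blast)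
  then have ip: "integrable lborel (\<lambda>x. f x * ?p a x)" for a
    by (rule integrable_singular_potential[OF n f bf])
  \<comment> \<open>The complement of \<open>A a\<close> is the small ball around \<open>a\<close>
    on which the kernel is frozen. For fixed \<open>x\<close> other than \<open>y\<close> it does
    not contain \<open>x\<close> once \<open>a\<close> is close to \<open>y\<close>, so freezing
    leaves the pointwise derivative at \<open>y\<close> unchanged.\<close>
  define A where "A a = {x. dist a y / 2 \<le> dist x a}" for a
  have mA: "A a \<in> sets borel" "- A a \<in> sets borel" for a
    unfolding A_def by (intro borel_closed borel_comp closed_Collect_le continuous_intros)+
  define K where "K x a = indicator (A a) x * (f x * ?p a x) + indicator (- A a) x * (f x * ?p y x)" for x a
  define v where "v x = (f x * ((2 - ?n) * norm (x - y) powr (- ?n))) *\<^sub>R (y - x)" for x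
  define c where "c = M * (?n - 2) * 3 powr (?n - 1)"
  define g where "g x = c * (indicator (ball y (2 * R)) x * norm (x - y) powr (- (?n - 1/2)))" for x
  have c: "c \<ge> 0" using M n3 by (simp add: c_def)
  have p1: "norm (x - y) powr (- (1/2)) * norm (x - y) powr (1 - ?n) = norm (x - y) powr (- (?n - 1/2))" for x
    by (simp flip: powr_add)
  have ig: "integrable lborel g"
    unfolding g_def by (intro integrable_mult_right integrable_riesz) (use n R in auto)
  have iK: "integrable lborel (\<lambda>x. K x a)" for a
    unfolding K_def using mA ip by (intro Bochner_Integration.integrable_add integrable_mult_indicator[where 'a='a and 'b=real, unfolded real_scaleR_def]) auto
  have mv: "v \<in> borel_measurable borel"
    unfolding v_def
    by (intro borel_measurable_scaleR borel_measurable_times f powr_real_measurable borel_measurable_norm borel_measurable_diff borel_measurable_const) auto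
  have nv: "norm (v x) \<le> g x" for x
  proof (cases "x = y \<or> x \<notin> ball y (2 * R)")
    case False
    have "norm (v x) = \<bar>f x\<bar> * ((?n - 2) * norm (x - y) powr (- ?n) * norm (x - y))"
      using n3 by (simp add: v_def abs_mult norm_minus_commute[of y x] mult_ac)
    also have "norm (x - y) powr (- ?n) * norm (x - y) = norm (x - y) powr (1 - ?n)"
      using False powr_add[of "norm (x - y)" "- ?n" 1] by simp
    then have "(?n - 2) * norm (x - y) powr (- ?n) * norm (x - y) = (?n - 2) * norm (x - y) powr (1 - ?n)" by simp
    also have "\<bar>f x\<bar> * ((?n - 2) * norm (x - y) powr (1 - ?n)) \<le> M * norm (x - y) powr (- (1/2)) * ((?n - 2) * norm (x - y) powr (1 - ?n))"
      using bf[of x] n3 by (intro mult_right_mono) auto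
    also have "\<dots> = M * (?n - 2) * norm (x - y) powr (- (?n - 1/2))" using p1[of x] by (simp add: mult_ac)
    also have "\<dots> \<le> c * norm (x - y) powr (- (?n - 1/2))"
    proof -
      have "1 \<le> (3::real) powr (?n - 1)" using n3 by (intro ge_one_powr_ge_zero) auto
      then have "M * (?n - 2) * 1 \<le> c" unfolding c_def using M n3 by (intro mult_left_mono) auto
      then show ?thesis by (intro mult_right_mono) auto
    qed
    finally show ?thesis using False by (simp add: g_def)
  qed (use supp fy in \<open>auto simp: v_def g_def\<close>)
  have der: "(K x has_derivative (\<lambda>h. v x \<bullet> h)) (at y)" if "x \<noteq> y" for x
  proof -
    have n0: "(norm (y - x))\<^sup>2 > 0" using that by simp
    have d: "((\<lambda>a. ((norm (a - x))\<^sup>2) powr ((2 - ?n) / 2)) has_derivative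
       (\<lambda>h. (2 - ?n) / 2 * ((norm (y - x))\<^sup>2) powr ((2 - ?n) / 2 - 1) * (2 * ((y - x) \<bullet> h)))) (at y)"
      by (rule has_derivative_radial[where h="\<lambda>t. t powr ((2 - ?n) / 2)"]) (use n0 in \<open>auto intro!: derivative_eq_intros\<close>)
    have p: "((norm (a - x))\<^sup>2) powr b = norm (x - a) powr (2 * b)" for a b
      using powr_powr[of "norm (x - a)" 2 b] by (simp add: norm_minus_commute)
    have e: "2 * ((2 - ?n) / 2) = 2 - ?n" "2 * ((2 - ?n) / 2 - 1) = - ?n" by (simp_all add: field_simps)
    have "((\<lambda>a. ?p a x) has_derivative (\<lambda>h. (2 - ?n) / 2 * norm (x - y) powr (- ?n) * (2 * ((y - x) \<bullet> h)))) (at y)"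
      using d unfolding p e .
    from has_derivative_mult_right[OF this, of "f x"]
    have "((\<lambda>a. f x * ?p a x) has_derivative (\<lambda>h. v x \<bullet> h)) (at y)"
      by (rule has_derivative_eq_rhs) (auto simp: v_def fun_eq_iff)
    then show ?thesis
    proof (rule has_derivative_transform_within_open[where s="ball y (dist x y / 2)"])
      show "f x * ?p a x = K x a" if "a \<in> ball y (dist x y / 2)" for a
      proof -
        have "dist x y \<le> dist x a + dist a y" by (rule dist_triangle)
        moreover have "dist a y < dist x y / 2" using that by (simp add: dist_commute)
        ultimately have "dist a y / 2 \<le> dist x a" using zero_le_dist[of a y] by linarith
        then have "x \<in> A a" by (simp add: A_def)
        then show ?thesis by (simp add: K_def)
      qed
    qed (use that in auto)
  qed
  have lip: "\<bar>K x a - K x y\<bar> \<le> norm (a - y) * g x" for x a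
  proof -
    have Ky: "K x y = f x * ?p y x" by (simp add: K_def indicator_def)
    show ?thesis
    proof (cases "f x = 0 \<or> x \<notin> A a \<or> a = y")
      case True
      have "g x \<ge> 0" using c by (simp add: g_def)
      then show ?thesis using True unfolding Ky by (auto simp: K_def indicator_def)
    next
      case False
      then have x: "x \<noteq> y" "x \<in> ball y (2 * R)" "dist a y / 2 \<le> dist x a" "a \<noteq> y" using fy supp by (auto simp: A_def)
      have xa: "norm (x - a) > 0" using x(3,4) by (metis dist_norm half_gt_zero less_le_trans zero_less_dist_iff)
      have "norm (x - y) \<le> norm (x - a) + dist a y" using dist_triangle[of x y a] by (simp add: dist_norm)
      then have le3: "norm (x - y) \<le> 3 * norm (x - a)" using x(3) by (simp add: dist_norm)
      have "\<bar>norm (x - a) powr (- (?n - 2)) - norm (x - y) powr (- (?n - 2))\<bar> \<le>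
        (?n - 2) * 3 powr (?n - 2 + 1) * \<bar>norm (x - a) - norm (x - y)\<bar> * norm (x - y) powr (- (?n - 2 + 1))"
        by (rule powr_minus_diff_le) (use xa x le3 n3 in auto)
      also have "\<dots> \<le> (?n - 2) * 3 powr (?n - 2 + 1) * norm (a - y) * norm (x - y) powr (- (?n - 2 + 1))"
        using n3 norm_triangle_ineq3[of "x - a" "x - y"] by (intro mult_right_mono mult_left_mono) (auto simp: norm_minus_commute)
      finally have d: "\<bar>?p a x - ?p y x\<bar> \<le> (?n - 2) * 3 powr (?n - 1) * norm (a - y) * norm (x - y) powr (1 - ?n)" by simp
      have "\<bar>K x a - K x y\<bar> = \<bar>f x\<bar> * \<bar>?p a x - ?p y x\<bar>"
        unfolding Ky using False by (simp add: K_def abs_mult[symmetric] right_diff_distrib)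
      also have "\<dots> \<le> M * norm (x - y) powr (- (1/2)) * ((?n - 2) * 3 powr (?n - 1) * norm (a - y) * norm (x - y) powr (1 - ?n))"
        using bf[of x] d M by (intro mult_mono) auto
      also have "\<dots> = c * norm (a - y) * (norm (x - y) powr (- (1/2)) * norm (x - y) powr (1 - ?n))" by (simp add: c_def mult_ac)
      also have "\<dots> = norm (a - y) * g x" unfolding p1 using x by (simp add: g_def mult_ac)
      finally show ?thesis .
    qed
  qed
  have main: "((\<lambda>a. integral\<^sup>L lborel (\<lambda>x. K x a)) has_derivative (\<lambda>h. integral\<^sup>L lborel v \<bullet> h)) (at y)"
    "norm (integral\<^sup>L lborel v) \<le> integral\<^sup>L lborel g"
    using has_derivative_integral_dominated[OF zero_less_one iK mv nv ig der lip]
      norm_integral_dominated[OF zero_less_one iK mv nv ig der lip] by blast+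
  define rem where "rem a = integral\<^sup>L lborel (\<lambda>x. indicator (- A a) x * (f x * ?p a x) - indicator (- A a) x * (f x * ?p y x))" for a
  have split: "integral\<^sup>L lborel (\<lambda>x. f x * ?p a x) = integral\<^sup>L lborel (\<lambda>x. K x a) + rem a" for a
  proof -
    have i: "integrable lborel (\<lambda>x. indicator (- A a) x * (f x * ?p b x))" for b
      using integrable_mult_indicator[OF _ ip, of "- A a" b] mA by simp
    have "integral\<^sup>L lborel (\<lambda>x. K x a) + rem a = integral\<^sup>L lborel (\<lambda>x. K x a + (indicator (- A a) x * (f x * ?p a x) - indicator (- A a) x * (f x * ?p y x)))"
      unfolding rem_def by (subst Bochner_Integration.integral_add) (use iK i in auto)
    also have "\<dots> = integral\<^sup>L lborel (\<lambda>x. f x * ?p a x)"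
      by (rule Bochner_Integration.integral_cong) (auto simp: K_def indicator_def)
    finally show ?thesis by simp
  qed
  define c2 where "c2 = M * riesz_const ?n (?n - 2)"
  \<comment> \<open>With \<open>h = |a - y| / 2\<close>, points of the removed ball have distance at
    least \<open>h\<close> from \<open>y\<close>, so \<open>f\<close> is at most
    \<open>M * h powr (- (1/2))\<close> there, while the kernel integrates to order
    \<open>h powr 2\<close>. The sum \<open>3/2\<close> of the exponents exceeds one.\<close>
  have rem: "\<bar>rem a\<bar> \<le> c2 * (dist a y / 2) powr (3/2)" if "a \<noteq> y" for a
  proof -
    let ?h = "dist a y / 2"
    have h: "?h > 0" using that by simp
    have b: "\<bar>indicator (- A a) x * (f x * ?p a x) - indicator (- A a) x * (f x * ?p y x)\<bar> \<le>
      M * ?h powr (- (1/2)) * (indicator (ball a ?h) x * norm (x - a) powr (- (?n - 2)))" if xa: "x \<noteq> a" for x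
    proof (cases "x \<in> A a")
      case False
      then have x: "norm (x - a) < ?h" "x \<in> ball a ?h" by (auto simp: A_def dist_norm norm_minus_commute)
      have "dist a y \<le> norm (x - a) + norm (x - y)" using dist_triangle[of a y x] by (simp add: dist_norm norm_minus_commute)
      then have xy: "?h \<le> norm (x - y)" using x(1) by simp
      have "?p y x \<le> ?p a x" using xy x(1) xa n3 by (intro powr_mono2') auto
      then have "\<bar>?p a x - ?p y x\<bar> \<le> ?p a x" by simp
      moreover have "\<bar>f x\<bar> \<le> M * ?h powr (- (1/2))"
      proof -
        have "norm (x - y) powr (- (1/2)) \<le> ?h powr (- (1/2))" using xy h by (intro powr_mono2') auto
        then show ?thesis using bf[of x] M by (meson mult_left_mono order_trans)
      qed
      ultimately have "\<bar>f x\<bar> * \<bar>?p a x - ?p y x\<bar> \<le> M * ?h powr (- (1/2)) * ?p a x"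
        using M by (intro mult_mono) auto
      then show ?thesis using False x by (simp add: abs_mult[symmetric] right_diff_distrib)
    qed (use M in simp)
    have i: "integrable lborel (\<lambda>x. indicator (- A a) x * (f x * ?p b x))" for b
      using integrable_mult_indicator[OF _ ip, of "- A a" b] mA by simp
    have "\<bar>rem a\<bar> \<le> integral\<^sup>L lborel (\<lambda>x. norm (indicator (- A a) x * (f x * ?p a x) - indicator (- A a) x * (f x * ?p y x)))"
      unfolding rem_def real_norm_def[symmetric] by (rule integral_norm_bound)
    also have "\<dots> \<le> integral\<^sup>L lborel (\<lambda>x. M * ?h powr (- (1/2)) * (indicator (ball a ?h) x * norm (x - a) powr (- (?n - 2))))"
    proof (rule integral_mono_AE)
      show "integrable lborel (\<lambda>x. M * ?h powr (- (1/2)) * (indicator (ball a ?h) x * norm (x - a) powr (- (?n - 2))))"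
        by (intro integrable_mult_right integrable_riesz) (use n h in auto)
      show "AE x in lborel. norm (indicator (- A a) x * (f x * ?p a x) - indicator (- A a) x * (f x * ?p y x))
        \<le> M * ?h powr (- (1/2)) * (indicator (ball a ?h) x * norm (x - a) powr (- (?n - 2)))"
        using AE_lborel_singleton[of a] by eventually_elim (use b in simp)
    qed (use i in auto)
    also have "\<dots> = M * ?h powr (- (1/2)) * integral\<^sup>L lborel (\<lambda>x. indicator (ball a ?h) x * norm (x - a) powr (- (?n - 2)))"
      by simp
    also have "\<dots> \<le> M * ?h powr (- (1/2)) * (riesz_const ?n (?n - 2) * ?h powr (?n - (?n - 2)))"
      by (intro mult_left_mono integral_riesz) (use n h M in auto)
    also have "\<dots> = c2 * (?h powr (- (1/2)) * ?h powr 2)" by (simp add: c2_def mult_ac)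
    also have "?h powr (- (1/2)) * ?h powr 2 = ?h powr (3/2)" by (subst powr_add[symmetric]) simp
    finally show ?thesis .
  qed
  have c2: "c2 \<ge> 0" unfolding c2_def using M riesz_const_pos[of ?n "?n - 2"] by simp
  have "(rem has_derivative (\<lambda>h. 0)) (at y)"
  proof -
    have "A y = UNIV" by (auto simp: A_def)
    then have "rem y = 0" by (simp add: rem_def)
    have "((\<lambda>a. rem a / norm (a - y)) \<longlongrightarrow> 0) (at y)"
    proof (rule Lim_null_comparison)
      show "\<forall>\<^sub>F a in at y. norm (rem a / norm (a - y)) \<le> c2 * sqrt (norm (a - y))"
        unfolding eventually_at_filter
      proof (rule always_eventually, intro allI impI)
        fix a assume a: "a \<noteq> y"
        have h: "norm (a - y) > 0" using a by simp
        have "(norm (a - y) / 2) powr (3/2) \<le> norm (a - y) powr (3/2)" by (intro powr_mono2) auto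
        also have "\<dots> = norm (a - y) * sqrt (norm (a - y))"
          using h powr_add[of "norm (a - y)" 1 "1/2"] by (simp add: powr_half_sqrt)
        finally have "\<bar>rem a\<bar> \<le> c2 * (norm (a - y) * sqrt (norm (a - y)))"
          using rem[OF a] c2 by (simp add: dist_norm) (meson mult_left_mono order_trans)
        then show "norm (rem a / norm (a - y)) \<le> c2 * sqrt (norm (a - y))"
          using h by (simp add: abs_divide divide_le_eq mult_ac)
      qed
      have "((\<lambda>a. c2 * sqrt (norm (a - y))) \<longlongrightarrow> c2 * sqrt (norm (y - y))) (at y)"
        by (intro tendsto_intros)
      then show "((\<lambda>a. c2 * sqrt (norm (a - y))) \<longlongrightarrow> 0) (at y)" by simp
    qed
    then show ?thesis by (simp add: has_derivative_within \<open>rem y = 0\<close> bounded_linear_zero)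
  qed
  from has_derivative_add[OF main(1) this]
  have "((\<lambda>a. integral\<^sup>L lborel (\<lambda>x. f x * ?p a x)) has_derivative (\<lambda>h. integral\<^sup>L lborel v \<bullet> h)) (at y)"
    unfolding split by simp
  moreover have "integral\<^sup>L lborel g \<le> c * (riesz_const ?n (?n - 1/2) * (2 * R) powr (?n - (?n - 1/2)))"
    unfolding g_def integral_mult_right_zero
    by (intro mult_left_mono integral_riesz) (use n R c in auto)
  ultimately show thesis
    using that main(2) unfolding c_def by (simp add: mult_ac)
qed

section \<open>A classical minimum principle and two inequalities for powers\<close>

text \<open>Subtracting \<open>e\<close> times the squared norm makes the Laplacian strictly
  negative, and \<open>e\<close> is so small that the minimum stays negative and hence interior.
  There each second derivative along a basis vector is nonnegative, which contradicts the sign of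
  their sum. Serves the regular part of the Green function, which is harmonic in the classical
  sense.\<close>

lemma min_principle_classical:
  fixes u :: "'a::euclidean_space \<Rightarrow> real"
  assumes S: "open S" "bounded S" and u: "Ck_on 2 u S" "continuous_on (closure S) u"
    and super: "\<And>x. x \<in> S \<Longrightarrow> laplacian u x \<le> 0" and bd: "\<And>x. x \<in> frontier S \<Longrightarrow> 0 \<le> u x"
    and x0: "x0 \<in> S"
  shows "0 \<le> u x0"
proof (rule ccontr)
  assume neg: "\<not> 0 \<le> u x0"
  have K: "compact (closure S)" using S(2) by simp
  obtain B where B: "\<And>x. x \<in> closure S \<Longrightarrow> norm x \<le> B" using compact_imp_bounded[OF K] by (auto simp: bounded_iff)
  define e where "e = - u x0 / (2 * (B\<^sup>2 + 1))"
  have B1: "B\<^sup>2 + 1 > 0" by (simp add: add_nonneg_pos)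
  have e: "e > 0" using neg B1 unfolding e_def by (intro divide_pos_pos) auto
  have eB: "e * B\<^sup>2 < - u x0"
  proof -
    have "e * B\<^sup>2 \<le> e * (B\<^sup>2 + 1)" using e by simp
    also have "\<dots> = - u x0 / 2" using B1 by (simp add: e_def field_simps)
    also have "\<dots> < - u x0" using neg by simp
    finally show ?thesis .
  qed
  define w where "w z = 1 * u z + (- e) * (norm (z - 0))\<^sup>2" for z
  have cw: "continuous_on (closure S) w" unfolding w_def by (intro continuous_intros u)
  have sub: "S \<subseteq> closure S" by (rule closure_subset)
  obtain x1 where x1: "x1 \<in> closure S" "\<And>y. y \<in> closure S \<Longrightarrow> w x1 \<le> w y"
    using continuous_attains_inf[OF K _ cw] x0 sub by blast
  have "w x0 \<le> u x0" using e by (simp add: w_def)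
  then have "w x1 \<le> u x0" using x1(2)[of x0] x0 sub by auto
  moreover have "e * (norm x1)\<^sup>2 \<le> e * B\<^sup>2" using B[OF x1(1)] e by (intro mult_left_mono power_mono) auto
  ultimately have "u x1 < 0" using eB by (simp add: w_def)
  then have x1S: "x1 \<in> S" using x1(1) bd[of x1] by (force simp: closure_Un_frontier)
  have Ckw: "Ck_on 2 w S" unfolding w_def by (intro Ck_on_add Ck_on_cmult Ck_on_dist_square u S)
  have "laplacian w x1 = 1 * laplacian u x1 + (- e) * laplacian (\<lambda>z. (norm (z - 0))\<^sup>2) x1"
    unfolding w_def by (rule laplacian_lincomb[OF S(1) x1S u(1) Ck_on_dist_square[OF S(1)]])
  moreover have "laplacian (\<lambda>z. (norm (z - 0))\<^sup>2) x1 = 2 * real DIM('a)"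
    using laplacian_radial[of UNIV x1 0 "\<lambda>t. t" "\<lambda>_. 1" 0] by simp
  moreover have "0 < e * (2 * real DIM('a))" using e by simp
  ultimately have lneg: "laplacian w x1 < 0" using super[OF x1S] by simp
  have Ckw': "Ck_on (Suc (Suc 0)) w S" using Ckw by (simp add: numeral_2_eq_2)
  note D = Ck_on_SucD[OF Ckw']
  let ?d = "\<lambda>b z. frechet_derivative w (at z) b"
  have "frechet_derivative (?d b) (at x1) b \<ge> 0" if b: "b \<in> Basis" for b
  proof (rule ccontr)
    let ?s = "frechet_derivative (?d b) (at x1) b"
    assume "\<not> ?s \<ge> 0"
    then have s: "?s < 0" by simp
    obtain r where r: "r > 0" "ball x1 r \<subseteq> S" using S(1) x1S openE by blast
    have inS: "x1 + t *\<^sub>R b \<in> S" if "\<bar>t\<bar> < r" for t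
      using r(2) that b by (auto simp: dist_norm)
    have line: "((\<lambda>t. f (x1 + t *\<^sub>R b)) has_real_derivative f' b) (at t)"
      if "(f has_derivative f') (at (x1 + t *\<^sub>R b))" for f :: "'a \<Rightarrow> real" and f' t
    proof -
      have "((\<lambda>t. f (x1 + t *\<^sub>R b)) has_derivative (\<lambda>h. f' (h *\<^sub>R b))) (at t)"
        by (rule has_derivative_compose[of "\<lambda>t. x1 + t *\<^sub>R b", OF _ that]) (auto intro!: derivative_eq_intros)
      then show ?thesis
        using linear_scale[OF has_derivative_linear[OF that]] by (simp add: has_field_derivative_def mult.commute[of _ "f' b"])
    qed
    have f: "((\<lambda>t. w (x1 + t *\<^sub>R b)) has_real_derivative ?d b (x1 + t *\<^sub>R b)) (at t)" if "\<bar>t\<bar> < r" for t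
      by (rule line[OF D(1)[OF inS[OF that]]])
    have g: "((\<lambda>t. ?d b (x1 + t *\<^sub>R b)) has_real_derivative ?s) (at 0)"
      by (rule line) (use Ck_on_SucD(1)[OF D(2)[OF b] x1S] in simp)
    have min: "w (x1 + 0 *\<^sub>R b) \<le> w (x1 + t *\<^sub>R b)" if "\<bar>t\<bar> < r" for t
      using x1(2) inS[OF that] sub by auto
    have g0: "?d b (x1 + 0 *\<^sub>R b) = 0"
      by (rule DERIV_local_min[OF f[of 0] r(1)]) (use r min in auto)
    obtain d where d: "d > 0" "\<And>h. h > 0 \<Longrightarrow> h < d \<Longrightarrow> ?d b (x1 + (0 + h) *\<^sub>R b) < ?d b (x1 + 0 *\<^sub>R b)"
      using DERIV_neg_dec_right[OF g s] by blast
    define t where "t = min d r / 2"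
    have t: "0 < t" "t < d" "t < r" using d(1) r(1) by (auto simp: t_def)
    obtain \<xi> where \<xi>: "0 < \<xi>" "\<xi> < t" "w (x1 + t *\<^sub>R b) - w (x1 + 0 *\<^sub>R b) = (t - 0) * ?d b (x1 + \<xi> *\<^sub>R b)"
      using MVT2[of 0 t "\<lambda>t. w (x1 + t *\<^sub>R b)" "\<lambda>t. ?d b (x1 + t *\<^sub>R b)"] t f by auto
    have "?d b (x1 + \<xi> *\<^sub>R b) < 0" using d(2)[of \<xi>] \<xi> t g0 by simp
    then have "(t - 0) * ?d b (x1 + \<xi> *\<^sub>R b) < 0" using t by (simp add: mult_pos_neg)
    then show False using \<xi>(3) min[of t] t by simp
  qed
  then have "laplacian w x1 \<ge> 0" unfolding laplacian_def by (intro sum_nonneg) auto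
  with lneg show False by simp
qed

lemma powr_superadditive:
  fixes a b p :: real
  assumes "0 \<le> a" "0 \<le> b" "1 \<le> p"
  shows "a powr p + b powr p \<le> (a + b) powr p"
proof -
  have e: "c powr p = c * c powr (p - 1)" if "0 \<le> c" for c :: real
    using that powr_add[of c 1 "p - 1"] by (cases "c = 0") auto
  have "a * a powr (p - 1) \<le> a * (a + b) powr (p - 1)" "b * b powr (p - 1) \<le> b * (a + b) powr (p - 1)"
    using assms by (auto intro!: mult_left_mono powr_mono2)
  then show ?thesis using e[of a] e[of b] e[of "a + b"] assms by (simp add: algebra_simps)
qed

text \<open>The mean value theorem bounds the growth from \<open>a\<close> to \<open>a + b\<close>
  by \<open>p * b * (a + b) powr \<epsilon>\<close>, so in terms of \<open>q = (a + b) / b\<close>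
  it remains to bound \<open>p * q powr \<epsilon> - 1\<close>. This is of order \<epsilon>, but
  grows with \<open>q\<close>; the loss is put into a small power \<open>q powr \<theta>\<close>
  with \<theta> independent of \<epsilon>.\<close>

lemma powr_superadditive_defect:
  fixes a b \<epsilon> \<theta> :: real
  assumes a: "0 \<le> a" and b: "0 < b" and \<epsilon>: "0 \<le> \<epsilon>" "\<epsilon> \<le> \<theta> / 2" and \<theta>: "0 < \<theta>" "\<theta> \<le> 1"
  shows "(a + b) powr (1 + \<epsilon>) - a powr (1 + \<epsilon>) - b powr (1 + \<epsilon>) \<le>
    \<epsilon> * (1 + 4 / \<theta>) * (b powr (1 + \<epsilon> - \<theta>) * (a + b) powr \<theta>)"
proof -
  let ?p = "1 + \<epsilon>" and ?\<Gamma> = "a + b"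
  define q where "q = ?\<Gamma> / b"
  have q: "1 \<le> q" "?\<Gamma> = b * q" using a b by (auto simp: q_def)
  have 1: "?\<Gamma> powr ?p - a powr ?p \<le> ?p * b * ?\<Gamma> powr \<epsilon>"
  proof (cases "a = 0")
    case True
    have "b powr ?p = b * b powr \<epsilon>" using b by (simp add: powr_add)
    also have "\<dots> \<le> ?p * b * b powr \<epsilon>" using b \<epsilon> by simp
    finally show ?thesis using True by simp
  next
    case False
    have "\<exists>z. a < z \<and> z < ?\<Gamma> \<and> ?\<Gamma> powr ?p - a powr ?p = (?\<Gamma> - a) * (?p * z powr \<epsilon>)"
      using a b False by (intro MVT2) (auto intro!: derivative_eq_intros)
    then obtain z where z: "a < z" "z < ?\<Gamma>" "?\<Gamma> powr ?p - a powr ?p = b * (?p * z powr \<epsilon>)" by auto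
    have "z powr \<epsilon> \<le> ?\<Gamma> powr \<epsilon>" using z a \<epsilon> by (intro powr_mono2) auto
    then have "b * (?p * z powr \<epsilon>) \<le> b * (?p * ?\<Gamma> powr \<epsilon>)" using b \<epsilon> by (intro mult_left_mono) auto
    with z(3) show ?thesis by (simp add: mult_ac)
  qed
  have 2: "?p * q powr \<epsilon> - 1 \<le> \<epsilon> * (1 + 4 / \<theta>) * q powr \<theta>"
  proof -
    \<comment> \<open>\<open>q powr \<epsilon> - 1 <= \<epsilon> * ln q * q powr \<epsilon>\<close>,
      and the logarithm is absorbed by \<open>ln q <= q powr k / k\<close>. With this
      \<open>k\<close> the total power is \<open>q powr \<theta>\<close>, and
      \<open>\<epsilon> <= \<theta> / 2\<close> keeps \<open>1 / k\<close> below
      \<open>2 / \<theta>\<close>.\<close>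
    define k where "k = \<theta> - \<epsilon>"
    have k: "k \<ge> \<theta> / 2" "k > 0" using \<epsilon> \<theta> by (auto simp: k_def)
    have "k * ln q \<le> q powr k"
      using ln_le_minus_one[of "q powr k"] q by (simp add: ln_powr)
    then have lnq: "ln q \<le> q powr k / k" using k by (simp add: field_simps)
    have "1 - \<epsilon> * ln q \<le> exp (- (\<epsilon> * ln q))" using exp_ge_add_one_self[of "- (\<epsilon> * ln q)"] by simp
    then have "(1 - \<epsilon> * ln q) * q powr \<epsilon> \<le> exp (- (\<epsilon> * ln q)) * q powr \<epsilon>" by (rule mult_right_mono) simp
    also have "\<dots> = 1" using q by (simp add: powr_def flip: exp_add)
    finally have "q powr \<epsilon> - 1 \<le> \<epsilon> * ln q * q powr \<epsilon>" by (simp add: algebra_simps)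
    also have "\<dots> \<le> \<epsilon> * (q powr k / k) * q powr \<epsilon>" using lnq \<epsilon> by (intro mult_right_mono mult_left_mono) auto
    also have "\<dots> = \<epsilon> / k * q powr \<theta>" by (simp add: k_def flip: powr_add)
    also have "\<dots> \<le> \<epsilon> / (\<theta> / 2) * q powr \<theta>" using k \<epsilon> \<theta> by (intro mult_right_mono divide_left_mono) auto
    finally have "q powr \<epsilon> - 1 \<le> 2 * \<epsilon> / \<theta> * q powr \<theta>" by (simp add: mult_ac)
    then have "?p * (q powr \<epsilon> - 1) \<le> 2 * (2 * \<epsilon> / \<theta> * q powr \<theta>)"
      using \<epsilon> \<theta> q by (intro mult_mono) (auto intro: ge_one_powr_ge_zero)
    moreover have "\<epsilon> \<le> \<epsilon> * q powr \<theta>" using mult_left_mono[OF ge_one_powr_ge_zero[OF q(1), of \<theta>] \<epsilon>(1)] \<theta> by simp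
    ultimately show ?thesis by (simp add: algebra_simps)
  qed
  have "b powr ?p = b * b powr \<epsilon>" using b by (simp add: powr_add)
  then have "?p * b * ?\<Gamma> powr \<epsilon> - b powr ?p = b powr ?p * (?p * q powr \<epsilon> - 1)"
    unfolding q(2) using b q by (simp add: powr_mult algebra_simps)
  also have "\<dots> \<le> b powr ?p * (\<epsilon> * (1 + 4 / \<theta>) * q powr \<theta>)" using 2 by (intro mult_left_mono) auto
  finally have fin: "?p * b * ?\<Gamma> powr \<epsilon> - b powr ?p \<le> b powr ?p * (\<epsilon> * (1 + 4 / \<theta>) * q powr \<theta>)" .
  have "b powr ?p = b powr (?p - \<theta>) * b powr \<theta>" by (simp flip: powr_add)
  moreover have "?\<Gamma> powr \<theta> = b powr \<theta> * q powr \<theta>" unfolding q(2) using b q by (simp add: powr_mult)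
  ultimately have "b powr ?p * (\<epsilon> * (1 + 4 / \<theta>) * q powr \<theta>) = \<epsilon> * (1 + 4 / \<theta>) * (b powr (?p - \<theta>) * ?\<Gamma> powr \<theta>)"
    by (simp only: ac_simps)
  with 1 fin show ?thesis by linarith
qed

subsection \<open>Geometry of the boundary\<close>

lemma Ck_on_1_lipschitz:
  fixes f :: "'a::euclidean_space \<Rightarrow> real"
  assumes f: "Ck_on (Suc 0) f U" and c: "cball c r \<subseteq> U"
  obtains L where "L \<ge> 0" "\<And>w z. w \<in> cball c r \<Longrightarrow> z \<in> cball c r \<Longrightarrow> \<bar>f w - f z\<bar> \<le> L * norm (w - z)"
proof -
  note D = Ck_on_SucD[OF f]
  let ?s = "\<lambda>z. \<Sum>b\<in>Basis. \<bar>frechet_derivative f (at z) b\<bar>"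
  have "continuous_on (cball c r) ?s"
    by (intro continuous_intros continuous_on_subset[OF _ c]) (use D(2) in auto)
  from compact_imp_bounded[OF compact_continuous_image[OF this compact_cball]]
  obtain B where B: "\<And>z. z \<in> cball c r \<Longrightarrow> ?s z \<le> B" unfolding bounded_iff by (metis abs_le_D1 imageI real_norm_def)
  have lip: "\<bar>f w - f z\<bar> \<le> max B 0 * norm (w - z)" if "w \<in> cball c r" "z \<in> cball c r" for w z
  proof -
    have "norm (f w - f z) \<le> max B 0 * norm (w - z)"
    proof (rule differentiable_bound[of "cball c r" f "\<lambda>z. frechet_derivative f (at z)"])
      show "(f has_derivative frechet_derivative f (at x)) (at x within cball c r)" if "x \<in> cball c r" for x
        by (rule has_derivative_at_withinI[OF D(1)]) (use c that in blast)
      show "onorm (frechet_derivative f (at x)) \<le> max B 0" if x: "x \<in> cball c r" for x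
      proof (rule onorm_bound)
        fix h
        have "(f has_derivative frechet_derivative f (at x)) (at x)" using D(1) c x by auto
        then have l: "linear (frechet_derivative f (at x))" by (rule has_derivative_linear)
        have "frechet_derivative f (at x) h = (\<Sum>b\<in>Basis. (h \<bullet> b) * frechet_derivative f (at x) b)"
          by (subst euclidean_representation[of h, symmetric]) (simp add: linear_sum[OF l] linear_scale[OF l])
        also have "\<bar>\<dots>\<bar> \<le> (\<Sum>b\<in>Basis. norm h * \<bar>frechet_derivative f (at x) b\<bar>)"
          by (rule order_trans[OF sum_abs sum_mono]) (auto simp: abs_mult Basis_le_norm intro: mult_right_mono)
        also have "\<dots> \<le> max B 0 * norm h"
          using mult_left_mono[of "?s x" "max B 0" "norm h"] B[OF x] by (simp add: sum_distrib_left mult.commute)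
        finally show "norm (frechet_derivative f (at x) h) \<le> max B 0 * norm h" by simp
      qed simp
    qed (use that in auto)
    then show ?thesis by simp
  qed
  show thesis by (rule that[of "max B 0"]) (use lip in auto)
qed

lemma gradient_eq:
  assumes "(f has_derivative (\<lambda>h. D \<bullet> h)) (at x)"
  shows "gradient f x = D"
proof -
  have "GDERIV f x :> D" using assms by (simp add: gderiv_def inner_commute)
  moreover have "D' = D" if "GDERIV f x :> D'" for D'
  proof -
    have "(\<lambda>h. h \<bullet> D') = (\<lambda>h. h \<bullet> D)"
      using that \<open>GDERIV f x :> D\<close> has_derivative_unique unfolding gderiv_def by blast
    then have "(D' - D) \<bullet> D' = (D' - D) \<bullet> D" by meson
    then have "(D' - D) \<bullet> (D' - D) = 0" by (simp add: inner_diff_right)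
    then show ?thesis by simp
  qed
  ultimately show ?thesis unfolding gradient_def by (rule the_equality)
qed

lemma has_derivative_gradient:
  assumes "f differentiable (at x)"
  shows "(f has_derivative (\<lambda>h. gradient f x \<bullet> h)) (at x)"
    and "gradient f x = (\<Sum>b\<in>Basis. frechet_derivative f (at x) b *\<^sub>R b)"
proof -
  let ?D = "\<Sum>b\<in>Basis. frechet_derivative f (at x) b *\<^sub>R b"
  have d: "(f has_derivative frechet_derivative f (at x)) (at x)" using assms frechet_derivative_works by blast
  then have l: "linear (frechet_derivative f (at x))" by (rule has_derivative_linear)
  have "frechet_derivative f (at x) h = ?D \<bullet> h" for h
  proof -
    have "frechet_derivative f (at x) h = (\<Sum>b\<in>Basis. (h \<bullet> b) * frechet_derivative f (at x) b)"
      by (subst euclidean_representation[of h, symmetric]) (simp add: linear_sum[OF l] linear_scale[OF l])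
    then show ?thesis unfolding inner_sum_left inner_scaleR_left by (simp add: inner_commute mult.commute)
  qed
  then have "frechet_derivative f (at x) = (\<lambda>h. ?D \<bullet> h)" by blast
  with d have "(f has_derivative (\<lambda>h. ?D \<bullet> h)) (at x)" by simp
  moreover from this show "gradient f x = ?D" by (rule gradient_eq)
  ultimately show "(f has_derivative (\<lambda>h. gradient f x \<bullet> h)) (at x)" by simp
qed

text \<open>The ball around \<open>x\<close> that touches the frontier at \<open>z\<close> forces
  the gradient of the defining function at \<open>z\<close> to be a positive multiple of
  \<open>z - x\<close>; Taylor's formula with a Lipschitz gradient then bounds the distance to the
  tangent plane quadratically. The bound is one-sided on the closure, where the defining function is
  at most zero, and two-sided on the frontier, where it vanishes. The factor \<open>dist x z\<close>
  stems from leaving \<open>z - x\<close> unnormalised.\<close>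

lemma local_quadratic_bound:
  fixes \<Omega> :: "'a::euclidean_space set"
  assumes \<Omega>: "smooth_bounded_domain \<Omega>" and z0: "z0 \<in> frontier \<Omega>"
  shows "\<exists>r>0. \<exists>K\<ge>0. \<forall>x\<in>\<Omega>. \<forall>z\<in>frontier \<Omega> \<inter> ball z0 r. dist x z = infdist x (frontier \<Omega>) \<longrightarrow>
    (\<forall>a. (a \<in> closure \<Omega> \<longrightarrow> (a - z) \<bullet> (z - x) \<le> K * dist x z * (norm (a - z))\<^sup>2) \<and>
      (a \<in> frontier \<Omega> \<longrightarrow> \<bar>(a - z) \<bullet> (z - x)\<bar> \<le> K * dist x z * (norm (a - z))\<^sup>2))"
proof -
  have o: "open \<Omega>" and co: "connected \<Omega>" using \<Omega> by (auto simp: smooth_bounded_domain_def)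
  have "\<forall>z\<in>frontier \<Omega>. \<exists>U \<rho>. open U \<and> z \<in> U \<and> Cinf_on \<rho> U \<and>
        (\<forall>x\<in>U. gradient \<rho> x \<noteq> 0) \<and>
        \<Omega> \<inter> U = {x\<in>U. \<rho> x < 0} \<and> frontier \<Omega> \<inter> U = {x\<in>U. \<rho> x = 0}"
    using \<Omega> unfolding smooth_bounded_domain_def by (elim conjE)
  from bspec[OF this z0] obtain U \<rho> where U\<rho>: "open U \<and> z0 \<in> U \<and> Cinf_on \<rho> U \<and>
        (\<forall>x\<in>U. gradient \<rho> x \<noteq> 0) \<and>
        \<Omega> \<inter> U = {x\<in>U. \<rho> x < 0} \<and> frontier \<Omega> \<inter> U = {x\<in>U. \<rho> x = 0}"
    by (elim exE)
  have U: "open U" "z0 \<in> U" and \<rho>: "Cinf_on \<rho> U"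
    and g0: "\<And>x. x \<in> U \<Longrightarrow> gradient \<rho> x \<noteq> 0"
    and in\<Omega>: "\<Omega> \<inter> U = {x\<in>U. \<rho> x < 0}" and fr: "frontier \<Omega> \<inter> U = {x\<in>U. \<rho> x = 0}"
    using U\<rho> by simp_all
  obtain r0 where r0: "r0 > 0" "cball z0 r0 \<subseteq> U" using U open_contains_cball by blast
  define r where "r = r0 / 2"
  have r: "r > 0" "cball z0 (2 * r) \<subseteq> U" using r0 by (auto simp: r_def)
  let ?B = "cball z0 (2 * r)"
  have Ck: "Ck_on (Suc (Suc 0)) \<rho> U" using \<rho> by (simp only: Cinf_on_def)
  note D = Ck_on_SucD[OF Ck]
  let ?N = "gradient \<rho>"
  have df: "\<rho> differentiable (at x)" if "x \<in> U" for x using D(1)[OF that] by (auto simp: differentiable_def)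
  note hd = has_derivative_gradient(1)[OF df] and geq = has_derivative_gradient(2)[OF df]
  have "\<exists>L. L \<ge> 0 \<and> (\<forall>w\<in>?B. \<forall>z\<in>?B. \<bar>frechet_derivative \<rho> (at w) b - frechet_derivative \<rho> (at z) b\<bar> \<le> L * norm (w - z))"
    if "b \<in> Basis" for b
    using Ck_on_1_lipschitz[OF D(2)[OF that] r(2)] by metis
  then obtain l where l: "\<And>b. b \<in> Basis \<Longrightarrow> l b \<ge> 0"
    "\<And>b w z. b \<in> Basis \<Longrightarrow> w \<in> ?B \<Longrightarrow> z \<in> ?B \<Longrightarrow> \<bar>frechet_derivative \<rho> (at w) b - frechet_derivative \<rho> (at z) b\<bar> \<le> l b * norm (w - z)"
    by metis
  define L where "L = (\<Sum>b\<in>Basis. l b)"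
  have L0: "L \<ge> 0" unfolding L_def using l(1) by (intro sum_nonneg) auto
  have lip: "norm (?N w - ?N z) \<le> L * norm (w - z)" if "w \<in> ?B" "z \<in> ?B" for w z
  proof -
    have "?N w - ?N z = (\<Sum>b\<in>Basis. (frechet_derivative \<rho> (at w) b - frechet_derivative \<rho> (at z) b) *\<^sub>R b)"
      using geq that r(2) by (simp add: subset_iff scaleR_diff_left sum_subtractf)
    also have "norm \<dots> \<le> (\<Sum>b\<in>Basis. l b * norm (w - z))"
      by (rule order_trans[OF norm_sum sum_mono]) (use l(2) that in auto)
    finally show ?thesis by (simp add: L_def sum_distrib_right)
  qed
  have cN: "continuous_on ?B ?N"
  proof (rule continuous_on_eq)
    show "continuous_on ?B (\<lambda>x. \<Sum>b\<in>Basis. frechet_derivative \<rho> (at x) b *\<^sub>R b)"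
      using Ck_on_imp_continuous_on[OF D(2)] r(2) by (auto intro!: continuous_intros intro: continuous_on_subset)
    show "(\<Sum>b\<in>Basis. frechet_derivative \<rho> (at x) b *\<^sub>R b) = ?N x" if "x \<in> ?B" for x
      using geq that r(2) by auto
  qed
  obtain zm where zm: "zm \<in> ?B" "\<And>z. z \<in> ?B \<Longrightarrow> norm (?N zm) \<le> norm (?N z)"
    using continuous_attains_inf[OF compact_cball _ continuous_on_norm[OF cN]] r(1) by (metis cball_eq_empty less_imp_le mult_pos_pos not_le zero_less_numeral)
  define m where "m = norm (?N zm)"
  have m: "m > 0" "\<And>z. z \<in> ?B \<Longrightarrow> m \<le> norm (?N z)" using zm g0[of zm] r(2) by (auto simp: m_def)
  have taylor: "\<bar>\<rho> a - \<rho> z - ?N z \<bullet> (a - z)\<bar> \<le> L * (norm (a - z))\<^sup>2" if a: "a \<in> ?B" and z: "z \<in> ?B" for a z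
  proof -
    have seg: "closed_segment z a \<subseteq> ?B" using a z by (intro closed_segment_subset convex_cball)
    have "norm ((\<rho> a - ?N z \<bullet> a) - (\<rho> z - ?N z \<bullet> z)) \<le> (L * norm (a - z)) * norm (a - z)"
    proof (rule differentiable_bound[of "closed_segment z a" "\<lambda>w. \<rho> w - ?N z \<bullet> w" "\<lambda>w h. ?N w \<bullet> h - ?N z \<bullet> h"])
      show "((\<lambda>w. \<rho> w - ?N z \<bullet> w) has_derivative (\<lambda>h. ?N w \<bullet> h - ?N z \<bullet> h)) (at w within closed_segment z a)"
        if "w \<in> closed_segment z a" for w
        using that seg r(2)
        by (intro has_derivative_diff has_derivative_at_withinI[OF hd] bounded_linear_imp_has_derivative bounded_linear_inner_right) auto
      show "onorm (\<lambda>h. ?N w \<bullet> h - ?N z \<bullet> h) \<le> L * norm (a - z)" if w: "w \<in> closed_segment z a" for w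
      proof (rule onorm_bound)
        fix h
        have "\<bar>?N w \<bullet> h - ?N z \<bullet> h\<bar> \<le> norm (?N w - ?N z) * norm h"
          using Cauchy_Schwarz_ineq2[of "?N w - ?N z" h] by (simp add: inner_diff_left)
        also have "\<dots> \<le> (L * norm (a - z)) * norm h"
        proof (rule mult_right_mono)
          have "norm (?N w - ?N z) \<le> L * norm (w - z)" using lip w seg z by blast
          also have "\<dots> \<le> L * norm (a - z)" using L0 segment_bound(1)[OF w] by (intro mult_left_mono) (auto simp: norm_minus_commute)
          finally show "norm (?N w - ?N z) \<le> L * norm (a - z)" .
        qed simp
        finally show "norm (?N w \<bullet> h - ?N z \<bullet> h) \<le> L * norm (a - z) * norm h" by simp
      qed (use L0 in simp)
    qed auto
    then show ?thesis by (simp add: inner_diff_right power2_eq_square algebra_simps)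
  qed
  \<comment> \<open>\<open>L / m\<close> comes from Taylor's formula, divided by the least gradient
    norm on \<open>?B\<close>. The term \<open>1 / r\<close> serves points outside
    \<open>?B\<close>, where \<open>r <= norm (a - z)\<close> turns the Cauchy-Schwarz bound into a
    quadratic one.\<close>
  define K where "K = L / m + 1 / r"
  have K: "K \<ge> 0" "L / m \<le> K" "1 / r \<le> K" using L0 m(1) r(1) by (auto simp: K_def)
  have main: "(a \<in> closure \<Omega> \<longrightarrow> (a - z) \<bullet> (z - x) \<le> K * dist x z * (norm (a - z))\<^sup>2) \<and>
      (a \<in> frontier \<Omega> \<longrightarrow> \<bar>(a - z) \<bullet> (z - x)\<bar> \<le> K * dist x z * (norm (a - z))\<^sup>2)"
    if x: "x \<in> \<Omega>" and z: "z \<in> frontier \<Omega>" "z \<in> ball z0 r" and dz: "dist x z = infdist x (frontier \<Omega>)" for x z a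
  proof -
    define d where "d = dist x z"
    have "z \<notin> \<Omega>" using z(1) o by (simp add: frontier_def interior_open)
    then have d: "d > 0" using x by (auto simp: d_def)
    have zB: "z \<in> ?B" using z(2) r(1) by auto
    have zU: "z \<in> U" using zB r(2) by blast
    have \<rho>z: "\<rho> z = 0" using fr z(1) zU by blast
    have ball: "ball x d \<subseteq> \<Omega>"
    proof (rule ccontr)
      assume "\<not> ball x d \<subseteq> \<Omega>"
      then have "ball x d - \<Omega> \<noteq> {}" by auto
      moreover have "x \<in> ball x d \<inter> \<Omega>" using x d by simp
      ultimately have "ball x d \<inter> frontier \<Omega> \<noteq> {}"
        using connected_Int_frontier[OF connected_ball, of x d \<Omega>] by blast
      then obtain w where "w \<in> ball x d" "w \<in> frontier \<Omega>" by blast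
      then show False using infdist_le[of w "frontier \<Omega>" x] dz by (auto simp: d_def)
    qed
    define e where "e = (z - x) /\<^sub>R d"
    have e: "norm e = 1" "z - x = d *\<^sub>R e" using d by (auto simp: e_def d_def dist_norm norm_minus_commute)
    \<comment> \<open>A direction with \<open>v \<bullet> e < 0\<close> enters the touching ball,
      where the defining function is negative, so that function cannot increase along it to first
      order.\<close>
    have half: "?N z \<bullet> v \<le> 0" if v: "v \<bullet> e < 0" for v
    proof (rule ccontr)
      assume "\<not> ?N z \<bullet> v \<le> 0"
      then have pos: "?N z \<bullet> v > 0" by simp
      have "((\<lambda>t. \<rho> (z + t *\<^sub>R v)) has_real_derivative ?N z \<bullet> v) (at 0)"
      proof -
        have "((\<lambda>t. \<rho> (z + t *\<^sub>R v)) has_derivative (\<lambda>h. ?N z \<bullet> (h *\<^sub>R v))) (at 0)"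
          by (rule has_derivative_compose[of "\<lambda>t. z + t *\<^sub>R v"]) (use hd[OF zU] in \<open>auto intro!: derivative_eq_intros\<close>)
        then show ?thesis by (simp add: has_field_derivative_def mult.commute[of _ "_ \<bullet> _"])
      qed
      from DERIV_pos_inc_right[OF this pos] obtain t0 where t0: "t0 > 0" "\<And>h. h > 0 \<Longrightarrow> h < t0 \<Longrightarrow> \<rho> (z + 0 *\<^sub>R v) < \<rho> (z + (0 + h) *\<^sub>R v)" by blast
      have v0: "norm v > 0" using v by auto
      obtain r1 where r1: "r1 > 0" "ball z r1 \<subseteq> U" using U(1) zU openE by blast
      \<comment> \<open>The three bounds keep the sign given by the derivative, keep the point
        inside \<open>U\<close>, and keep it inside the touching ball.\<close>
      define t where "t = min (t0 / 2) (min (r1 / (2 * norm v)) (- (v \<bullet> e) * d / (norm v)\<^sup>2))"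
      have t: "t > 0" "t < t0" "t \<le> r1 / (2 * norm v)" "t \<le> - (v \<bullet> e) * d / (norm v)\<^sup>2"
        using t0(1) r1(1) v0 v d by (auto simp: t_def min_less_iff_disj mult_neg_pos divide_neg_pos)
      have "t * norm v \<le> r1 / 2" using t(3) v0 by (simp add: field_simps)
      then have "z + t *\<^sub>R v \<in> ball z r1" using t(1) r1(1) by (simp add: dist_norm)
      then have inU: "z + t *\<^sub>R v \<in> U" using r1 by blast
      have "(norm (z + t *\<^sub>R v - x))\<^sup>2 = (norm (d *\<^sub>R e + t *\<^sub>R v))\<^sup>2" using e(2) by (simp add: algebra_simps)
      also have "\<dots> = d\<^sup>2 + 2 * d * t * (v \<bullet> e) + t\<^sup>2 * (norm v)\<^sup>2"
        using e(1) unfolding power2_norm_eq_inner norm_eq_1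
        by (simp add: inner_add inner_commute power2_eq_square algebra_simps)
      also have "t\<^sup>2 * (norm v)\<^sup>2 \<le> t * (- (v \<bullet> e) * d)"
      proof -
        have "t * (norm v)\<^sup>2 \<le> - (v \<bullet> e) * d" using t(4) v0 pos_le_divide_eq[of "(norm v)\<^sup>2" t "- (v \<bullet> e) * d"] by simp
        from mult_left_mono[OF this, of t] show ?thesis using t(1) by (simp add: power2_eq_square mult_ac)
      qed
      also have "d\<^sup>2 + 2 * d * t * (v \<bullet> e) + t * (- (v \<bullet> e) * d) = d\<^sup>2 + d * t * (v \<bullet> e)" by (simp add: algebra_simps)
      also have "\<dots> < d\<^sup>2" using d t(1) v by (simp add: mult_pos_neg)
      finally have "norm (z + t *\<^sub>R v - x) < d" using d by (simp add: power2_less_imp_less)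
      then have "z + t *\<^sub>R v \<in> \<Omega>" using ball by (auto simp: dist_norm norm_minus_commute)
      then have "\<rho> (z + t *\<^sub>R v) < 0" using in\<Omega> inU by blast
      then show False using t0(2)[of t] t \<rho>z by simp
    qed
    define n where "n = ?N z"
    have nm: "m \<le> norm n" using m(2)[OF zB] by (simp add: n_def)
    have ne0: "n \<bullet> e \<ge> 0" using half[of "- e"] e(1) by (force simp: n_def norm_eq_1)
    \<comment> \<open>The tangential part of \<open>n\<close> is orthogonal to \<open>e\<close>,
      while \<open>half\<close> wants a strict inequality. It is therefore tilted by
      \<open>s'\<close> towards the ball; since \<open>s\<close> is arbitrary, the tangential part
      vanishes.\<close>
    have "norm n ^ 2 - (n \<bullet> e)\<^sup>2 \<le> s" if "s > 0" for s
    proof -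
      define s' where "s' = s / (n \<bullet> e + 1)"
      have s': "s' > 0" "s' * (n \<bullet> e) \<le> s" using that ne0 by (auto simp: s'_def field_simps)
      have "?N z \<bullet> (n - (n \<bullet> e) *\<^sub>R e - s' *\<^sub>R e) \<le> 0"
        using s' e(1) by (intro half) (simp add: inner_diff_left norm_eq_1)
      then show ?thesis using s'(2) unfolding power2_norm_eq_inner
        by (simp add: n_def[symmetric] inner_diff_right power2_eq_square)
    qed
    then have "norm n ^ 2 - (n \<bullet> e)\<^sup>2 \<le> 0" by (meson dense not_le)
    moreover have "(norm (n - (n \<bullet> e) *\<^sub>R e))\<^sup>2 = norm n ^ 2 - (n \<bullet> e)\<^sup>2"
      using e(1) unfolding power2_norm_eq_inner norm_eq_1
      by (simp add: inner_diff inner_commute power2_eq_square algebra_simps)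
    ultimately have "(norm (n - (n \<bullet> e) *\<^sub>R e))\<^sup>2 \<le> 0" by simp
    then have ne: "n = (n \<bullet> e) *\<^sub>R e" by simp
    have "norm n = norm ((n \<bullet> e) *\<^sub>R e)" using ne by (rule arg_cong)
    then have nn: "norm n = n \<bullet> e" using e(1) ne0 by simp
    have n_e: "w \<bullet> n = norm n * (w \<bullet> e)" for w
      using arg_cong[OF ne, of "\<lambda>u. w \<bullet> u"] by (simp add: nn)
    have scal: "(a - z) \<bullet> (z - x) = d * ((a - z) \<bullet> e)" using e(2) by simp
    have far: "\<bar>(a - z) \<bullet> (z - x)\<bar> \<le> K * dist x z * (norm (a - z))\<^sup>2" if "a \<notin> ?B"
    proof -
      have "r \<le> norm (a - z)" using that z(2) dist_triangle[of z0 a z] by (simp add: dist_norm norm_minus_commute)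
      then have "1 \<le> K * norm (a - z)"
        using mult_mono[OF K(3), of r "norm (a - z)"] r(1) K(1) by simp
      have "\<bar>(a - z) \<bullet> (z - x)\<bar> \<le> norm (a - z) * d"
        using Cauchy_Schwarz_ineq2[of "a - z" "z - x"] by (simp add: d_def dist_norm norm_minus_commute)
      also have "\<dots> \<le> (K * norm (a - z)) * (norm (a - z) * d)"
        using mult_right_mono[OF \<open>1 \<le> K * norm (a - z)\<close>, of "norm (a - z) * d"] d by simp
      finally show ?thesis by (simp add: d_def power2_eq_square mult_ac)
    qed
    have near: "w \<bullet> (z - x) \<le> K * dist x z * q" if "n \<bullet> w \<le> L * q" "0 \<le> q" for w q
    proof -
      have "norm n * (w \<bullet> e) \<le> L * q" using that(1) n_e[of w] by (simp add: inner_commute)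
      moreover have np: "norm n > 0" using nm m(1) by linarith
      ultimately have "w \<bullet> e \<le> L * q / norm n" by (simp add: pos_le_divide_eq mult.commute)
      also have "\<dots> \<le> L * q / m"
        using nm L0 that(2) by (intro divide_left_mono mult_nonneg_nonneg mult_pos_pos np m(1))
      also have "\<dots> \<le> K * q" using mult_right_mono[OF K(2) that(2)] by simp
      finally have "d * (w \<bullet> e) \<le> d * (K * q)" using d by (intro mult_left_mono) auto
      then show ?thesis unfolding e(2) by (simp add: d_def mult_ac)
    qed
    show ?thesis
    proof (cases "a \<in> ?B")
      case True
      have t: "\<bar>\<rho> a - n \<bullet> (a - z)\<bar> \<le> L * (norm (a - z))\<^sup>2"
        using taylor[OF True zB] \<rho>z by (simp add: n_def)
      have aU: "a \<in> U" using True r(2) by blast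
      have "\<rho> a \<le> 0" if "a \<in> closure \<Omega>"
        using that aU in\<Omega> fr closure_Un_frontier[of \<Omega>] by force
      moreover have "\<rho> a = 0" if "a \<in> frontier \<Omega>" using that aU fr by blast
      ultimately have "(a - z) \<bullet> (z - x) \<le> K * dist x z * (norm (a - z))\<^sup>2" if "a \<in> closure \<Omega>"
        using near[of "a - z" "(norm (a - z))\<^sup>2"] t that by force
      moreover have "\<bar>(a - z) \<bullet> (z - x)\<bar> \<le> K * dist x z * (norm (a - z))\<^sup>2" if "a \<in> frontier \<Omega>"
      proof -
        have "\<rho> a = 0" using that aU fr by blast
        then show ?thesis
          using near[of "a - z" "(norm (a - z))\<^sup>2"] near[of "- (a - z)" "(norm (a - z))\<^sup>2"] t
          by (simp only: inner_minus_left inner_minus_right abs_le_iff) simp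
      qed
      ultimately show ?thesis by blast
    next
      case False
      then show ?thesis using far abs_le_D1 by blast
    qed
  qed
  show ?thesis
  proof (rule exI[of _ r], intro conjI r(1), rule exI[of _ K], intro conjI K(1) ballI impI, rule allI)
    fix x z a assume "x \<in> \<Omega>" "z \<in> frontier \<Omega> \<inter> ball z0 r" "dist x z = infdist x (frontier \<Omega>)"
    then show "(a \<in> closure \<Omega> \<longrightarrow> (a - z) \<bullet> (z - x) \<le> K * dist x z * (norm (a - z))\<^sup>2) \<and>
      (a \<in> frontier \<Omega> \<longrightarrow> \<bar>(a - z) \<bullet> (z - x)\<bar> \<le> K * dist x z * (norm (a - z))\<^sup>2)"
      using main[of x z a] by blast
  qed
qed

text \<open>Compactness of the frontier turns the local constants into one \<open>K\<close>. The
  condition \<open>K * d <= 1 / 16\<close> makes the nearest frontier point unique, so that the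
  definite description in \<open>bdry_dir\<close> denotes; for the other statements the quadratic
  bound is divided by \<open>d\<close>.\<close>

lemma bdry_geometry:
  fixes \<Omega> :: "'a::euclidean_space set"
  assumes \<Omega>: "smooth_bounded_domain \<Omega>"
  obtains K where "K > 0"
    "\<And>x. x \<in> \<Omega> \<Longrightarrow> 0 < bdry_dist \<Omega> x"
    "\<And>x. x \<in> \<Omega> \<Longrightarrow> ball x (bdry_dist \<Omega> x) \<subseteq> \<Omega>"
    "\<And>x. x \<in> \<Omega> \<Longrightarrow> K * bdry_dist \<Omega> x \<le> 1 / 16 \<Longrightarrow>
      norm (bdry_dir \<Omega> x) = 1 \<and> x + bdry_dist \<Omega> x *\<^sub>R bdry_dir \<Omega> x \<in> frontier \<Omega>"
    "\<And>x a. x \<in> \<Omega> \<Longrightarrow> K * bdry_dist \<Omega> x \<le> 1 / 16 \<Longrightarrow> a \<in> closure \<Omega> \<Longrightarrow>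
      (a - (x + bdry_dist \<Omega> x *\<^sub>R bdry_dir \<Omega> x)) \<bullet> bdry_dir \<Omega> x \<le> K * (norm (a - (x + bdry_dist \<Omega> x *\<^sub>R bdry_dir \<Omega> x)))\<^sup>2"
    "\<And>x a. x \<in> \<Omega> \<Longrightarrow> K * bdry_dist \<Omega> x \<le> 1 / 16 \<Longrightarrow> a \<in> frontier \<Omega> \<Longrightarrow>
      \<bar>(a - (x + bdry_dist \<Omega> x *\<^sub>R bdry_dir \<Omega> x)) \<bullet> bdry_dir \<Omega> x\<bar> \<le> K * (norm (a - (x + bdry_dist \<Omega> x *\<^sub>R bdry_dir \<Omega> x)))\<^sup>2"
proof -
  have o: "open \<Omega>" and co: "connected \<Omega>" and bo: "bounded \<Omega>" and ne: "\<Omega> \<noteq> {}"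
    using \<Omega> by (auto simp: smooth_bounded_domain_def)
  let ?F = "frontier \<Omega>"
  have F: "?F \<noteq> {}" "closed ?F" "compact ?F"
    using frontier_eq_empty[of \<Omega>] ne bo not_bounded_UNIV by (auto simp: compact_frontier_bounded)
  define P where "P r K z0 \<longleftrightarrow> r > 0 \<and> K \<ge> 0 \<and> (\<forall>x\<in>\<Omega>. \<forall>z\<in>?F \<inter> ball z0 r. dist x z = infdist x ?F \<longrightarrow>
     (\<forall>a. (a \<in> closure \<Omega> \<longrightarrow> (a - z) \<bullet> (z - x) \<le> K * dist x z * (norm (a - z))\<^sup>2) \<and>
     (a \<in> ?F \<longrightarrow> \<bar>(a - z) \<bullet> (z - x)\<bar> \<le> K * dist x z * (norm (a - z))\<^sup>2)))" for r K z0
  have "\<exists>r K. P r K z0" if "z0 \<in> ?F" for z0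
    using local_quadratic_bound[OF \<Omega> that] unfolding P_def by (elim exE conjE) (intro exI conjI)
  then obtain r k where rk: "\<And>z0. z0 \<in> ?F \<Longrightarrow> P (r z0) (k z0) z0" by metis
  have "?F \<subseteq> (\<Union>z0\<in>?F. ball z0 (r z0))"
    using rk by (force simp: P_def)
  then obtain C where C: "C \<subseteq> ?F" "finite C" "?F \<subseteq> (\<Union>z0\<in>C. ball z0 (r z0))"
    using compactE_image[OF F(3), of ?F "\<lambda>z0. ball z0 (r z0)"] by (metis open_ball)
  define K where "K = 1 + (\<Sum>z0\<in>C. k z0)"
  have kpos: "k z0 \<ge> 0" if "z0 \<in> C" for z0 using rk[of z0] that C(1) by (auto simp: P_def)
  have K1: "K \<ge> 1" unfolding K_def using kpos by (simp add: sum_nonneg)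
  have kK: "k z0 \<le> K" if "z0 \<in> C" for z0
    unfolding K_def using member_le_sum[OF that, of k] kpos C(2) by auto
  have main: "(a \<in> closure \<Omega> \<longrightarrow> (a - z) \<bullet> (z - x) \<le> K * dist x z * (norm (a - z))\<^sup>2) \<and>
     (a \<in> ?F \<longrightarrow> \<bar>(a - z) \<bullet> (z - x)\<bar> \<le> K * dist x z * (norm (a - z))\<^sup>2)"
    if "x \<in> \<Omega>" "z \<in> ?F" "dist x z = infdist x ?F" for x z a
  proof -
    obtain z0 where z0: "z0 \<in> C" "z \<in> ball z0 (r z0)" using C(3) \<open>z \<in> ?F\<close> by auto
    have "P (r z0) (k z0) z0" using rk z0(1) C(1) by blast
    then have "(a \<in> closure \<Omega> \<longrightarrow> (a - z) \<bullet> (z - x) \<le> k z0 * dist x z * (norm (a - z))\<^sup>2) \<and>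
     (a \<in> ?F \<longrightarrow> \<bar>(a - z) \<bullet> (z - x)\<bar> \<le> k z0 * dist x z * (norm (a - z))\<^sup>2)"
      using that z0(2) unfolding P_def by blast
    moreover have "k z0 * dist x z * (norm (a - z))\<^sup>2 \<le> K * dist x z * (norm (a - z))\<^sup>2"
      using kK[OF z0(1)] by (intro mult_right_mono) auto
    ultimately show ?thesis by linarith
  qed
  let ?d = "bdry_dist \<Omega>"
  have notin: "w \<notin> ?F" if "w \<in> \<Omega>" for w using that o by (simp add: frontier_def interior_open)
  have dpos: "?d x > 0" if "x \<in> \<Omega>" for x
    unfolding bdry_dist_def using infdist_pos_not_in_closed[OF F(2,1) notin[OF that]] .
  have ball: "ball x (?d x) \<subseteq> \<Omega>" if x: "x \<in> \<Omega>" for x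
  proof (rule ccontr)
    assume "\<not> ball x (?d x) \<subseteq> \<Omega>"
    then have "ball x (?d x) - \<Omega> \<noteq> {}" by auto
    moreover have "x \<in> ball x (?d x) \<inter> \<Omega>" using x dpos by simp
    ultimately have "ball x (?d x) \<inter> ?F \<noteq> {}"
      using connected_Int_frontier[OF connected_ball, of x "?d x" \<Omega>] by blast
    then obtain w where "w \<in> ball x (?d x)" "w \<in> ?F" by blast
    then show False using infdist_le[of w ?F x] by (auto simp: bdry_dist_def)
  qed
  have dir: "norm (bdry_dir \<Omega> x) = 1 \<and> x + ?d x *\<^sub>R bdry_dir \<Omega> x \<in> ?F" if x: "x \<in> \<Omega>" and small: "K * ?d x \<le> 1 / 16" for x
  proof -
    obtain z where z: "z \<in> ?F" "infdist x ?F = dist x z" using infdist_attains_inf[OF F(2,1)] by blast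
    define \<nu> where "\<nu> = (z - x) /\<^sub>R ?d x"
    have d: "?d x > 0" "?d x = dist x z" using dpos[OF x] z(2) by (auto simp: bdry_dist_def)
    have \<nu>: "norm \<nu> = 1" "x + ?d x *\<^sub>R \<nu> = z" using d by (auto simp: \<nu>_def dist_norm norm_minus_commute)
    \<comment> \<open>If \<open>w\<close> and \<open>z\<close> are both nearest points, expanding
      \<open>|w - x| = |z - x|\<close> gives
      \<open>|w - z|^2 = - 2 (w - z) \<bullet> (z - x)\<close>, and the quadratic bound makes the
      right-hand side at most \<open>|w - z|^2 / 8\<close>.\<close>
    have "\<mu> = \<nu>" if \<mu>: "norm \<mu> = 1 \<and> x + ?d x *\<^sub>R \<mu> \<in> ?F" for \<mu>
    proof -
      define w where "w = x + ?d x *\<^sub>R \<mu>"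
      have "(norm (w - z))\<^sup>2 + 2 * ((w - z) \<bullet> (z - x)) + (norm (z - x))\<^sup>2 = (norm (w - x))\<^sup>2"
        using dot_norm[of "w - z" "z - x"] by (simp add: field_simps)
      moreover have "norm (w - x) = norm (z - x)" using \<mu> d by (simp add: w_def dist_norm norm_minus_commute)
      ultimately have "(norm (w - z))\<^sup>2 = - 2 * ((w - z) \<bullet> (z - x))" by simp
      also have "\<dots> \<le> 2 * (K * ?d x * (norm (w - z))\<^sup>2)"
        using main[OF x z(1), of w] z(2) \<mu> d(2) unfolding w_def[symmetric] by auto
      also have "\<dots> \<le> 2 * (1 / 16 * (norm (w - z))\<^sup>2)" using small by (intro mult_left_mono mult_right_mono) auto
      finally have "w = z" by simp
      then show ?thesis using d(1) \<nu>(2) by (simp add: w_def) (metis add_left_cancel less_irrefl real_vector.scale_cancel_left)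
    qed
    then have "bdry_dir \<Omega> x = \<nu>" unfolding bdry_dir_def using \<nu> z(1) by (intro the_equality) auto
    then show ?thesis using \<nu> z(1) by simp
  qed
  have quad: "(a \<in> closure \<Omega> \<longrightarrow> (a - (x + ?d x *\<^sub>R bdry_dir \<Omega> x)) \<bullet> bdry_dir \<Omega> x \<le> K * (norm (a - (x + ?d x *\<^sub>R bdry_dir \<Omega> x)))\<^sup>2) \<and>
     (a \<in> ?F \<longrightarrow> \<bar>(a - (x + ?d x *\<^sub>R bdry_dir \<Omega> x)) \<bullet> bdry_dir \<Omega> x\<bar> \<le> K * (norm (a - (x + ?d x *\<^sub>R bdry_dir \<Omega> x)))\<^sup>2)"
    if x: "x \<in> \<Omega>" and small: "K * ?d x \<le> 1 / 16" for x a
  proof -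
    define \<nu> where "\<nu> = bdry_dir \<Omega> x"
    define z where "z = x + ?d x *\<^sub>R \<nu>"
    have d: "?d x > 0" by (rule dpos[OF x])
    have z: "z \<in> ?F" "norm \<nu> = 1" using dir[OF x small] by (auto simp: z_def \<nu>_def)
    have dz: "dist x z = ?d x" using d z(2) by (simp add: z_def dist_norm)
    have zx: "z - x = ?d x *\<^sub>R \<nu>" by (simp add: z_def)
    have m: "(a \<in> closure \<Omega> \<longrightarrow> ?d x * ((a - z) \<bullet> \<nu>) \<le> ?d x * (K * (norm (a - z))\<^sup>2)) \<and>
      (a \<in> ?F \<longrightarrow> ?d x * \<bar>(a - z) \<bullet> \<nu>\<bar> \<le> ?d x * (K * (norm (a - z))\<^sup>2))"
      using main[OF x z(1), of a] dz d by (simp add: bdry_dist_def zx[unfolded bdry_dist_def] abs_mult mult_ac)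
    then show ?thesis
      using d by (simp add: mult_le_cancel_left_pos flip: \<nu>_def z_def)
  qed
  show thesis
  proof (rule that)
    show "K > 0" using K1 by simp
  qed (use dpos ball dir quad in blast)+
qed

subsection \<open>Poisson's equation in the sense of distributions\<close>

text \<open>Sign convention: \<open>f\<close> is minus the Laplacian of \<open>u\<close>. Indicators
  in place of set integrals let the lemmas on integrals over the whole space apply directly;
  boundary values are treated separately.\<close>

definition weak_poisson :: "'a::euclidean_space set \<Rightarrow> ('a \<Rightarrow> real) \<Rightarrow> ('a \<Rightarrow> real) \<Rightarrow> bool" where
  "weak_poisson \<Omega> u f \<longleftrightarrow> integrable lborel (\<lambda>x. indicator \<Omega> x * u x) \<and> integrable lborel f \<and>
    (\<forall>\<phi>. test_function \<Omega> \<phi> \<longrightarrow>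
      integral\<^sup>L lborel (\<lambda>x. indicator \<Omega> x * u x * laplacian \<phi> x) = - integral\<^sup>L lborel (\<lambda>x. f x * \<phi> x))"

lemma test_functionD:
  fixes \<phi> :: "'a::euclidean_space \<Rightarrow> real"
  assumes "test_function \<Omega> \<phi>"
  shows "Ck_on k \<phi> UNIV" "x \<notin> \<Omega> \<Longrightarrow> \<phi> x = 0" "x \<notin> \<Omega> \<Longrightarrow> laplacian \<phi> x = 0"
    and "\<exists>R. \<forall>x. R \<le> norm x \<longrightarrow> \<phi> x = 0" "\<exists>M. \<forall>x. \<bar>\<phi> x\<bar> \<le> M" "\<exists>M. \<forall>x. \<bar>laplacian \<phi> x\<bar> \<le> M"
proof -
  let ?C = "closure {x. \<phi> x \<noteq> 0}"
  have a: "Cinf_on \<phi> UNIV" "compact ?C" "?C \<subseteq> \<Omega>" using assms by (auto simp: test_function_def)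
  then show Ck: "Ck_on k \<phi> UNIV" for k by (simp add: Cinf_on_def)
  have z: "\<phi> x = 0" if "x \<notin> ?C" for x using that closure_subset[of "{x. \<phi> x \<noteq> 0}"] by auto
  then show "x \<notin> \<Omega> \<Longrightarrow> \<phi> x = 0" using a(3) by blast
  show "laplacian \<phi> x = 0" if "x \<notin> \<Omega>"
  proof -
    have "laplacian \<phi> x = laplacian (\<lambda>_. 0::real) x"
    proof (rule laplacian_cong[of "- ?C"])
      show "x \<in> - ?C" using that a(3) by blast
      show "Ck_on 2 \<phi> (- ?C)" by (rule Ck_on_subset[OF Ck subset_UNIV])
      show "\<phi> w = 0" if "w \<in> - ?C" for w using z that by blast
    qed auto
    also have "\<dots> = 0" using laplacian_eq[of UNIV x "\<lambda>_. 0" "\<lambda>_ _. 0" "\<lambda>_ _. 0"] by simp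
    finally show ?thesis .
  qed
  obtain r where r: "\<And>x. x \<in> ?C \<Longrightarrow> norm x \<le> r" using compact_imp_bounded[OF a(2)] by (auto simp: bounded_iff)
  have R: "\<phi> x = 0" if "r + 1 \<le> norm x" for x using z[of x] r[of x] that by force
  then show "\<exists>R. \<forall>x. R \<le> norm x \<longrightarrow> \<phi> x = 0" by blast
  show "\<exists>M. \<forall>x. \<bar>\<phi> x\<bar> \<le> M"
    using continuous_bounded_support[OF Ck_on_imp_continuous_on[OF Ck] R] by metis
  have "laplacian \<phi> x = 0" if "r + 2 \<le> norm x" for x
    using laplacian_zero_outside[OF Ck R] that by simp
  then show "\<exists>M. \<forall>x. \<bar>laplacian \<phi> x\<bar> \<le> M"
    using continuous_bounded_support[OF continuous_on_laplacian[OF Ck]] by metis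
qed

lemma integrable_mult_bounded_continuous:
  fixes f g :: "'a::euclidean_space \<Rightarrow> real"
  assumes f: "integrable lborel f" and g: "continuous_on UNIV g" "\<And>x. \<bar>g x\<bar> \<le> M"
  shows "integrable lborel (\<lambda>x. f x * g x)"
proof (rule Bochner_Integration.integrable_bound[where f="\<lambda>x. M * f x"])
  show "(\<lambda>x. f x * g x) \<in> borel_measurable lborel"
    using f borel_measurable_continuous_onI[OF g(1)] by (intro borel_measurable_times) auto
  show "AE x in lborel. norm (f x * g x) \<le> norm (M * f x)"
    using mult_right_mono[OF order_trans[OF g(2) abs_ge_self], of "\<bar>f _\<bar>"] by (intro AE_I2) (simp add: abs_mult mult.commute)
qed (use f in simp)

lemma weak_poissonD:
  assumes "weak_poisson \<Omega> u f" "test_function \<Omega> \<phi>"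
  shows "integrable lborel (\<lambda>x. indicator \<Omega> x * u x * laplacian \<phi> x)" "integrable lborel (\<lambda>x. f x * \<phi> x)"
    "integral\<^sup>L lborel (\<lambda>x. indicator \<Omega> x * u x * laplacian \<phi> x) = - integral\<^sup>L lborel (\<lambda>x. f x * \<phi> x)"
proof -
  note t = test_functionD[OF assms(2)]
  show "integrable lborel (\<lambda>x. indicator \<Omega> x * u x * laplacian \<phi> x)"
    using integrable_mult_bounded_continuous[OF _ continuous_on_laplacian[OF t(1)]] t(6) assms(1)
    unfolding weak_poisson_def by blast
  show "integrable lborel (\<lambda>x. f x * \<phi> x)"
    using integrable_mult_bounded_continuous[OF _ Ck_on_imp_continuous_on[OF t(1)]] t(5) assms(1)
    unfolding weak_poisson_def by blast
qed (use assms in \<open>auto simp: weak_poisson_def\<close>)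

lemma weak_poisson_lincomb:
  assumes "weak_poisson \<Omega> u f" "weak_poisson \<Omega> v g"
  shows "weak_poisson \<Omega> (\<lambda>x. c * u x + d * v x) (\<lambda>x. c * f x + d * g x)"
  unfolding weak_poisson_def
proof (intro conjI allI impI)
  have e: "indicator \<Omega> x * (c * u x + d * v x) = c * (indicator \<Omega> x * u x) + d * (indicator \<Omega> x * v x)" for x
    by (simp add: algebra_simps)
  show "integrable lborel (\<lambda>x. indicator \<Omega> x * (c * u x + d * v x))" "integrable lborel (\<lambda>x. c * f x + d * g x)"
    unfolding e using assms by (auto simp: weak_poisson_def)
  fix \<phi> assume t: "test_function \<Omega> \<phi>"
  note p = weak_poissonD[OF assms(1) t] weak_poissonD[OF assms(2) t]
  have "integral\<^sup>L lborel (\<lambda>x. indicator \<Omega> x * (c * u x + d * v x) * laplacian \<phi> x) =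
    integral\<^sup>L lborel (\<lambda>x. c * (indicator \<Omega> x * u x * laplacian \<phi> x) + d * (indicator \<Omega> x * v x * laplacian \<phi> x))"
    by (rule Bochner_Integration.integral_cong) (auto simp: algebra_simps)
  also have "\<dots> = - integral\<^sup>L lborel (\<lambda>x. c * (f x * \<phi> x) + d * (g x * \<phi> x))" using p by simp
  also have "\<dots> = - integral\<^sup>L lborel (\<lambda>x. (c * f x + d * g x) * \<phi> x)"
    by (rule arg_cong[where f=uminus], rule Bochner_Integration.integral_cong) (auto simp: algebra_simps)
  finally show "integral\<^sup>L lborel (\<lambda>x. indicator \<Omega> x * (c * u x + d * v x) * laplacian \<phi> x) =
    - integral\<^sup>L lborel (\<lambda>x. (c * f x + d * g x) * \<phi> x)" .
qed

text \<open>Lebesgue integrals do not see the value at the pole. This allows a removable singularity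
  to be filled in before the minimum principle, which asks for continuity on the closure, is
  applied.\<close>

lemma weak_poisson_fun_upd:
  fixes y :: "'a::euclidean_space"
  assumes "weak_poisson \<Omega> u f" "open \<Omega>"
  shows "weak_poisson \<Omega> (u(y := l)) f"
proof -
  have AE: "AE x in lborel. indicator \<Omega> x * u x = indicator \<Omega> x * (u(y := l)) x"
    using AE_lborel_singleton[of y] by eventually_elim simp
  have m: "(\<lambda>x. indicator \<Omega> x * u x) \<in> borel_measurable borel" using assms(1) by (auto simp: weak_poisson_def)
  have eq: "indicator \<Omega> x * (u(y := l)) x = (\<lambda>x. if x \<in> {y} then indicator \<Omega> y * l else indicator \<Omega> x * u x) x" for x
    by simp
  have m': "(\<lambda>x. indicator \<Omega> x * (u(y := l)) x) \<in> borel_measurable borel"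
    unfolding eq by (intro measurable_If_set m) auto
  have i: "integrable lborel (\<lambda>x. indicator \<Omega> x * (u(y := l)) x)"
    by (rule integrable_cong_AE_imp[OF _ _ AE]) (use assms(1) m' in \<open>simp_all only: weak_poisson_def measurable_lborel2\<close>)
  have "integral\<^sup>L lborel (\<lambda>x. indicator \<Omega> x * (u(y := l)) x * laplacian \<phi> x) = integral\<^sup>L lborel (\<lambda>x. indicator \<Omega> x * u x * laplacian \<phi> x)"
    if "test_function \<Omega> \<phi>" for \<phi>
  proof (rule integral_cong_AE)
    have ml: "laplacian \<phi> \<in> borel_measurable borel"
      using test_functionD(1)[OF that] by (intro borel_measurable_continuous_onI continuous_on_laplacian)
    show "(\<lambda>x. indicator \<Omega> x * (u(y := l)) x * laplacian \<phi> x) \<in> borel_measurable lborel"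
      unfolding measurable_lborel2 by (rule borel_measurable_times[OF m' ml])
    show "(\<lambda>x. indicator \<Omega> x * u x * laplacian \<phi> x) \<in> borel_measurable lborel"
      unfolding measurable_lborel2 by (rule borel_measurable_times[OF m ml])
    show "AE x in lborel. indicator \<Omega> x * (u(y := l)) x * laplacian \<phi> x = indicator \<Omega> x * u x * laplacian \<phi> x"
      using AE by eventually_elim (simp only:)
  qed
  then show ?thesis using assms(1) i unfolding weak_poisson_def by auto
qed

lemma weak_poisson_radial:
  fixes y :: "'a::euclidean_space" and h h1 h2 L :: "real \<Rightarrow> real" and \<gamma> \<beta> A :: real
  assumes \<Omega>: "open \<Omega>" "bounded \<Omega>"
    and h: "\<And>t. t > 0 \<Longrightarrow> (h has_real_derivative h1 t) (at t)"
    and h1: "\<And>t. t > 0 \<Longrightarrow> (h1 has_real_derivative h2 t) (at t)"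
    and h2: "continuous_on {0<..} h2"
    and \<gamma>: "0 \<le> \<gamma>" "2 * \<gamma> < DIM('a)" and \<beta>: "0 \<le> \<beta>" "2 * \<beta> < DIM('a)"
    and bh: "\<And>t. t > 0 \<Longrightarrow> \<bar>h t\<bar> \<le> A * t powr (- \<gamma>)"
    and bh1: "\<And>t. t > 0 \<Longrightarrow> \<bar>h1 t\<bar> \<le> A * t powr (- \<beta>)"
    and bh2: "\<And>t. t > 0 \<Longrightarrow> \<bar>h2 t\<bar> \<le> A * t powr (- \<beta> - 1)"
    and L: "\<And>t. t > 0 \<Longrightarrow> L t = - (4 * t * h2 t + 2 * real DIM('a) * h1 t)"
  shows "weak_poisson \<Omega> (\<lambda>x. h ((norm (x - y))\<^sup>2)) (\<lambda>x. indicator \<Omega> x * L ((norm (x - y))\<^sup>2))"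
proof -
  let ?n = "real DIM('a)"
  define q where "q x = (norm (x - y))\<^sup>2" for x
  have q: "q x > 0" if "x \<noteq> y" for x using that by (simp add: q_def)
  have cq: "continuous_on S q" for S unfolding q_def by (intro continuous_intros)
  have qp: "q x powr a = norm (x - y) powr (2 * a)" for x a
    using powr_powr[of "norm (x - y)" 2 a] by (simp add: q_def)
  obtain r where r: "r > 0" "\<Omega> \<subseteq> ball y r"
    using bounded_subset_ballD[OF \<Omega>(2)] by blast
  have A: "A \<ge> 0" using bh1[of 1] by simp
  have ch: "continuous_on {0<..} h" "continuous_on {0<..} h1"
    using h h1 by (auto intro!: continuous_at_imp_continuous_on DERIV_isCont)
  have cL: "continuous_on {0<..} L"
    by (rule continuous_on_eq[of _ "\<lambda>t. - (4 * t * h2 t + 2 * ?n * h1 t)"]) (auto intro!: continuous_intros ch h2 simp: L)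
  have mf: "(\<lambda>x. indicator \<Omega> x * F (q x)) \<in> borel_measurable borel" if "continuous_on {0<..} F" for F :: "real \<Rightarrow> real"
    by (intro borel_measurable_times borel_measurable_indicator borel_measurable_except_point[of y]
        continuous_on_compose2[OF that] cq) (use q \<Omega>(1) in auto)
  have bL: "\<bar>L t\<bar> \<le> (4 + 2 * ?n) * A * t powr (- \<beta>)" if t: "t > 0" for t
  proof -
    have "t * \<bar>h2 t\<bar> \<le> t * (A * t powr (- \<beta> - 1))" using bh2[OF t] t by (intro mult_left_mono) auto
    also have "\<dots> = A * t powr (- \<beta>)" using t by (simp add: powr_diff)
    finally have "\<bar>4 * t * h2 t\<bar> \<le> 4 * (A * t powr (- \<beta>))" using t by (simp add: abs_mult)
    moreover have "\<bar>2 * ?n * h1 t\<bar> \<le> 2 * ?n * (A * t powr (- \<beta>))"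
      unfolding abs_mult using bh1[OF t] by (intro mult_mono) auto
    ultimately show ?thesis unfolding L[OF t] by (simp add: algebra_simps)
  qed
  have i1: "integrable lborel (\<lambda>x. indicator \<Omega> x * h (q x))"
  proof (rule integrable_riesz_bound[where y=y and r=r and \<beta>="2 * \<gamma>" and A=A, OF mf[OF ch(1)]])
    show "\<bar>indicator \<Omega> x * h (q x)\<bar> \<le> A * norm (x - y) powr (- (2 * \<gamma>))" if "x \<noteq> y" for x
      using bh[OF q[OF that]] qp[of x "- \<gamma>"] A by (simp add: indicator_def)
  qed (use \<gamma> r in \<open>auto simp: indicator_def\<close>)
  have i2: "integrable lborel (\<lambda>x. indicator \<Omega> x * L (q x))"
  proof (rule integrable_riesz_bound[where y=y and r=r and \<beta>="2 * \<beta>" and A="(4 + 2 * ?n) * A", OF mf[OF cL]])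
    show "\<bar>indicator \<Omega> x * L (q x)\<bar> \<le> (4 + 2 * ?n) * A * norm (x - y) powr (- (2 * \<beta>))" if "x \<noteq> y" for x
      using bL[OF q[OF that]] qp[of x "- \<beta>"] A by (simp add: indicator_def)
  qed (use \<beta> r in \<open>auto simp: indicator_def\<close>)
  have "integral\<^sup>L lborel (\<lambda>x. indicator \<Omega> x * h (q x) * laplacian \<phi> x) = - integral\<^sup>L lborel (\<lambda>x. indicator \<Omega> x * L (q x) * \<phi> x)"
    if t: "test_function \<Omega> \<phi>" for \<phi>
  proof -
    note tt = test_functionD[OF t]
    obtain R where R: "\<And>x. R \<le> norm x \<Longrightarrow> \<phi> x = 0" using tt(4) by blast
    have "integral\<^sup>L lborel (\<lambda>x. indicator \<Omega> x * h (q x) * laplacian \<phi> x) = integral\<^sup>L lborel (\<lambda>x. h (q x) * laplacian \<phi> x)"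
      by (rule Bochner_Integration.integral_cong) (use tt(3) in \<open>auto simp: indicator_def\<close>)
    also have "\<dots> = integral\<^sup>L lborel (\<lambda>x. (4 * q x * h2 (q x) + 2 * ?n * h1 (q x)) * \<phi> x)"
      unfolding q_def by (rule radial_weak_laplacian(3)[OF h h1 h2 \<gamma> \<beta> bh bh1 bh2 tt(1) R])
    also have "\<dots> = integral\<^sup>L lborel (\<lambda>x. - (indicator \<Omega> x * L (q x) * \<phi> x))"
    proof (rule integral_cong_AE)
      have m\<phi>: "\<phi> \<in> borel_measurable borel" by (rule borel_measurable_continuous_onI[OF Ck_on_imp_continuous_on[OF tt(1)]])
      show "(\<lambda>x. - (indicator \<Omega> x * L (q x) * \<phi> x)) \<in> borel_measurable lborel"
        unfolding measurable_lborel2 by (intro borel_measurable_uminus borel_measurable_times[OF mf[OF cL] m\<phi>])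
      show "(\<lambda>x. (4 * q x * h2 (q x) + 2 * ?n * h1 (q x)) * \<phi> x) \<in> borel_measurable lborel"
        using radial_weak_laplacian(2)[OF h h1 h2 \<gamma> \<beta> bh bh1 bh2 tt(1) R] unfolding q_def by (rule borel_measurable_integrable)
      show "AE x in lborel. (4 * q x * h2 (q x) + 2 * ?n * h1 (q x)) * \<phi> x = - (indicator \<Omega> x * L (q x) * \<phi> x)"
        using AE_lborel_singleton[of y]
      proof eventually_elim
        case (elim x)
        show ?case using tt(2)[of x] by (cases "x \<in> \<Omega>") (simp_all add: L[OF q[OF elim]] algebra_simps)
      qed
    qed
    finally show ?thesis by simp
  qed
  then show ?thesis using i1 i2 unfolding weak_poisson_def q_def by blast
qed

lemma powr_mult_self: "0 < t \<Longrightarrow> b = a + 1 \<Longrightarrow> t * t powr a = t powr (b::real)"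
  by (simp add: powr_add)

text \<open>The identity behind \<open>\<alpha>1_const\<close>: with
  \<open>(n - 2) * p = s + 2\<close> the factor \<open>s * (n - 2 - s)\<close> is its denominator.
  The condition \<open>s + 2 < n\<close> keeps the source integrable, and no point mass appears at
  \<open>y\<close>.\<close>

lemma weak_poisson_power:
  fixes y :: "'a::euclidean_space"
  assumes \<Omega>: "open \<Omega>" "bounded \<Omega>" and s: "0 < s" "s + 2 < real DIM('a)"
  shows "weak_poisson \<Omega> (\<lambda>x. norm (x - y) powr (- s))
    (\<lambda>x. indicator \<Omega> x * (s * (real DIM('a) - 2 - s) * norm (x - y) powr (- (s + 2))))"
proof -
  let ?n = "real DIM('a)"
  define L where "L t = s * (?n - 2 - s) * t powr (- (s / 2 + 1))" for t
  have "weak_poisson \<Omega> (\<lambda>x. (\<lambda>t. t powr (- (s / 2))) ((norm (x - y))\<^sup>2)) (\<lambda>x. indicator \<Omega> x * L ((norm (x - y))\<^sup>2))"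
  proof (rule weak_poisson_radial[OF \<Omega>, where \<gamma>="s / 2" and \<beta>="s / 2 + 1" and A="1 + s / 2 * (s / 2 + 1)"
        and ?h1.0="\<lambda>t. - (s / 2) * t powr (- (s / 2) - 1)" and ?h2.0="\<lambda>t. s / 2 * (s / 2 + 1) * t powr (- (s / 2) - 2)"])
    fix t :: real assume t: "t > 0"
    show "((\<lambda>t. t powr - (s / 2)) has_real_derivative - (s / 2) * t powr (- (s / 2) - 1)) (at t)"
      "((\<lambda>t. - (s / 2) * t powr (- (s / 2) - 1)) has_real_derivative s / 2 * (s / 2 + 1) * t powr (- (s / 2) - 2)) (at t)"
      using t by (auto intro!: derivative_eq_intros simp: field_simps)
    have A: "1 \<le> 1 + s / 2 * (s / 2 + 1)" "s / 2 \<le> 1 + s / 2 * (s / 2 + 1)" "s / 2 * (s / 2 + 1) \<le> 1 + s / 2 * (s / 2 + 1)"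
      using s by (auto simp: algebra_simps)
    show "\<bar>t powr - (s / 2)\<bar> \<le> (1 + s / 2 * (s / 2 + 1)) * t powr - (s / 2)"
      using mult_right_mono[OF A(1), of "t powr - (s / 2)"] by simp
    show "\<bar>- (s / 2) * t powr (- (s / 2) - 1)\<bar> \<le> (1 + s / 2 * (s / 2 + 1)) * t powr - (s / 2 + 1)"
      using mult_right_mono[OF A(2), of "t powr (- (s / 2) - 1)"] s by (simp add: abs_mult)
    show "\<bar>s / 2 * (s / 2 + 1) * t powr (- (s / 2) - 2)\<bar> \<le> (1 + s / 2 * (s / 2 + 1)) * t powr (- (s / 2 + 1) - 1)"
    proof -
      have "- (s / 2 + 1) - 1 = - (s / 2) - 2" by simp
      then show ?thesis
        using mult_right_mono[OF A(3), of "t powr (- (s / 2) - 2)"] s by (simp only:) (simp add: abs_mult)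
    qed
    define P where "P = t powr (- (s / 2) - 2)"
    have P: "t powr (- (s / 2) - 1) = t * P" unfolding P_def by (rule powr_mult_self[symmetric]) (use t in auto)
    have "- (s / 2 + 1) = - (s / 2) - 1" by simp
    then have "L t = s * (?n - 2 - s) * (t * P)" unfolding L_def by (simp only: P)
    then show "L t = - (4 * t * (s / 2 * (s / 2 + 1) * t powr (- (s / 2) - 2)) + 2 * ?n * (- (s / 2) * t powr (- (s / 2) - 1)))"
      unfolding P P_def[symmetric] by (simp add: field_simps)
  qed (use s in \<open>auto intro!: continuous_intros\<close>)
  moreover have "((norm (x - y))\<^sup>2) powr b = norm (x - y) powr (2 * b)" for x b
    using powr_powr[of "norm (x - y)" 2 b] by simp
  moreover have "2 * (- (s / 2)) = - s" "2 * (- (s / 2 + 1)) = - (s + 2)" by simp_all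
  ultimately show ?thesis unfolding L_def by (simp only:)
qed

text \<open>The exponent \<open>3/2\<close> makes the right-hand side singular like \<open>|x - y|^(-1/2)\<close>, the same order as in
  \<open>nonlinearity_estimate\<close>.\<close>

lemma weak_poisson_barrier:
  fixes y :: "'a::euclidean_space"
  assumes \<Omega>: "open \<Omega>" "bounded \<Omega>" and s: "0 < s" "s + 2 < real DIM('a)" and d: "d > 0"
  obtains g M where
    "weak_poisson \<Omega> (\<lambda>x. (norm (x - y) powr (3/2) + d powr (3/2)) powr (- (2 * s / 3))) g"
    "\<And>x. \<bar>g x\<bar> \<le> M * norm (x - y) powr (- (1/2))" "g \<in> borel_measurable borel" "\<And>x. x \<notin> \<Omega> \<Longrightarrow> g x = 0"
    "\<And>x. x \<in> \<Omega> \<Longrightarrow> s * (real DIM('a) - 2 - s) * norm (x - y) powr (- (1/2)) *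
      (norm (x - y) powr (3/2) + d powr (3/2)) powr (- (2 * s / 3 + 1)) \<le> g x"
proof -
  let ?n = "real DIM('a)"
  define D where "D = d powr (3/2)"
  have D: "D > 0" using d by (simp add: D_def)
  define \<sigma> where "\<sigma> = 2 * s / 3"
  have \<sigma>: "\<sigma> > 0" "s = 3 / 2 * \<sigma>" using s by (auto simp: \<sigma>_def)
  \<comment> \<open>In the variable \<open>t = |x - y|^2\<close> the exponent \<open>3/2\<close>
    becomes \<open>3/4\<close>, and the barrier is \<open>X powr (- \<sigma>)\<close>. The constant
    \<open>D > 0\<close> bounds \<open>X\<close> from below, so the only singularity left is the one
    of the derivatives of \<open>t powr (3/4)\<close>.\<close>
  define X where "X t = t powr (3/4) + D" for t
  have X: "X t > 0" "D \<le> X t" "t powr (3/4) \<le> X t" for t using D by (auto simp: X_def add_nonneg_pos)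
  define h1 where "h1 t = - (s / 2) * t powr (- (1/4)) * X t powr (- \<sigma> - 1)" for t
  define h2 where "h2 t = s / 8 * t powr (- (5/4)) * X t powr (- \<sigma> - 1) + s / 2 * (\<sigma> + 1) * (3/4) * t powr (- (1/2)) * X t powr (- \<sigma> - 2)" for t
  define L where "L t = s * t powr (- (1/4)) * X t powr (- \<sigma> - 2) * ((?n - 2 - s) * t powr (3/4) + (?n - 1/2) * D)" for t
  define A where "A = (1 + s + s * (\<sigma> + 1)) * (D powr (- \<sigma>) + D powr (- \<sigma> - 1))"
  have Xp: "X t powr (- \<sigma>) \<le> D powr (- \<sigma>)" "X t powr (- \<sigma> - 1) \<le> D powr (- \<sigma> - 1)" for t
    using X D \<sigma> by (auto intro!: powr_mono2')
  have dX: "(X has_real_derivative 3/4 * t powr (- (1/4))) (at t)" if "t > 0" for t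
    unfolding X_def using that by (auto intro!: derivative_eq_intros)
  have Le: "L t = - (4 * t * h2 t + 2 * ?n * h1 t)" if t: "t > 0" for t
  proof -
    define P where "P = t powr (- (1/4))"
    define Q where "Q = X t powr (- \<sigma> - 2)"
    define Y where "Y = t powr (3/4)"
    have "X t powr (- \<sigma> - 1) = Q * X t"
      using powr_mult_self[OF X(1)[of t], of "- \<sigma> - 1" "- \<sigma> - 2"] by (simp add: Q_def mult.commute)
    then have e1: "X t powr (- \<sigma> - 1) = Q * (Y + D)" by (simp add: X_def Y_def)
    have e2: "t * t powr (- (5/4)) = P" using t powr_add[of t 1 "- (5/4)"] by (simp add: P_def)
    have e3: "t * t powr (- (1/2)) = P * Y" using t powr_add[of t 1 "- (1/2)"] by (simp add: P_def Y_def flip: powr_add)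
    have "4 * t * h2 t = s / 2 * (t * t powr (- (5/4))) * X t powr (- \<sigma> - 1) + 3 / 2 * s * (\<sigma> + 1) * (t * t powr (- (1/2))) * Q"
      unfolding h2_def Q_def by (simp add: algebra_simps)
    also have "\<dots> = s / 2 * P * (Q * (Y + D)) + 3 / 2 * s * (\<sigma> + 1) * (P * Y) * Q" unfolding e1 e2 e3 ..
    finally have "4 * t * h2 t + 2 * ?n * h1 t = s * P * Q * ((1/2 - ?n) * (Y + D) + 3/2 * (\<sigma> + 1) * Y)"
      unfolding h1_def e1 P_def[symmetric] by (simp add: algebra_simps)
    also have "3/2 * (\<sigma> + 1) = s + 3/2" using \<sigma>(2) by simp
    finally show ?thesis unfolding L_def P_def[symmetric] Q_def[symmetric] Y_def[symmetric] by (simp add: field_simps)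
  qed
  have A0: "A \<ge> 0" using s \<sigma> by (simp add: A_def)
  have wp: "weak_poisson \<Omega> (\<lambda>x. (\<lambda>t. X t powr (- \<sigma>)) ((norm (x - y))\<^sup>2)) (\<lambda>x. indicator \<Omega> x * L ((norm (x - y))\<^sup>2))"
    and bL: "\<And>t. t > 0 \<Longrightarrow> \<bar>L t\<bar> \<le> (4 + 2 * ?n) * A * t powr (- (1/4))"
  proof -
    have d1: "((\<lambda>t. X t powr (- \<sigma>)) has_real_derivative h1 t) (at t)" if t: "t > 0" for t
      using t X[of t] \<sigma> by (auto intro!: derivative_eq_intros dX simp: h1_def)
    have d2: "(h1 has_real_derivative h2 t) (at t)" if t: "t > 0" for t
    proof -
      have e: "t powr (- (1/4)) * t powr (- (1/4)) = t powr (- (1/2))" by (simp flip: powr_add)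
      have "(h1 has_real_derivative (- (s / 2) * t powr (- (1/4)) * ((- \<sigma> - 1) * X t powr (- \<sigma> - 1 - 1) * (3/4 * t powr (- (1/4)))) +
         (- (s / 2)) * (- (1/4) * t powr (- (1/4) - 1)) * X t powr (- \<sigma> - 1))) (at t)"
        unfolding h1_def using t X[of t] by (auto intro!: derivative_eq_intros dX simp: field_simps)
      then show ?thesis by (rule DERIV_cong) (simp add: h2_def e[symmetric] field_simps)
    qed
    have ch2: "continuous_on {0<..} h2"
      unfolding h2_def X_def using D by (auto intro!: continuous_intros simp: add_nonneg_eq_0_iff)
    have b0: "\<bar>X t powr (- \<sigma>)\<bar> \<le> A * t powr (- 0)" if t: "t > 0" for t
    proof -
      have "1 * D powr (- \<sigma>) \<le> A" unfolding A_def using s \<sigma> by (intro mult_mono) auto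
      then show ?thesis using Xp(1)[of t] t by simp
    qed
    have b1: "\<bar>h1 t\<bar> \<le> A * t powr (- (1/4))" if t: "t > 0" for t
    proof -
      have "s / 2 * X t powr (- \<sigma> - 1) \<le> A" unfolding A_def using s \<sigma> Xp(2)[of t] by (intro mult_mono) (auto simp: add_increasing)
      from mult_right_mono[OF this, of "t powr (- (1/4))"] show ?thesis using s by (simp add: h1_def abs_mult mult_ac)
    qed
    have b2: "\<bar>h2 t\<bar> \<le> A * t powr (- (1/4) - 1)" if t: "t > 0" for t
    proof -
      have "t powr (3/4) * X t powr (- \<sigma> - 2) \<le> X t * X t powr (- \<sigma> - 2)" using X by (intro mult_right_mono) auto
      also have "\<dots> = X t powr (- \<sigma> - 1)" by (rule powr_mult_self) (use X in auto)
      finally have "t powr (- (5/4)) * (t powr (3/4) * X t powr (- \<sigma> - 2)) \<le> t powr (- (5/4)) * X t powr (- \<sigma> - 1)"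
        by (intro mult_left_mono) auto
      moreover have "t powr (- (1/2)) = t powr (- (5/4)) * t powr (3/4)" by (simp flip: powr_add)
      ultimately have "t powr (- (1/2)) * X t powr (- \<sigma> - 2) \<le> t powr (- (5/4)) * X t powr (- \<sigma> - 1)" by (simp add: mult.assoc)
      then have "s / 2 * (\<sigma> + 1) * (3/4) * (t powr (- (1/2)) * X t powr (- \<sigma> - 2)) \<le> s / 2 * (\<sigma> + 1) * (3/4) * (t powr (- (5/4)) * X t powr (- \<sigma> - 1))"
        using s \<sigma> by (intro mult_left_mono) auto
      then have "\<bar>h2 t\<bar> \<le> (s / 8 + s / 2 * (\<sigma> + 1) * (3/4)) * X t powr (- \<sigma> - 1) * t powr (- (5/4))"
        using s(1) \<sigma>(1) by (simp add: h2_def algebra_simps)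
      also have "\<dots> \<le> A * t powr (- (5/4))"
      proof -
        have "0 \<le> \<sigma> * s" using s(1) \<sigma>(1) by simp
        then have "s / 8 + s / 2 * (\<sigma> + 1) * (3/4) \<le> 1 + s + s * (\<sigma> + 1)" using s(1) by (simp add: field_simps)
        then show ?thesis unfolding A_def using s(1) \<sigma>(1) Xp(2)[of t] by (intro mult_right_mono mult_mono) (auto intro: add_increasing)
      qed
      finally show ?thesis by simp
    qed
    show "weak_poisson \<Omega> (\<lambda>x. (\<lambda>t. X t powr (- \<sigma>)) ((norm (x - y))\<^sup>2)) (\<lambda>x. indicator \<Omega> x * L ((norm (x - y))\<^sup>2))"
      by (rule weak_poisson_radial[OF \<Omega> d1 d2 ch2, where \<gamma>=0 and \<beta>="1/4" and A=A]) (use s b0 b1 b2 Le in auto)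
    show "\<bar>L t\<bar> \<le> (4 + 2 * ?n) * A * t powr (- (1/4))" if t: "t > 0" for t
    proof -
      have "t * \<bar>h2 t\<bar> \<le> t * (A * t powr (- (1/4) - 1))" using b2[OF t] t by (intro mult_left_mono) auto
      also have "\<dots> = A * t powr (- (1/4))"
        using powr_mult_self[OF t, of "- (1/4)" "- (1/4) - 1"] by (simp add: mult.left_commute)
      finally have "\<bar>4 * t * h2 t\<bar> \<le> 4 * (A * t powr (- (1/4)))" using t by (simp add: abs_mult)
      moreover have "\<bar>2 * ?n * h1 t\<bar> \<le> 2 * ?n * (A * t powr (- (1/4)))"
        unfolding abs_mult using b1[OF t] by (intro mult_mono) auto
      ultimately show ?thesis unfolding Le[OF t] by (simp add: algebra_simps)
    qed
  qed
  have sq: "((norm (x - y))\<^sup>2) powr b = norm (x - y) powr (2 * b)" for x b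
    using powr_powr[of "norm (x - y)" 2 b] by simp
  have XX: "X ((norm (x - y))\<^sup>2) = norm (x - y) powr (3/2) + d powr (3/2)" for x
    by (simp add: X_def D_def sq)
  show thesis
  proof (rule that[of "\<lambda>x. indicator \<Omega> x * L ((norm (x - y))\<^sup>2)" "(4 + 2 * ?n) * A"])
    show "weak_poisson \<Omega> (\<lambda>x. (norm (x - y) powr (3/2) + d powr (3/2)) powr (- (2 * s / 3))) (\<lambda>x. indicator \<Omega> x * L ((norm (x - y))\<^sup>2))"
      using wp by (simp add: XX \<sigma>_def)
    then show "(\<lambda>x. indicator \<Omega> x * L ((norm (x - y))\<^sup>2)) \<in> borel_measurable borel" by (auto simp: weak_poisson_def)
    fix x
    show "\<bar>indicator \<Omega> x * L ((norm (x - y))\<^sup>2)\<bar> \<le> (4 + 2 * ?n) * A * norm (x - y) powr (- (1/2))"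
    proof (cases "x = y")
      case True
      then show ?thesis by (simp add: L_def)
    next
      case False
      then show ?thesis using bL[of "(norm (x - y))\<^sup>2"] A0 by (auto simp: sq indicator_def)
    qed
    show "indicator \<Omega> x * L ((norm (x - y))\<^sup>2) = 0" if "x \<notin> \<Omega>" using that by simp
    show "s * (?n - 2 - s) * norm (x - y) powr (- (1/2)) * (norm (x - y) powr (3/2) + d powr (3/2)) powr (- (2 * s / 3 + 1))
      \<le> indicator \<Omega> x * L ((norm (x - y))\<^sup>2)" if "x \<in> \<Omega>"
    proof -
      let ?t = "(norm (x - y))\<^sup>2"
      \<comment> \<open>The bracket in \<open>L\<close> has the larger coefficient
        \<open>n - 1/2\<close> at \<open>D\<close>, so it dominates \<open>(n - 2 - s)\<close> times
        \<open>X\<close>, and one power of \<open>X\<close> cancels.\<close>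
      have "(?n - 2 - s) * X ?t \<le> (?n - 2 - s) * ?t powr (3/4) + (?n - 1/2) * D"
        using D s mult_right_mono[of "?n - 2 - s" "?n - 1/2" D] by (simp add: X_def algebra_simps)
      then have "s * ?t powr (- (1/4)) * X ?t powr (- \<sigma> - 2) * ((?n - 2 - s) * X ?t) \<le> L ?t"
        unfolding L_def using s by (intro mult_left_mono) auto
      moreover have "X ?t powr (- \<sigma> - 2) * X ?t = X ?t powr (- (\<sigma> + 1))"
        using powr_mult_self[OF X(1)[of ?t], of "- (\<sigma> + 1)" "- \<sigma> - 2"] by (simp add: mult.commute)
      moreover have "s * ?t powr (- (1/4)) * X ?t powr (- \<sigma> - 2) * ((?n - 2 - s) * X ?t) =
        s * (?n - 2 - s) * ?t powr (- (1/4)) * (X ?t powr (- \<sigma> - 2) * X ?t)" by (simp only: ac_simps)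
      ultimately have "s * (?n - 2 - s) * ?t powr (- (1/4)) * X ?t powr (- (\<sigma> + 1)) \<le> L ?t" by simp
      moreover have "?t powr (- (1/4)) = norm (x - y) powr (- (1/2))" unfolding sq by simp
      ultimately show ?thesis using that by (simp add: XX \<sigma>_def)
    qed
  qed
qed

lemma continuous_on_gradient:
  assumes "Ck_on (Suc 0) k UNIV" shows "continuous_on UNIV (gradient k)"
proof (rule continuous_on_eq)
  note D = Ck_on_SucD[OF assms]
  show "continuous_on UNIV (\<lambda>x. \<Sum>b\<in>Basis. frechet_derivative k (at x) b *\<^sub>R b)"
    using Ck_on_imp_continuous_on[OF D(2)] by (auto intro!: continuous_intros)
  show "(\<Sum>b\<in>Basis. frechet_derivative k (at x) b *\<^sub>R b) = gradient k x" for x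
    by (metis D(1) UNIV_I differentiable_def has_derivative_gradient(2))
qed

lemma isCont_indicator_mult:
  fixes u :: "'a::euclidean_space \<Rightarrow> real"
  assumes "open \<Omega>" "a \<in> \<Omega>" "isCont u a"
  shows "isCont (\<lambda>x. indicator \<Omega> x * u x) a"
proof -
  have "eventually (\<lambda>x. x \<in> \<Omega>) (nhds a)" using assms(1,2) by (rule eventually_nhds_in_open)
  then have "eventually (\<lambda>x. indicator \<Omega> x * u x = u x) (nhds a)" by eventually_elim simp
  then have "isCont (\<lambda>x. indicator \<Omega> x * u x) a \<longleftrightarrow> isCont u a" by (rule isCont_cong)
  then show ?thesis using assms(3) by simp
qed

lemma gradient_bounded:
  assumes "Ck_on (Suc 0) k UNIV"
  obtains L where "L > 0" "\<And>z. norm z \<le> r \<Longrightarrow> norm (gradient k z) \<le> L"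
proof -
  have "compact (gradient k ` cball 0 r)"
    by (intro compact_continuous_image continuous_on_subset[OF continuous_on_gradient[OF assms]]) auto
  then obtain L where "L > 0" "\<forall>w\<in>gradient k ` cball 0 r. norm w \<le> L"
    using compact_imp_bounded bounded_pos by blast
  with that show thesis by (metis image_eqI mem_cball_0)
qed

section \<open>Comparison and removable singularities for weak solutions\<close>

context newton_profile
begin

text \<open>For \<open>F >= 0\<close> the potential term of \<open>weak_representation\<close> is
  nonnegative, because the smoothed kernel stays below the singular one. What remains is the mean
  inequality that \<open>min_principle\<close> asks for.\<close>

lemma weak_min_principle:
  assumes \<Omega>: "open \<Omega>" "bounded \<Omega>" and u: "continuous_on (closure \<Omega>) u" and w: "weak_poisson \<Omega> u F"
    and F: "\<And>x. 0 \<le> F x" "\<And>x. \<bar>F x\<bar> \<le> M * norm (x - y) powr (- (1/2))" "\<And>x. x \<notin> \<Omega> \<Longrightarrow> F x = 0"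
    and bd: "\<And>x. x \<in> frontier \<Omega> \<Longrightarrow> 0 \<le> u x" and x: "x \<in> (\<Omega>::'a set)"
  shows "0 \<le> u x"
proof (rule min_principle[OF \<Omega> u _ bd x])
  fix a R assume a: "a \<in> \<Omega>" and R: "R > 0" "cball a R \<subseteq> \<Omega>"
  let ?p = "\<lambda>x. norm (x - a) powr (2 - real DIM('a))"
  have "isCont u a" using continuous_on_subset[OF u closure_subset] a \<Omega>(1) continuous_on_eq_continuous_at by blast
  then have c: "isCont (\<lambda>x. indicator \<Omega> x * u x) a"
    by (rule isCont_indicator_mult[OF \<Omega>(1) a])
  have mF: "F \<in> borel_measurable borel" using w by (auto simp: weak_poisson_def)
  have "{x. F x \<noteq> 0} \<subseteq> \<Omega>" using F(3) by blast
  then have bF: "bounded {x. F x \<noteq> 0}" using \<Omega>(2) bounded_subset by blast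
  have "\<kappa> * (indicator \<Omega> a * u a) = integral\<^sup>L lborel (\<lambda>x. indicator \<Omega> x * u x * \<eta> R (x - a)) +
    integral\<^sup>L lborel (\<lambda>x. F x * (?p x - N R (x - a)))"
    by (rule weak_representation[OF _ c mF _ _ R])
      (use w dim in \<open>auto simp: weak_poisson_def intro: integrable_singular_potential[OF _ mF F(2) bF]\<close>)
  moreover have "0 \<le> integral\<^sup>L lborel (\<lambda>x. F x * (?p x - N R (x - a)))"
  proof (rule integral_nonneg_AE)
    show "AE x in lborel. 0 \<le> F x * (?p x - N R (x - a))"
      using AE_lborel_singleton[of a]
    proof eventually_elim
      case (elim x)
      then show ?case using N_bound(2)[OF R(1), of "x - a"] F(1)[of x] by simp
    qed
  qed
  ultimately show "integral\<^sup>L lborel (\<lambda>x. indicator \<Omega> x * u x * \<eta> R (x - a)) \<le> \<kappa> * u a" using a by simp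
qed

text \<open>For \<open>a\<close> near \<open>y\<close> but different from it,
  \<open>weak_representation\<close> expresses \<open>u a\<close> by three potentials. Their sum is
  also defined and differentiable at \<open>a = y\<close>, and so yields the value \<open>l\<close>
  and the gradient \<open>g\<close>. \<open>M0\<close> ensures integrability on the whole domain,
  whereas the gradient bound sees \<open>M\<close> and \<open>S\<close> on the ball alone: the term
  with \<open>u\<close> scales like \<open>S / R\<close>, the two with \<open>f\<close> like
  \<open>M * sqrt R\<close>. The constant is obtained before the domain, the functions and the
  radius.\<close>

lemma removable_singularity:
  obtains C where "C > 0"
    "\<And>(\<Omega>::'a set) u f y R M0 M. open \<Omega> \<Longrightarrow> bounded \<Omega> \<Longrightarrow> R > 0 \<Longrightarrow> ball y (2 * R) \<subseteq> \<Omega> \<Longrightarrow> weak_poisson \<Omega> u f \<Longrightarrow>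
      continuous_on (\<Omega> - {y}) u \<Longrightarrow> (\<And>x. \<bar>f x\<bar> \<le> M0 * norm (x - y) powr (- (1/2))) \<Longrightarrow> (\<And>x. x \<notin> \<Omega> \<Longrightarrow> f x = 0) \<Longrightarrow>
      (\<And>x. x \<in> ball y (2 * R) \<Longrightarrow> \<bar>f x\<bar> \<le> M * norm (x - y) powr (- (1/2))) \<Longrightarrow> M \<ge> 0 \<Longrightarrow>
      \<exists>l g. ((u(y := l)) has_derivative (\<lambda>h. g \<bullet> h)) (at y) \<and>
        (\<forall>S. (\<forall>x\<in>ball y (2 * R) - {y}. \<bar>u x\<bar> \<le> S) \<longrightarrow> norm g \<le> C * (S / R + M * sqrt R))"
proof -
  let ?n = "real DIM('a)"
  have n3: "DIM('a) \<ge> 3" using dim by simp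
  have CkN: "Ck_on (Suc 0) (N 1) UNIV" and Ck\<eta>: "Ck_on (Suc 0) (\<eta> 1) UNIV"
    using Ck_N[of "Suc 0" 1 0] Ck_\<eta>[of "Suc 0" 1 0] by (simp_all del: Ck_on.simps)
  obtain LN where LN: "LN > 0" "\<And>z. norm z \<le> 4 \<Longrightarrow> norm (gradient (N 1) z) \<le> LN" using gradient_bounded[OF CkN, of 4] by blast
  obtain LE where LE: "LE > 0" "\<And>z. norm z \<le> 4 \<Longrightarrow> norm (gradient (\<eta> 1) z) \<le> LE" using gradient_bounded[OF Ck\<eta>, of 4] by blast
  have hdN: "(N 1 has_derivative (\<lambda>h. gradient (N 1) z \<bullet> h)) (at z)" for z
    by (rule has_derivative_gradient) (use Ck_on_SucD(1)[OF CkN] in \<open>auto simp: differentiable_def\<close>)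
  have hd\<eta>: "(\<eta> 1 has_derivative (\<lambda>h. gradient (\<eta> 1) z \<bullet> h)) (at z)" for z
    by (rule has_derivative_gradient) (use Ck_on_SucD(1)[OF Ck\<eta>] in \<open>auto simp: differentiable_def\<close>)
  define C1 where "C1 = LE * unit_ball_vol ?n * 2 ^ DIM('a)"
  define C2 where "C2 = (?n - 2) * 3 powr (?n - 1) * riesz_const ?n (?n - 1/2) * sqrt 2"
  define C3 where "C3 = LN * riesz_const ?n (1/2) * 2 powr (?n - 1/2)"
  have C0: "C1 \<ge> 0" "C2 \<ge> 0" "C3 \<ge> 0"
    using LN(1) LE(1) dim riesz_const_pos[of ?n "?n - 1/2"] riesz_const_pos[of ?n "1/2"]
    by (auto simp: C1_def C2_def C3_def)
  define C where "C = (C1 + C2 + C3 + 1) / \<kappa>"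
  show thesis
  proof (rule that[of C])
    show "C > 0" using C0 \<kappa>_pos by (simp add: C_def)
    fix \<Omega> :: "'a set" and u f y R M0 M
    assume \<Omega>: "open \<Omega>" "bounded \<Omega>" and R: "R > 0" and sub: "ball y (2 * R) \<subseteq> \<Omega>" and w: "weak_poisson \<Omega> u f"
      and cu: "continuous_on (\<Omega> - {y}) u" and bf: "\<And>x. \<bar>f x\<bar> \<le> M0 * norm (x - y) powr (- (1/2))"
      and f0: "\<And>x. x \<notin> \<Omega> \<Longrightarrow> f x = 0" and bfM: "\<And>x. x \<in> ball y (2 * R) \<Longrightarrow> \<bar>f x\<bar> \<le> M * norm (x - y) powr (- (1/2))"
      and M: "M \<ge> 0"
    let ?B = "ball y (2 * R)"
    let ?p = "\<lambda>a x. norm (x - a) powr (2 - ?n)"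
    have iu: "integrable lborel (\<lambda>x. indicator \<Omega> x * u x)" and "integrable lborel f" using w by (auto simp: weak_poisson_def)
    then have mf: "f \<in> borel_measurable borel" by auto
    \<comment> \<open>For \<open>a\<close> within \<open>R\<close> of \<open>y\<close> the weight
      \<open>\<eta> R\<close> and the kernel difference centred at \<open>a\<close> are supported in
      the ball of radius \<open>2 * R\<close> about \<open>y\<close>. Truncating there makes the
      densities independent of \<open>a\<close>.\<close>
    define u1 where "u1 x = indicator ?B x * (indicator \<Omega> x * u x)" for x
    define f1 where "f1 x = indicator ?B x * f x" for x
    have iu1: "integrable lborel u1"
      unfolding u1_def using integrable_mult_indicator[OF _ iu, of ?B] by simp
    have u10: "u1 x = 0" if "x \<notin> ?B" for x using that by (simp add: u1_def)
    have f10: "f1 x = 0" if "x \<notin> ?B" for x using that by (simp add: f1_def)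
    have mf1: "f1 \<in> borel_measurable borel" unfolding f1_def by (intro borel_measurable_times borel_measurable_indicator mf) auto
    have bf1: "\<bar>f1 x\<bar> \<le> M * norm (x - y) powr (- (1/2))" for x
      using bfM[of x] M by (auto simp: f1_def indicator_def)
    have if1: "integrable lborel f1"
      by (rule integrable_riesz_bound[OF mf1, where \<beta>="1/2" and y=y and r="2 * R" and A=M]) (use dim R bf1 f10 in auto)
    have "{x. f x \<noteq> 0} \<subseteq> \<Omega>" using f0 by blast
    then have bdf: "bounded {x. f x \<noteq> 0}" using \<Omega>(2) bounded_subset by blast
    have "{x. f1 x \<noteq> 0} \<subseteq> ?B" using f10 by blast
    then have bdf1: "bounded {x. f1 x \<noteq> 0}" using bounded_ball bounded_subset by blast
    have ip1: "integrable lborel (\<lambda>x. f1 x * ?p a x)" for a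
      by (rule integrable_singular_potential[OF n3 mf1 bf1 bdf1])
    have iN1: "integrable lborel (\<lambda>x. f1 x * N R (x - a))" for a
    proof (rule Bochner_Integration.integrable_bound[OF ip1[of a]])
      show "(\<lambda>x. f1 x * N R (x - a)) \<in> borel_measurable lborel"
        unfolding measurable_lborel2
        by (intro borel_measurable_times mf1 borel_measurable_continuous_onI[OF Ck_on_imp_continuous_on[OF Ck_N]])
      show "AE x in lborel. norm (f1 x * N R (x - a)) \<le> norm (f1 x * ?p a x)"
        using AE_lborel_singleton[of a]
      proof eventually_elim
        case (elim x)
        then show ?case using N_bound[OF R, of "x - a"] by (simp add: abs_mult mult_left_mono)
      qed
    qed
    \<comment> \<open>Scaling back to radius one, where the gradient bounds \<open>LN\<close> and
      \<open>LE\<close> were fixed once for all \<open>R\<close>.\<close>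
    have sc: "N R (x - a) = R powr (2 - ?n) * N 1 ((x - a) /\<^sub>R R)" "\<eta> R (x - a) = R powr (- ?n) * \<eta> 1 ((x - a) /\<^sub>R R)" for x a
      using R by (simp_all add: N_def \<eta>_def power_mult_distrib divide_inverse power_inverse mult.commute)
    let ?\<Phi>1 = "\<lambda>a. integral\<^sup>L lborel (\<lambda>x. u1 x * \<eta> 1 ((x - a) /\<^sub>R R))"
    let ?\<Phi>2 = "\<lambda>a. integral\<^sup>L lborel (\<lambda>x. f1 x * ?p a x)"
    let ?\<Phi>3 = "\<lambda>a. integral\<^sup>L lborel (\<lambda>x. f1 x * N 1 ((x - a) /\<^sub>R R))"
    obtain D1 where D1: "(?\<Phi>1 has_derivative (\<lambda>h. D1 \<bullet> h)) (at y)" "norm D1 \<le> LE / R * integral\<^sup>L lborel (\<lambda>x. \<bar>u1 x\<bar>)"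
      by (rule differentiable_smooth_potential[OF hd\<eta> continuous_on_gradient[OF Ck\<eta>] LE(2) R iu1 u10])
    obtain D2 where D2: "(?\<Phi>2 has_derivative (\<lambda>h. D2 \<bullet> h)) (at y)"
      "norm D2 \<le> M * (?n - 2) * 3 powr (?n - 1) * riesz_const ?n (?n - 1/2) * (2 * R) powr (1/2)"
      by (rule differentiable_singular_potential[OF n3 mf1 bf1 R f10])
    obtain D3 where D3: "(?\<Phi>3 has_derivative (\<lambda>h. D3 \<bullet> h)) (at y)" "norm D3 \<le> LN / R * integral\<^sup>L lborel (\<lambda>x. \<bar>f1 x\<bar>)"
      by (rule differentiable_smooth_potential[OF hdN continuous_on_gradient[OF CkN] LN(2) R if1 f10])
    define \<Psi> where "\<Psi> a = (R powr (- ?n) * ?\<Phi>1 a + (?\<Phi>2 a - R powr (2 - ?n) * ?\<Phi>3 a)) / \<kappa>" for a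
    define g where "g = (1 / \<kappa>) *\<^sub>R (R powr (- ?n) *\<^sub>R D1 + (D2 - R powr (2 - ?n) *\<^sub>R D3))"
    have d\<Psi>: "(\<Psi> has_derivative (\<lambda>h. g \<bullet> h)) (at y)"
      unfolding \<Psi>_def divide_inverse
      by (rule has_derivative_eq_rhs[OF has_derivative_mult_left[OF has_derivative_add[OF has_derivative_mult_right[OF D1(1)]
            has_derivative_diff[OF D2(1) has_derivative_mult_right[OF D3(1)]]]]])
        (auto simp: g_def inner_add_left inner_diff_left divide_inverse mult.commute)
    have rep: "u a = \<Psi> a" if a: "a \<in> ball y R" "a \<noteq> y" for a
    proof -
      have cb: "cball a R \<subseteq> ?B"
      proof
        fix x assume "x \<in> cball a R"
        then show "x \<in> ?B" using a(1) dist_triangle[of y x a] by simp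
      qed
      then have cb\<Omega>: "cball a R \<subseteq> \<Omega>" using sub by blast
      have a\<Omega>: "a \<in> \<Omega>" using cb\<Omega> R by (meson centre_in_cball less_imp_le subsetD)
      have "isCont u a" using cu a(2) a\<Omega> \<Omega>(1) continuous_on_eq_continuous_at[of "\<Omega> - {y}" u] open_delete[of \<Omega> y] by blast
      then have c: "isCont (\<lambda>x. indicator \<Omega> x * u x) a"
        by (rule isCont_indicator_mult[OF \<Omega>(1) a\<Omega>])
      have "\<kappa> * (indicator \<Omega> a * u a) = integral\<^sup>L lborel (\<lambda>x. indicator \<Omega> x * u x * \<eta> R (x - a)) +
        integral\<^sup>L lborel (\<lambda>x. f x * (?p a x - N R (x - a)))"
        by (rule weak_representation[OF iu c mf _ _ R cb\<Omega>])
          (use w in \<open>auto simp: weak_poisson_def intro: integrable_singular_potential[OF n3 mf bf bdf]\<close>)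
      moreover have "(\<lambda>x. indicator \<Omega> x * u x * \<eta> R (x - a)) = (\<lambda>x. R powr (- ?n) * (u1 x * \<eta> 1 ((x - a) /\<^sub>R R)))"
      proof
        fix x
        show "indicator \<Omega> x * u x * \<eta> R (x - a) = R powr (- ?n) * (u1 x * \<eta> 1 ((x - a) /\<^sub>R R))"
        proof (cases "x \<in> ?B")
          case False
          then have "x \<notin> cball a R" using cb by blast
          then have "R \<le> norm (x - a)" by (simp add: dist_norm norm_minus_commute)
          then show ?thesis using \<eta>_far[OF R, of "x - a"] False by (simp add: u1_def)
        qed (simp add: u1_def sc mult_ac)
      qed
      moreover have "(\<lambda>x. f x * (?p a x - N R (x - a))) = (\<lambda>x. f1 x * ?p a x - f1 x * N R (x - a))"
      proof
        fix x
        show "f x * (?p a x - N R (x - a)) = f1 x * ?p a x - f1 x * N R (x - a)"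
        proof (cases "x \<in> ?B")
          case False
          then have "x \<notin> cball a R" using cb by blast
          then have "R \<le> norm (x - a)" by (simp add: dist_norm norm_minus_commute)
          then show ?thesis using N_far[OF R, of "x - a"] False by (simp add: f1_def)
        qed (simp add: f1_def right_diff_distrib)
      qed
      moreover have "integral\<^sup>L lborel (\<lambda>x. f1 x * N R (x - a)) = R powr (2 - ?n) * ?\<Phi>3 a"
      proof -
        have "(\<lambda>x. f1 x * N R (x - a)) = (\<lambda>x. R powr (2 - ?n) * (f1 x * N 1 ((x - a) /\<^sub>R R)))" by (simp add: sc mult_ac)
        then show ?thesis by simp
      qed
      ultimately have "\<kappa> * u a = R powr (- ?n) * ?\<Phi>1 a + (?\<Phi>2 a - R powr (2 - ?n) * ?\<Phi>3 a)"
        using ip1[of a] iN1[of a] a\<Omega> by simp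
      then show ?thesis using \<kappa>_pos by (simp add: \<Psi>_def field_simps)
    qed
    have "((u(y := \<Psi> y)) has_derivative (\<lambda>h. g \<bullet> h)) (at y)"
      by (rule has_derivative_transform_within_open[OF d\<Psi>, of "ball y R"]) (use R rep in auto)
    moreover have "norm g \<le> C * (S / R + M * sqrt R)" if S: "\<forall>x\<in>?B - {y}. \<bar>u x\<bar> \<le> S" for S
    proof -
      obtain b :: 'a where b: "norm b = 1" using vector_choose_size[of 1] by auto
      have "y + R *\<^sub>R b \<in> ?B - {y}" using R b by (auto simp: dist_norm)
      then have S0: "S \<ge> 0" using S by (meson abs_ge_zero order_trans)
      have "integral\<^sup>L lborel (\<lambda>x. \<bar>u1 x\<bar>) \<le> integral\<^sup>L lborel (\<lambda>x. S * indicator ?B x)"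
      proof (rule integral_mono_AE)
        show "integrable lborel (\<lambda>x. S * indicator ?B x)"
          using emeasure_bounded_finite[of ?B] by (intro integrable_mult_right integrable_real_indicator) auto
        show "AE x in lborel. \<bar>u1 x\<bar> \<le> S * indicator ?B x"
          using AE_lborel_singleton[of y]
        proof eventually_elim
          case (elim x)
          then show ?case using S S0 by (auto simp: u1_def indicator_def)
        qed
      qed (use iu1 in simp)
      also have "\<dots> = S * (unit_ball_vol ?n * (2 * R) ^ DIM('a))" using R by (simp add: content_ball)
      finally have "LE / R * integral\<^sup>L lborel (\<lambda>x. \<bar>u1 x\<bar>) \<le> LE / R * (S * (unit_ball_vol ?n * (2 * R) ^ DIM('a)))"
        using LE(1) R by (intro mult_left_mono) auto
      with D1(2) have n1: "norm D1 \<le> LE / R * (S * (unit_ball_vol ?n * (2 * R) ^ DIM('a)))" by linarith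
      have "R powr (- ?n) * (2 * R) ^ DIM('a) = 2 ^ DIM('a)"
        using R by (simp add: powr_minus powr_realpow power_mult_distrib)
      then have "R powr (- ?n) * (LE / R * (S * (unit_ball_vol ?n * (2 * R) ^ DIM('a)))) = C1 * (S / R)"
        by (simp add: C1_def mult_ac)
      moreover have "R powr (- ?n) * norm D1 \<le> R powr (- ?n) * (LE / R * (S * (unit_ball_vol ?n * (2 * R) ^ DIM('a))))"
        by (rule mult_left_mono[OF n1]) simp
      ultimately have m1: "R powr (- ?n) * norm D1 \<le> C1 * (S / R)" by linarith
      have "(2 * R) powr (1/2) = sqrt 2 * sqrt R" using R by (simp add: powr_half_sqrt real_sqrt_mult)
      then have m2: "norm D2 \<le> C2 * (M * sqrt R)" using D2(2) by (simp add: C2_def mult_ac)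
      have "integral\<^sup>L lborel (\<lambda>x. \<bar>f1 x\<bar>) \<le> integral\<^sup>L lborel (\<lambda>x. M * (indicator ?B x * norm (x - y) powr (- (1/2))))"
      proof (rule integral_mono)
        show "integrable lborel (\<lambda>x. M * (indicator ?B x * norm (x - y) powr (- (1/2))))"
          by (intro integrable_mult_right integrable_riesz) (use dim R in auto)
        show "\<bar>f1 x\<bar> \<le> M * (indicator ?B x * norm (x - y) powr (- (1/2)))" for x
          using bf1[of x] f10[of x] by (cases "x \<in> ?B") auto
      qed (use if1 in simp)
      also have "\<dots> \<le> M * (riesz_const ?n (1/2) * (2 * R) powr (?n - 1/2))"
        unfolding integral_mult_right_zero using M dim R by (intro mult_left_mono integral_riesz) auto
      finally have "LN / R * integral\<^sup>L lborel (\<lambda>x. \<bar>f1 x\<bar>) \<le> LN / R * (M * (riesz_const ?n (1/2) * (2 * R) powr (?n - 1/2)))"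
        using LN(1) R by (intro mult_left_mono) auto
      with D3(2) have n3: "norm D3 \<le> LN / R * (M * (riesz_const ?n (1/2) * (2 * R) powr (?n - 1/2)))" by linarith
      have "R powr (2 - ?n) / R * (2 * R) powr (?n - 1/2) = 2 powr (?n - 1/2) * sqrt R"
      proof -
        have "R powr (2 - ?n) / R = R powr (1 - ?n)" using R powr_diff[of R "2 - ?n" 1] by simp
        moreover have "R powr (1 - ?n) * R powr (?n - 1/2) = sqrt R" using R by (simp add: powr_half_sqrt flip: powr_add)
        ultimately show ?thesis using R by (simp add: powr_mult)
      qed
      then have e: "LN * M * riesz_const ?n (1/2) * (R powr (2 - ?n) / R * (2 * R) powr (?n - 1/2)) = C3 * (M * sqrt R)"
        by (simp only: C3_def ac_simps)
      have "R powr (2 - ?n) * norm D3 \<le> R powr (2 - ?n) * (LN / R * (M * (riesz_const ?n (1/2) * (2 * R) powr (?n - 1/2))))"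
        by (rule mult_left_mono[OF n3]) simp
      also have "\<dots> = LN * M * riesz_const ?n (1/2) * (R powr (2 - ?n) / R * (2 * R) powr (?n - 1/2))" by simp
      finally have m3: "R powr (2 - ?n) * norm D3 \<le> C3 * (M * sqrt R)" unfolding e .
      have "norm (R powr (- ?n) *\<^sub>R D1 + (D2 - R powr (2 - ?n) *\<^sub>R D3)) \<le> R powr (- ?n) * norm D1 + (norm D2 + R powr (2 - ?n) * norm D3)"
        by (rule order_trans[OF norm_triangle_ineq add_mono[OF _ order_trans[OF norm_triangle_ineq4]]]) auto
      also have "\<dots> \<le> C1 * (S / R) + (C2 * (M * sqrt R) + C3 * (M * sqrt R))" using m1 m2 m3 by linarith
      also have "\<dots> \<le> (C1 + C2 + C3 + 1) * (S / R) + (C1 + C2 + C3 + 1) * (M * sqrt R)"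
      proof -
        have "0 \<le> S / R" "0 \<le> M * sqrt R" using S0 R M by auto
        then have "C1 * (S / R) \<le> (C1 + C2 + C3 + 1) * (S / R)" "(C2 + C3) * (M * sqrt R) \<le> (C1 + C2 + C3 + 1) * (M * sqrt R)"
          using C0 by (intro mult_right_mono; linarith)+
        then show ?thesis by (simp add: distrib_right)
      qed
      finally have "norm (R powr (- ?n) *\<^sub>R D1 + (D2 - R powr (2 - ?n) *\<^sub>R D3)) \<le> (C1 + C2 + C3 + 1) * (S / R + M * sqrt R)"
        by (simp add: distrib_left)
      from divide_right_mono[OF this, of \<kappa>] show ?thesis using \<kappa>_pos by (simp add: g_def C_def)
    qed
    ultimately show "\<exists>l g. ((u(y := l)) has_derivative (\<lambda>h. g \<bullet> h)) (at y) \<and>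
        (\<forall>S. (\<forall>x\<in>?B - {y}. \<bar>u x\<bar> \<le> S) \<longrightarrow> norm g \<le> C * (S / R + M * sqrt R))" by blast
  qed
qed

end

subsection \<open>Comparison with the half space\<close>

text \<open>With \<open>v\<close> the vector from the foot point to \<open>a\<close>, the two
  squared distances have the mean \<open>|v|^2 + d^2\<close> and differ by
  \<open>4 * d * (v \<bullet> \<nu>)\<close>. The quadratic bound makes this difference at most
  \<open>4 * K * d * |v|^2\<close>, and \<open>|v|^2\<close> is at most twice the squared distance
  to the reflected point. For a flat boundary both distances agree on the frontier.\<close>

lemma reflection_bounds:
  fixes y \<nu> a :: "'a::real_inner"
  assumes \<nu>: "norm \<nu> = 1" and d: "d > 0" and K: "0 \<le> K" "K * d \<le> 1 / 16"
    and q: "(a - (y + d *\<^sub>R \<nu>)) \<bullet> \<nu> \<le> K * (norm (a - (y + d *\<^sub>R \<nu>)))\<^sup>2"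
  shows "d \<le> norm (a - (y + (2 * d) *\<^sub>R \<nu>))"
    and "(norm (a - y))\<^sup>2 \<le> (1 + 8 * (K * d)) * (norm (a - (y + (2 * d) *\<^sub>R \<nu>)))\<^sup>2"
    and "- ((a - (y + d *\<^sub>R \<nu>)) \<bullet> \<nu>) \<le> K * (norm (a - (y + d *\<^sub>R \<nu>)))\<^sup>2 \<Longrightarrow>
      (1 - 8 * (K * d)) * (norm (a - (y + (2 * d) *\<^sub>R \<nu>)))\<^sup>2 \<le> (norm (a - y))\<^sup>2"
proof -
  define v where "v = a - (y + d *\<^sub>R \<nu>)"
  define Z where "Z = (norm v)\<^sup>2"
  define b where "b = v \<bullet> \<nu>"
  define W where "W = (norm (a - (y + (2 * d) *\<^sub>R \<nu>)))\<^sup>2"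
  have \<nu>\<nu>: "\<nu> \<bullet> \<nu> = 1" using \<nu> by (simp add: norm_eq_1)
  have ay: "a - y = v + d *\<^sub>R \<nu>" and aw: "a - (y + (2 * d) *\<^sub>R \<nu>) = v - d *\<^sub>R \<nu>"
    by (simp_all add: v_def algebra_simps flip: scaleR_2)
  have e1: "(norm (a - y))\<^sup>2 = Z + 2 * (d * b) + d\<^sup>2"
    unfolding ay Z_def b_def power2_norm_eq_inner
    by (simp add: inner_add \<nu>\<nu> inner_commute power2_eq_square algebra_simps)
  have e2: "W = Z - 2 * (d * b) + d\<^sup>2"
    unfolding W_def aw Z_def b_def power2_norm_eq_inner
    by (simp add: inner_diff \<nu>\<nu> inner_commute power2_eq_square algebra_simps)
  have Z0: "Z \<ge> 0" by (simp add: Z_def)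
  have up: "d * b \<le> K * d * Z"
    using mult_left_mono[of b "K * Z" d] q d by (simp add: b_def Z_def v_def mult_ac)
  have small: "K * d * Z \<le> Z / 16" using mult_right_mono[OF K(2) Z0] by simp
  have W: "Z / 2 + d\<^sup>2 \<le> W" using up small Z0 unfolding e2 by linarith
  have "d\<^sup>2 \<le> (norm (a - (y + (2 * d) *\<^sub>R \<nu>)))\<^sup>2" using W Z0 by (simp add: W_def)
  then show "d \<le> norm (a - (y + (2 * d) *\<^sub>R \<nu>))" by (rule power2_le_imp_le) simp
  have "Z \<le> 2 * W" using W zero_le_power2[of d] by linarith
  then have KW: "4 * (K * d * Z) \<le> 8 * (K * d) * W" using mult_left_mono[of Z "2 * W" "4 * (K * d)"] K(1) d by simp
  have "(norm (a - y))\<^sup>2 = W + 4 * (d * b)" unfolding e1 e2 by simp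
  with up KW have "(norm (a - y))\<^sup>2 \<le> W + 8 * (K * d) * W" by linarith
  then show "(norm (a - y))\<^sup>2 \<le> (1 + 8 * (K * d)) * (norm (a - (y + (2 * d) *\<^sub>R \<nu>)))\<^sup>2"
    by (simp add: W_def algebra_simps)
  assume "- ((a - (y + d *\<^sub>R \<nu>)) \<bullet> \<nu>) \<le> K * (norm (a - (y + d *\<^sub>R \<nu>)))\<^sup>2"
  then have "- (d * b) \<le> K * d * Z"
    using mult_left_mono[of "- b" "K * Z" d] d by (simp add: b_def Z_def v_def mult_ac)
  with \<open>(norm (a - y))\<^sup>2 = W + 4 * (d * b)\<close> KW have "W - 8 * (K * d) * W \<le> (norm (a - y))\<^sup>2" by linarith
  then show "(1 - 8 * (K * d)) * (norm (a - (y + (2 * d) *\<^sub>R \<nu>)))\<^sup>2 \<le> (norm (a - y))\<^sup>2"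
    by (simp add: W_def algebra_simps)
qed

text \<open>\<tau> stands for \<open>K * d\<close>, so by \<open>reflection_bounds\<close> the ratio
  of squared distances deviates from one by at most \<open>8 * \<tau>\<close>. The exponent
  \<open>n / 2\<close> of squared distances covers all powers of distances up to order
  \<open>n\<close>, which are then compared within the tolerance \<open>e\<close>.\<close>

definition almost_one :: "real \<Rightarrow> real \<Rightarrow> real \<Rightarrow> bool" where
  "almost_one n e \<tau> \<longleftrightarrow> 0 \<le> \<tau> \<and> \<tau> \<le> 1 / 16 \<and> 1 - e \<le> (1 + 8 * \<tau>) powr (- (n / 2)) \<and> (1 - 8 * \<tau>) powr (- (n / 2)) \<le> 1 + e"

lemma ex_almost_one:
  assumes "e > 0"
  obtains \<tau>0 where "\<tau>0 > 0" "\<And>\<tau>. 0 \<le> \<tau> \<Longrightarrow> \<tau> \<le> \<tau>0 \<Longrightarrow> almost_one n e \<tau>"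
proof -
  have c: "isCont (\<lambda>\<tau>. (1 + 8 * \<tau>) powr (- (n / 2))) 0" "isCont (\<lambda>\<tau>. (1 - 8 * \<tau>) powr (- (n / 2))) 0"
    by (auto intro!: continuous_intros)
  obtain d1 where d1: "d1 > 0" "\<And>\<tau>. dist \<tau> 0 < d1 \<Longrightarrow> dist ((1 + 8 * \<tau>) powr (- (n / 2))) ((1 + 8 * 0) powr (- (n / 2))) < e"
    using c(1) assms unfolding continuous_at_eps_delta by blast
  obtain d2 where d2: "d2 > 0" "\<And>\<tau>. dist \<tau> 0 < d2 \<Longrightarrow> dist ((1 - 8 * \<tau>) powr (- (n / 2))) ((1 - 8 * 0) powr (- (n / 2))) < e"
    using c(2) assms unfolding continuous_at_eps_delta by blast
  show thesis
  proof (rule that[of "min (1 / 16) (min (d1 / 2) (d2 / 2))"])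
    fix \<tau> :: real assume t: "0 \<le> \<tau>" "\<tau> \<le> min (1 / 16) (min (d1 / 2) (d2 / 2))"
    have "dist \<tau> 0 < d1" "dist \<tau> 0 < d2" using t d1(1) d2(1) by auto
    from d1(2)[OF this(1)] d2(2)[OF this(2)] show "almost_one n e \<tau>"
      using t by (simp add: almost_one_def dist_real_def abs_less_iff)
  qed (use d1 d2 in auto)
qed

lemma powr_compare:
  assumes t: "almost_one n e \<tau>" and r: "0 < (r::real)" "0 < q" and s: "0 \<le> s" "s \<le> n"
  shows "r\<^sup>2 \<le> (1 + 8 * \<tau>) * q\<^sup>2 \<Longrightarrow> (1 - e) * q powr (- s) \<le> r powr (- s)"
    and "(1 - 8 * \<tau>) * q\<^sup>2 \<le> r\<^sup>2 \<Longrightarrow> r powr (- s) \<le> (1 + e) * q powr (- s)"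
proof -
  have sq: "x powr (- s) = (x\<^sup>2) powr (- (s / 2))" if "x > 0" for x :: real
    using powr_powr[of x 2 "- (s / 2)"] that by simp
  have t1: "0 \<le> \<tau>" "\<tau> \<le> 1 / 16" "1 - e \<le> (1 + 8 * \<tau>) powr (- (n / 2))" "(1 - 8 * \<tau>) powr (- (n / 2)) \<le> 1 + e"
    using t by (auto simp: almost_one_def)
  show "(1 - e) * q powr (- s) \<le> r powr (- s)" if "r\<^sup>2 \<le> (1 + 8 * \<tau>) * q\<^sup>2"
  proof -
    have "(1 + 8 * \<tau>) powr (- (n / 2)) \<le> (1 + 8 * \<tau>) powr (- (s / 2))" using t1 s by (intro powr_mono) auto
    then have "(1 - e) * q powr (- s) \<le> (1 + 8 * \<tau>) powr (- (s / 2)) * (q\<^sup>2) powr (- (s / 2))"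
      unfolding sq[OF r(2)] using t1(3) by (intro mult_right_mono) auto
    also have "\<dots> = ((1 + 8 * \<tau>) * q\<^sup>2) powr (- (s / 2))" using t1 by (simp add: powr_mult)
    also have "\<dots> \<le> (r\<^sup>2) powr (- (s / 2))" using that r s by (intro powr_mono2') auto
    finally show ?thesis using sq[OF r(1)] by simp
  qed
  show "r powr (- s) \<le> (1 + e) * q powr (- s)" if "(1 - 8 * \<tau>) * q\<^sup>2 \<le> r\<^sup>2"
  proof -
    have "(r\<^sup>2) powr (- (s / 2)) \<le> ((1 - 8 * \<tau>) * q\<^sup>2) powr (- (s / 2))" using that r s t1 by (intro powr_mono2') auto
    also have "\<dots> = (1 - 8 * \<tau>) powr (- (s / 2)) * (q\<^sup>2) powr (- (s / 2))" using t1 by (simp add: powr_mult)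
    also have "(1 - 8 * \<tau>) powr (- (s / 2)) \<le> (1 - 8 * \<tau>) powr (- (n / 2))" using t1 s by (intro powr_mono') auto
    then have "(1 - 8 * \<tau>) powr (- (s / 2)) * (q\<^sup>2) powr (- (s / 2)) \<le> (1 + e) * (q\<^sup>2) powr (- (s / 2))"
      using t1(4) by (intro mult_right_mono) auto
    finally show ?thesis using sq r by simp
  qed
qed

lemma fundamental_solution_harmonic:
  fixes w :: "'a::euclidean_space"
  assumes "open S" "w \<notin> S"
  shows "Ck_on 2 (\<lambda>x. norm (x - w) powr (2 - real DIM('a))) S"
    and "x \<in> S \<Longrightarrow> laplacian (\<lambda>x. norm (x - w) powr (2 - real DIM('a))) x = 0"
proof -
  let ?n = "real DIM('a)" and ?b = "1 - real DIM('a) / 2"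
  have e: "(\<lambda>x. norm (x - w) powr (2 - ?n)) = (\<lambda>x. ((norm (x - w))\<^sup>2) powr ?b)"
    using powr_powr[of "norm (_ - w)" 2 ?b] by (simp add: fun_eq_iff)
  have pos: "(norm (x - w))\<^sup>2 \<in> {0<..}" if "x \<in> S" for x using that assms by auto
  show "Ck_on 2 (\<lambda>x. norm (x - w) powr (2 - ?n)) S"
    unfolding e by (rule Ck_on_compose[OF assms(1) Ck_on_dist_square[OF assms(1)] open_greaterThan Ck_on_powr pos])
  show "laplacian (\<lambda>x. norm (x - w) powr (2 - ?n)) x = 0" if x: "x \<in> S"
  proof -
    let ?q = "(norm (x - w))\<^sup>2"
    have "laplacian (\<lambda>x. (\<lambda>t. t powr ?b) ((norm (x - w))\<^sup>2)) x = 4 * ?q * (?b * ((?b - 1) * ?q powr (?b - 1 - 1))) + 2 * ?n * (\<lambda>t. ?b * t powr (?b - 1)) ?q"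
      by (rule laplacian_radial[OF open_greaterThan pos[OF x], where h="\<lambda>t. t powr ?b" and h'="\<lambda>t. ?b * t powr (?b - 1)"])
        (use pos[OF x] in \<open>auto intro!: derivative_eq_intros\<close>)
    moreover have "?q * ?q powr (?b - 1 - 1) = ?q powr (?b - 1)"
      by (rule powr_mult_self) (use pos[OF x] in auto)
    moreover have "4 * ?q * (?b * ((?b - 1) * ?q powr (?b - 1 - 1))) = 4 * ?b * (?b - 1) * (?q * ?q powr (?b - 1 - 1))" by (simp only: ac_simps)
    ultimately have "laplacian (\<lambda>x. (\<lambda>t. t powr ?b) ((norm (x - w))\<^sup>2)) x = ?b * ?q powr (?b - 1) * (4 * (?b - 1) + 2 * ?n)"
      by (simp add: algebra_simps)
    also have "4 * (?b - 1) + 2 * ?n = 0" by simp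
    finally show ?thesis unfolding e by simp
  qed
qed

lemma harmonic_le:
  fixes u v :: "'a::euclidean_space \<Rightarrow> real"
  assumes S: "open S" "bounded S"
    and u: "Ck_on 2 u S" "continuous_on (closure S) u" "\<And>x. x \<in> S \<Longrightarrow> laplacian u x = 0"
    and v: "Ck_on 2 v S" "continuous_on (closure S) v" "\<And>x. x \<in> S \<Longrightarrow> laplacian v x = 0"
    and bd: "\<And>x. x \<in> frontier S \<Longrightarrow> a * u x \<le> b * v x" and x: "x \<in> S"
  shows "a * u x \<le> b * v x"
proof -
  have "0 \<le> b * v x + (- a) * u x"
  proof (rule min_principle_classical[OF S _ _ _ _ x])
    show "Ck_on 2 (\<lambda>x. b * v x + (- a) * u x) S" by (intro Ck_on_add Ck_on_cmult S u v)
    show "continuous_on (closure S) (\<lambda>x. b * v x + (- a) * u x)" by (intro continuous_intros u v)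
    show "laplacian (\<lambda>x. b * v x + (- a) * u x) z \<le> 0" if "z \<in> S" for z
      using laplacian_lincomb[OF S(1) that v(1) u(1), of b "- a"] u(3)[OF that] v(3)[OF that] by simp
  qed (use bd in simp)
  then show ?thesis by simp
qed

text \<open>Here \<open>r = |a - y|\<close>, \<open>q = |a - y'|\<close>, and \<open>h\<close> stands for the regular part of the Green function, which is
  close to its half-space value \<open>c q^(2 - n)\<close>.  The choice of \<open>\<theta>\<close> turns \<open>r^((2 - n) \<theta>)\<close> into \<open>r^(-1/2)\<close>,
  which is mild enough for the potential to be differentiable at \<open>y\<close>.\<close>

lemma nonlinearity_estimate:
  fixes n c r q h e \<epsilon> :: real
  defines "\<theta> \<equiv> 1 / (2 * (n - 2))"
  assumes n: "n \<ge> 3" and c: "c > 0" and r: "r > 0" "q > 0" "r \<le> 2 * q" and e: "0 \<le> e" "e \<le> 1 / 4"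
    and \<epsilon>: "0 \<le> \<epsilon>" "\<epsilon> \<le> \<theta> / 2"
    and h: "(1 - e) * (c * q powr (2 - n)) \<le> h" "h \<le> (1 + e) * (c * q powr (2 - n))" "h \<le> c * r powr (2 - n)"
  shows "\<bar>(c * r powr (2 - n)) powr (1 + \<epsilon>) - (c * r powr (2 - n) - h) powr (1 + \<epsilon>) - (c * q powr (2 - n)) powr (1 + \<epsilon>)\<bar>
    \<le> (4 * (1 + 4 / \<theta>) * \<epsilon> + 6 * e) * c powr (1 + \<epsilon>) * (q powr (- ((n - 2) * (1 + \<epsilon>) - 1/2)) * r powr (- (1/2)))"
proof -
  let ?p = "1 + \<epsilon>"
  define E where "E = c * q powr (2 - n)"
  define \<Gamma> where "\<Gamma> = c * r powr (2 - n)"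
  define P where "P = c powr ?p * (q powr (- ((n - 2) * ?p - 1/2)) * r powr (- (1/2)))"
  have \<theta>: "0 < \<theta>" "\<theta> \<le> 1" "(n - 2) * \<theta> = 1/2" using n by (auto simp: \<theta>_def field_simps)
  have E: "E > 0" using c r by (simp add: E_def)
  have \<Gamma>: "\<Gamma> > 0" using c r by (simp add: \<Gamma>_def)
  have P: "P \<ge> 0" by (simp add: P_def)
  have p2: "?p \<le> 2" using \<epsilon> \<theta> by simp
  have hE: "(1 - e) * E \<le> h" "h \<le> (1 + e) * E" "h \<le> \<Gamma>" using h by (auto simp: E_def \<Gamma>_def)
  have "(1 - e) * E > 0" using E e by simp
  then have hpos: "h > 0" using hE(1) by linarith
  have Ep: "E powr a = c powr a * q powr (- (n - 2) * a)" "\<Gamma> powr a = c powr a * r powr (- (n - 2) * a)" for a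
    using c r by (simp_all add: E_def \<Gamma>_def powr_mult powr_powr)
  \<comment> \<open>Since \<open>(n - 2) * \<theta> = 1/2\<close>, the product
    \<open>E powr (?p - \<theta>) * \<Gamma> powr \<theta>\<close> is \<open>P\<close> itself. The
    factor \<open>4\<close> pays for replacing \<open>h\<close> by \<open>E\<close>: a base at most
    \<open>2\<close>, with an exponent at most \<open>2\<close>.\<close>
  have 1: "h powr (?p - \<theta>) * \<Gamma> powr \<theta> \<le> 4 * P"
  proof -
    have "h powr (?p - \<theta>) \<le> ((1 + e) * E) powr (?p - \<theta>)" using hpos hE(2) \<epsilon> \<theta> by (intro powr_mono2) auto
    also have "\<dots> = (1 + e) powr (?p - \<theta>) * E powr (?p - \<theta>)" using e E by (simp add: powr_mult)
    also have "\<dots> \<le> 4 * E powr (?p - \<theta>)"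
    proof (rule mult_right_mono)
      have "(1 + e) powr (?p - \<theta>) \<le> 2 powr (?p - \<theta>)" using e \<epsilon> \<theta> by (intro powr_mono2) auto
      also have "\<dots> \<le> 2 powr 2" using p2 \<theta> by (intro powr_mono) auto
      finally show "(1 + e) powr (?p - \<theta>) \<le> 4" by simp
    qed simp
    finally have "h powr (?p - \<theta>) * \<Gamma> powr \<theta> \<le> 4 * E powr (?p - \<theta>) * \<Gamma> powr \<theta>" by (rule mult_right_mono) simp
    also have "E powr (?p - \<theta>) * \<Gamma> powr \<theta> = P"
    proof -
      have x: "- (n - 2) * (?p - \<theta>) = - ((n - 2) * ?p - 1/2)" "- (n - 2) * \<theta> = - (1/2)"
        using \<theta>(3) by (simp_all add: algebra_simps)
      have cc: "c powr (?p - \<theta>) * c powr \<theta> = c powr ?p" by (simp flip: powr_add)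
      have "E powr (?p - \<theta>) * \<Gamma> powr \<theta> = (c powr (?p - \<theta>) * c powr \<theta>) *
          (q powr (- (n - 2) * (?p - \<theta>)) * r powr (- (n - 2) * \<theta>))"
        unfolding Ep by (simp only: ac_simps)
      then show ?thesis unfolding x cc P_def .
    qed
    then have "4 * E powr (?p - \<theta>) * \<Gamma> powr \<theta> = 4 * P" by simp
    finally show ?thesis .
  qed
  \<comment> \<open>The power of \<open>q\<close> alone is traded for the mixed one in
    \<open>P\<close> by \<open>r <= 2 * q\<close>, which moves the exponent \<open>- 1/2\<close>
    from \<open>q\<close> to \<open>r\<close>.\<close>
  have 2: "E powr ?p \<le> 2 * P"
  proof -
    have "q powr (- (1/2)) \<le> (r / 2) powr (- (1/2))" using r by (intro powr_mono2') auto
    also have "\<dots> = 2 powr (1/2) * r powr (- (1/2))" using r by (simp add: powr_divide powr_minus_divide)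
    also have "\<dots> \<le> 2 * r powr (- (1/2))"
    proof (rule mult_right_mono)
      have "(2::real) powr (1/2) \<le> 2 powr 1" by (intro powr_mono) auto
      then show "(2::real) powr (1/2) \<le> 2" by simp
    qed simp
    finally have q2: "q powr (- (1/2)) \<le> 2 * r powr (- (1/2))" .
    have "E powr ?p = c powr ?p * (q powr (- ((n - 2) * ?p - 1/2)) * q powr (- (1/2)))"
      unfolding Ep by (simp flip: powr_add) (simp add: algebra_simps)
    also have "\<dots> \<le> c powr ?p * (q powr (- ((n - 2) * ?p - 1/2)) * (2 * r powr (- (1/2))))"
      using q2 by (intro mult_left_mono) auto
    finally show ?thesis by (simp add: P_def)
  qed
  have 3: "\<bar>h powr ?p - E powr ?p\<bar> \<le> 3 * e * E powr ?p"
  proof -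
    have "h powr ?p \<le> ((1 + e) * E) powr ?p" using hpos hE(2) \<epsilon> by (intro powr_mono2) auto
    also have "\<dots> = (1 + e) powr ?p * E powr ?p" using e E by (simp add: powr_mult)
    also have "\<dots> \<le> (1 + 3 * e) * E powr ?p"
    proof (rule mult_right_mono)
      have "(1 + e) powr ?p \<le> (1 + e) powr 2" using p2 e by (intro powr_mono) auto
      also have "\<dots> = 1 + 2 * e + e * e" using e by (simp add: power2_eq_square algebra_simps)
      also have "\<dots> \<le> 1 + 3 * e" using e mult_left_mono[of e 1 e] by simp
      finally show "(1 + e) powr ?p \<le> 1 + 3 * e" .
    qed simp
    finally have up: "h powr ?p \<le> (1 + 3 * e) * E powr ?p" .
    have "(1 - 3 * e) * E powr ?p \<le> (1 - e) powr ?p * E powr ?p"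
    proof (rule mult_right_mono)
      have "1 - 3 * e \<le> 1 - 2 * e + e * e" using e by simp
      also have "\<dots> = (1 - e) powr 2" using e by (simp add: power2_eq_square algebra_simps)
      also have "\<dots> \<le> (1 - e) powr ?p" using p2 e by (intro powr_mono') auto
      finally show "1 - 3 * e \<le> (1 - e) powr ?p" .
    qed simp
    also have "\<dots> = ((1 - e) * E) powr ?p" using e E by (simp add: powr_mult)
    also have "\<dots> \<le> h powr ?p" using e E hE(1) \<epsilon> by (intro powr_mono2) auto
    finally have lo: "(1 - 3 * e) * E powr ?p \<le> h powr ?p" .
    show ?thesis using up lo by (simp add: abs_le_iff algebra_simps)
  qed
  \<comment> \<open>The source is \<open>X\<close> plus \<open>h powr ?p - E powr ?p\<close>. The
    first term is the defect of superadditivity for the summands \<open>\<Gamma> - h\<close> and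
    \<open>h\<close>, of order \<epsilon>; the second is of order \<open>e\<close>.\<close>
  define X where "X = \<Gamma> powr ?p - (\<Gamma> - h) powr ?p - h powr ?p"
  have X0: "0 \<le> X" using powr_superadditive[of "\<Gamma> - h" h ?p] hE(3) hpos \<epsilon> by (simp add: X_def)
  have X1: "X \<le> \<epsilon> * (1 + 4 / \<theta>) * (4 * P)"
  proof -
    have "X \<le> \<epsilon> * (1 + 4 / \<theta>) * (h powr (?p - \<theta>) * \<Gamma> powr \<theta>)"
      using powr_superadditive_defect[of "\<Gamma> - h" h \<epsilon> \<theta>] hE(3) hpos \<epsilon> \<theta> by (simp add: X_def)
    also have "\<dots> \<le> \<epsilon> * (1 + 4 / \<theta>) * (4 * P)" using 1 \<epsilon> \<theta> by (intro mult_left_mono) auto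
    finally show ?thesis .
  qed
  have "3 * e * E powr ?p \<le> 3 * e * (2 * P)" using 2 e by (intro mult_left_mono) auto
  then have "\<bar>\<Gamma> powr ?p - (\<Gamma> - h) powr ?p - E powr ?p\<bar> \<le> \<epsilon> * (1 + 4 / \<theta>) * (4 * P) + 3 * e * (2 * P)"
    using X0 X1 3 unfolding X_def by linarith
  also have "\<dots> = (4 * (1 + 4 / \<theta>) * \<epsilon> + 6 * e) * P" by (simp add: algebra_simps)
  finally show ?thesis unfolding P_def E_def \<Gamma>_def by (simp add: mult.assoc)
qed

text \<open>From \<open>r <= 2 * q\<close> and \<open>d <= q\<close> the base of the barrier is at
  most \<open>4 * q powr (3/2)\<close>. Thus the barrier dominates negative powers of the distance
  \<open>q\<close> to the reflected point, in the source as well as on the frontier;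
  \<open>m\<close> bounds the exponent so that the constant is uniform.\<close>

lemma barrier_compare:
  fixes r q d \<mu> :: real
  assumes "0 < r" "0 < d" "r \<le> 2 * q" "d \<le> q" "0 \<le> \<mu>" "\<mu> \<le> m"
  shows "q powr (- (3 / 2 * \<mu>)) \<le> 4 powr m * (r powr (3/2) + d powr (3/2)) powr (- \<mu>)"
proof -
  let ?X = "r powr (3/2) + d powr (3/2)"
  have q: "q > 0" using assms by linarith
  have X: "?X > 0" using assms by (simp add: add_pos_pos)
  have "r powr (3/2) \<le> (2 * q) powr (3/2)" using assms by (intro powr_mono2) auto
  also have "\<dots> = 2 powr (3/2) * q powr (3/2)" using q by (simp add: powr_mult)
  also have "\<dots> \<le> 3 * q powr (3/2)"
  proof (rule mult_right_mono)
    have "(2::real) powr (3/2) = 2 * sqrt 2" using powr_add[of "2::real" 1 "1/2"] by (simp add: powr_half_sqrt)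
    also have "\<dots> \<le> 2 * (3/2)" by (intro mult_left_mono real_le_lsqrt) (auto simp: power2_eq_square)
    finally show "(2::real) powr (3/2) \<le> 3" by simp
  qed simp
  finally have "?X \<le> 4 * q powr (3/2)" using powr_mono2[of "3/2" d q] assms by simp
  then have "(4 * q powr (3/2)) powr (- \<mu>) \<le> ?X powr (- \<mu>)" using X assms by (intro powr_mono2') auto
  then have "4 powr (- \<mu>) * q powr (- (3 / 2 * \<mu>)) \<le> ?X powr (- \<mu>)" using q by (simp add: powr_mult powr_powr)
  then have "4 powr \<mu> * (4 powr (- \<mu>) * q powr (- (3 / 2 * \<mu>))) \<le> 4 powr \<mu> * ?X powr (- \<mu>)" by (rule mult_left_mono) simp
  moreover have "(4::real) powr \<mu> * 4 powr (- \<mu>) = 1" by (simp flip: powr_add)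
  ultimately have "q powr (- (3 / 2 * \<mu>)) \<le> 4 powr \<mu> * ?X powr (- \<mu>)" by (simp add: mult.assoc[symmetric])
  also have "\<dots> \<le> 4 powr m * ?X powr (- \<mu>)" using assms by (intro mult_right_mono powr_mono) auto
  finally show ?thesis .
qed

lemma weak_poisson_cong_rhs:
  assumes "weak_poisson \<Omega> u f" "AE x in lborel. f x = g x" "g \<in> borel_measurable borel"
  shows "weak_poisson \<Omega> u g"
proof -
  have f: "integrable lborel f" using assms(1) by (simp add: weak_poisson_def)
  have g: "integrable lborel g"
    by (rule integrable_cong_AE_imp[OF f _ assms(2)]) (use assms(3) in simp)
  have "integral\<^sup>L lborel (\<lambda>x. f x * \<phi> x) = integral\<^sup>L lborel (\<lambda>x. g x * \<phi> x)" if "test_function \<Omega> \<phi>" for \<phi>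
  proof (rule integral_cong_AE)
    have m: "\<phi> \<in> borel_measurable borel"
      by (rule borel_measurable_continuous_onI[OF Ck_on_imp_continuous_on[OF test_functionD(1)[OF that]]])
    have mf: "f \<in> borel_measurable borel" using f by auto
    show "(\<lambda>x. f x * \<phi> x) \<in> borel_measurable lborel" "(\<lambda>x. g x * \<phi> x) \<in> borel_measurable lborel"
      unfolding measurable_lborel2 by (rule borel_measurable_times[OF mf m], rule borel_measurable_times[OF assms(3) m])
    show "AE x in lborel. f x * \<phi> x = g x * \<phi> x" using assms(2) by eventually_elim simp
  qed
  then show ?thesis using assms(1) g unfolding weak_poisson_def by simp
qed

text \<open>Nonnegativity of the Green function. The comparison takes place outside a small ball
  about the pole, on whose sphere the fundamental solution exceeds the maximum of
  \<open>h\<close>.\<close>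

lemma green_function_nonneg:
  fixes y :: "'a::euclidean_space"
  assumes n: "DIM('a) \<ge> 3" and \<Omega>: "open \<Omega>" "bounded \<Omega>" "y \<in> \<Omega>" and c: "c > 0"
    and h: "continuous_on (closure \<Omega>) h" "Ck_on 2 h \<Omega>" "\<And>x. x \<in> \<Omega> \<Longrightarrow> laplacian h x = 0"
    and bd: "\<And>x. x \<in> frontier \<Omega> \<Longrightarrow> h x = c * norm (x - y) powr (2 - real DIM('a))"
    and a: "a \<in> \<Omega>" "a \<noteq> y"
  shows "h a \<le> c * norm (a - y) powr (2 - real DIM('a))"
proof -
  let ?n = "real DIM('a)"
  have n3: "?n \<ge> 3" using n by simp
  have "bounded (h ` closure \<Omega>)" using h(1) \<Omega>(2) by (intro compact_imp_bounded compact_continuous_image) auto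
  then obtain B where B: "B > 0" "\<And>x. x \<in> closure \<Omega> \<Longrightarrow> h x \<le> B" unfolding bounded_pos by (force dest: abs_le_D1)
  obtain r where r: "r > 0" "cball y r \<subseteq> \<Omega>" using \<Omega> open_contains_cball by blast
  \<comment> \<open>\<open>c / B\<close> and \<open>1\<close> yield
    \<open>B <= c / \<rho> <= c * \<rho> powr (2 - n)\<close>; the entry \<open>r\<close> keeps the
    ball inside the domain, and the last entry keeps \<open>a\<close> outside the ball.\<close>
  define \<rho> where "\<rho> = Min {r, 1, c / B, norm (a - y) / 2}"
  have \<rho>: "\<rho> > 0" "\<rho> \<le> r" "\<rho> \<le> 1" "\<rho> \<le> c / B" "\<rho> < norm (a - y)"
    using r(1) B(1) c a(2) by (auto simp: \<rho>_def min_less_iff_disj)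
  have big: "B \<le> c * \<rho> powr (2 - ?n)"
  proof -
    have "B \<le> c / \<rho>" using \<rho>(1,4) B(1) by (simp add: field_simps)
    also have "\<dots> = c * \<rho> powr (- 1)" using \<rho>(1) by (simp add: powr_minus_divide)
    also have "\<dots> \<le> c * \<rho> powr (2 - ?n)" using \<rho> c n3 by (intro mult_left_mono powr_mono') auto
    finally show ?thesis .
  qed
  define S where "S = \<Omega> - cball y \<rho>"
  have S: "open S" "bounded S" "S \<subseteq> \<Omega>" using \<Omega> by (auto simp: S_def intro: bounded_subset)
  have clS: "closure S \<subseteq> closure \<Omega>" using S(3) by (rule closure_mono)
  have clS': "closure S \<subseteq> - ball y \<rho>" by (rule closure_minimal) (auto simp: S_def)
  have "1 * h a \<le> c * norm (a - y) powr (2 - ?n)"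
  proof (rule harmonic_le[OF S(1,2), where u=h and v="\<lambda>x. norm (x - y) powr (2 - ?n)" and a=1 and b=c])
    show "Ck_on 2 h S" by (rule Ck_on_subset[OF h(2) S(3)])
    show "continuous_on (closure S) h" by (rule continuous_on_subset[OF h(1) clS])
    show "laplacian h x = 0" if "x \<in> S" for x using h(3) S(3) that by blast
    show "Ck_on 2 (\<lambda>x. norm (x - y) powr (2 - ?n)) S" "x \<in> S \<Longrightarrow> laplacian (\<lambda>x. norm (x - y) powr (2 - ?n)) x = 0" for x
      using fundamental_solution_harmonic[OF S(1), of y] \<rho>(1) by (auto simp: S_def)
    show "continuous_on (closure S) (\<lambda>x. norm (x - y) powr (2 - ?n))"
      using clS' \<rho>(1) by (intro continuous_intros) auto
    show "a \<in> S" using a \<rho>(5) by (simp add: S_def dist_norm norm_minus_commute)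
    show "1 * h x \<le> c * norm (x - y) powr (2 - ?n)" if x: "x \<in> frontier S" for x
    proof -
      have xc: "x \<in> closure S" "x \<notin> S" using x S(1) by (auto simp: frontier_def interior_open)
      show ?thesis
      proof (cases "x \<in> \<Omega>")
        case True
        then have "norm (x - y) = \<rho>" using xc clS' by (auto simp: S_def dist_norm norm_minus_commute)
        then show ?thesis using B(2)[of x] xc(1) clS big by auto
      next
        case False
        then have "x \<in> frontier \<Omega>" using xc(1) clS \<Omega>(1) by (auto simp: frontier_def interior_open)
        then show ?thesis using bd by simp
      qed
    qed
  qed
  then show ?thesis by simp
qed

lemma continuous_on_barrier:
  fixes y :: "'a::euclidean_space"
  assumes "d > 0" "0 < b"
  shows "continuous_on S (\<lambda>x. (norm (x - y) powr b + d powr b) powr a)"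
proof (rule continuous_on_powr)
  show "continuous_on S (\<lambda>x. norm (x - y) powr b + d powr b)"
    by (intro continuous_on_add continuous_on_powr' continuous_intros) (use assms in auto)
  show "\<forall>x\<in>S. norm (x - y) powr b + d powr b \<noteq> 0"
    using assms by (metis add_nonneg_pos less_irrefl powr_ge_zero powr_gt_zero)
qed auto

section \<open>The gradient of the deviation from the half-space profile\<close>

text \<open>The geometry of the boundary enters only through \<open>w\<close>, the reflected pole,
  and three inequalities between distances. A barrier multiple dominates both the source of
  \<open>D\<close> and its boundary values, so the minimum principle bounds \<open>D\<close> by a
  multiple of \<open>d powr (- s)\<close>; the bound for removable singularities at scale
  \<open>d\<close> then costs one more power of \<open>d\<close>. The constant depends on the
  dimension alone, which is why it is obtained before everything else.\<close>

lemma (in newton_profile) core_estimate: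
  assumes n5: "DIM('a) \<ge> 5"
  obtains C where "C > 0"
    "\<And>\<Omega> (y::'a) w d c h gt \<tau> e \<epsilon> s a1. open \<Omega> \<Longrightarrow> bounded \<Omega> \<Longrightarrow> y \<in> \<Omega> \<Longrightarrow> d > 0 \<Longrightarrow> ball y d \<subseteq> \<Omega> \<Longrightarrow>
      (\<And>a. a \<in> closure \<Omega> \<Longrightarrow> d \<le> norm (a - w)) \<Longrightarrow>
      (\<And>a. a \<in> closure \<Omega> \<Longrightarrow> (norm (a - y))\<^sup>2 \<le> (1 + 8 * \<tau>) * (norm (a - w))\<^sup>2) \<Longrightarrow>
      (\<And>a. a \<in> frontier \<Omega> \<Longrightarrow> (1 - 8 * \<tau>) * (norm (a - w))\<^sup>2 \<le> (norm (a - y))\<^sup>2) \<Longrightarrow>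
      almost_one (real DIM('a)) e \<tau> \<Longrightarrow> 0 < e \<Longrightarrow> e \<le> 1 / 4 \<Longrightarrow> c > 0 \<Longrightarrow>
      continuous_on (closure \<Omega>) h \<Longrightarrow> Ck_on 2 h \<Omega> \<Longrightarrow> (\<And>x. x \<in> \<Omega> \<Longrightarrow> laplacian h x = 0) \<Longrightarrow>
      (\<And>x. x \<in> frontier \<Omega> \<Longrightarrow> h x = c * norm (x - y) powr (2 - real DIM('a))) \<Longrightarrow>
      0 \<le> \<epsilon> \<Longrightarrow> \<epsilon> \<le> 1 / (4 * (real DIM('a) - 2)) \<Longrightarrow>
      continuous_on (closure \<Omega> - {y}) gt \<Longrightarrow> (\<And>x. x \<in> frontier \<Omega> \<Longrightarrow> gt x = 0) \<Longrightarrow>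
      weak_poisson \<Omega> gt (\<lambda>x. if x \<in> \<Omega> - {y} then (c * norm (x - y) powr (2 - real DIM('a)) - h x) powr (1 + \<epsilon>) else 0) \<Longrightarrow>
      s = (real DIM('a) - 2) * (1 + \<epsilon>) - 2 \<Longrightarrow> a1 = c powr (1 + \<epsilon>) / (s * (real DIM('a) - 2 - s)) \<Longrightarrow>
      \<exists>l g. (((\<lambda>x. a1 * norm (x - y) powr (- s) - gt x - a1 * norm (x - w) powr (- s))(y := l)) has_derivative (\<lambda>v. g \<bullet> v)) (at y) \<and>
        norm g \<le> C * (4 * (1 + 8 * (real DIM('a) - 2)) * \<epsilon> + 6 * e) * c powr (1 + \<epsilon>) * d powr (- s - 1)"
proof -
  let ?n = "real DIM('a)"
  have n: "?n \<ge> 5" using n5 by simp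
  obtain C where C: "C > 0" and rs:
    "\<And>(\<Omega>::'a set) u f y R M0 M. open \<Omega> \<Longrightarrow> bounded \<Omega> \<Longrightarrow> R > 0 \<Longrightarrow> ball y (2 * R) \<subseteq> \<Omega> \<Longrightarrow> weak_poisson \<Omega> u f \<Longrightarrow>
      continuous_on (\<Omega> - {y}) u \<Longrightarrow> (\<And>x. \<bar>f x\<bar> \<le> M0 * norm (x - y) powr (- (1/2))) \<Longrightarrow> (\<And>x. x \<notin> \<Omega> \<Longrightarrow> f x = 0) \<Longrightarrow>
      (\<And>x. x \<in> ball y (2 * R) \<Longrightarrow> \<bar>f x\<bar> \<le> M * norm (x - y) powr (- (1/2))) \<Longrightarrow> M \<ge> 0 \<Longrightarrow>
      \<exists>l g. ((u(y := l)) has_derivative (\<lambda>h. g \<bullet> h)) (at y) \<and>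
        (\<forall>S. (\<forall>x\<in>ball y (2 * R) - {y}. \<bar>u x\<bar> \<le> S) \<longrightarrow> norm g \<le> C * (S / R + M * sqrt R))"
    by (rule removable_singularity) blast
  show thesis
  proof (rule that[of "5 * C * 4 powr ?n"])
    show "5 * C * 4 powr ?n > 0" using C by simp
    fix \<Omega> and y w :: 'a and d c h gt \<tau> e \<epsilon> s a1
    assume \<Omega>: "open \<Omega>" "bounded \<Omega>" and y: "y \<in> \<Omega>" and d: "d > 0" and ball: "ball y d \<subseteq> \<Omega>"
      and q1: "\<And>a. a \<in> closure \<Omega> \<Longrightarrow> d \<le> norm (a - w)"
      and q2: "\<And>a. a \<in> closure \<Omega> \<Longrightarrow> (norm (a - y))\<^sup>2 \<le> (1 + 8 * \<tau>) * (norm (a - w))\<^sup>2"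
      and q3: "\<And>a. a \<in> frontier \<Omega> \<Longrightarrow> (1 - 8 * \<tau>) * (norm (a - w))\<^sup>2 \<le> (norm (a - y))\<^sup>2"
      and \<tau>: "almost_one ?n e \<tau>" and e: "0 < e" "e \<le> 1 / 4" and c: "c > 0"
      and h: "continuous_on (closure \<Omega>) h" "Ck_on 2 h \<Omega>" "\<And>x. x \<in> \<Omega> \<Longrightarrow> laplacian h x = 0"
      and hbd: "\<And>x. x \<in> frontier \<Omega> \<Longrightarrow> h x = c * norm (x - y) powr (2 - ?n)"
      and \<epsilon>: "0 \<le> \<epsilon>" "\<epsilon> \<le> 1 / (4 * (?n - 2))"
      and gt: "continuous_on (closure \<Omega> - {y}) gt" "\<And>x. x \<in> frontier \<Omega> \<Longrightarrow> gt x = 0"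
        "weak_poisson \<Omega> gt (\<lambda>x. if x \<in> \<Omega> - {y} then (c * norm (x - y) powr (2 - ?n) - h x) powr (1 + \<epsilon>) else 0)"
      and s_def: "s = (?n - 2) * (1 + \<epsilon>) - 2" and a1_def: "a1 = c powr (1 + \<epsilon>) / (s * (?n - 2 - s))"
    let ?p = "1 + \<epsilon>"
    let ?\<omega> = "4 * (1 + 8 * (?n - 2)) * \<epsilon> + 6 * e"
    have n2e: "0 \<le> (?n - 2) * \<epsilon>" "(?n - 2) * \<epsilon> \<le> 1/4"
    proof -
      show "0 \<le> (?n - 2) * \<epsilon>" using \<epsilon>(1) n by (intro mult_nonneg_nonneg) auto
      have "(?n - 2) * (1 / (4 * (?n - 2))) = 1/4" using n by (simp add: field_simps)
      then show "(?n - 2) * \<epsilon> \<le> 1/4" using mult_left_mono[OF \<epsilon>(2), of "?n - 2"] n by linarith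
    qed
    \<comment> \<open>\<open>s = n - 4 + (n - 2) * \<epsilon>\<close>, where the last term is at
      most \<open>1/4\<close>. Hence \<open>s\<close> and \<open>n - 2 - s\<close> are both at least
      one, which keeps \<open>a1\<close> below \<open>c powr ?p\<close>.\<close>
    have s: "1 \<le> s" "s + 1 \<le> ?n - 2" "?n - 4 \<le> s" using n2e n by (auto simp: s_def algebra_simps)
    have s2: "(?n - 2) * ?p = s + 2" by (simp add: s_def)
    have ss: "1 \<le> s * (?n - 2 - s)" using mult_mono[of 1 s 1 "?n - 2 - s"] s by simp
    have cp: "c powr ?p > 0" using c by simp
    have a1: "0 < a1" "a1 \<le> c powr ?p" "a1 * (s * (?n - 2 - s)) = c powr ?p"
      using ss cp by (auto simp: a1_def divide_le_eq)
    have \<omega>: "e \<le> ?\<omega>" "0 < ?\<omega>" using e \<epsilon> n by (auto simp: add_nonneg_pos)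
    have \<tau>': "0 \<le> \<tau>" "\<tau> \<le> 1/16" using \<tau> by (auto simp: almost_one_def)
    have clo: "\<Omega> \<subseteq> closure \<Omega>" "frontier \<Omega> \<subseteq> closure \<Omega>" by (auto simp: closure_subset frontier_def)
    have q0: "norm (a - w) > 0" if "a \<in> closure \<Omega>" for a using q1[OF that] d by linarith
    have r2q: "norm (a - y) \<le> 2 * norm (a - w)" if "a \<in> closure \<Omega>" for a
    proof (rule power2_le_imp_le)
      have "(1 + 8 * \<tau>) * (norm (a - w))\<^sup>2 \<le> 4 * (norm (a - w))\<^sup>2" using \<tau>' by (intro mult_right_mono) auto
      then show "(norm (a - y))\<^sup>2 \<le> (2 * norm (a - w))\<^sup>2" using q2[OF that] by (simp add: power_mult_distrib)
    qed simp
    have yfr: "y \<notin> frontier \<Omega>" using y \<Omega>(1) by (simp add: frontier_def interior_open)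
    have w\<Omega>: "w \<notin> closure \<Omega>" using q0[of w] by auto
    have bdpow: "(1 - e) * norm (a - w) powr (- t) \<le> norm (a - y) powr (- t)" "norm (a - y) powr (- t) \<le> (1 + e) * norm (a - w) powr (- t)"
      if "a \<in> frontier \<Omega>" "0 \<le> t" "t \<le> ?n" for a t
    proof -
      have "a \<noteq> y" using that(1) yfr by auto
      moreover have "a \<in> closure \<Omega>" using that(1) clo by auto
      ultimately show "(1 - e) * norm (a - w) powr (- t) \<le> norm (a - y) powr (- t)" "norm (a - y) powr (- t) \<le> (1 + e) * norm (a - w) powr (- t)"
        using powr_compare[OF \<tau>, of "norm (a - y)" "norm (a - w)" t] q0 q2 q3 that by auto
    qed
    note fw = fundamental_solution_harmonic[OF \<Omega>(1), of w]
    have w\<Omega>': "w \<notin> \<Omega>" using w\<Omega> clo by auto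
    have cE: "continuous_on (closure \<Omega>) (\<lambda>x. norm (x - w) powr (2 - ?n))"
      using w\<Omega> by (intro continuous_intros) auto
    have mn: "2 - ?n = - (?n - 2)" by simp
    \<comment> \<open>\<open>h\<close> and the fundamental solution with pole \<open>w\<close>
      outside the domain are both harmonic, and their boundary values agree up to the factors
      \<open>1 - e\<close> and \<open>1 + e\<close>. The maximum principle carries these factors
      inside.\<close>
    have hE1: "(1 - e) * (c * norm (x - w) powr (2 - ?n)) \<le> h x" if "x \<in> \<Omega>" for x
    proof -
      have "((1 - e) * c) * norm (x - w) powr (2 - ?n) \<le> 1 * h x"
      proof (rule harmonic_le[OF \<Omega> fw(1)[OF w\<Omega>'] cE fw(2)[OF w\<Omega>'] h(2,1,3) _ that])
        fix a assume a: "a \<in> frontier \<Omega>"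
        have "c * ((1 - e) * norm (a - w) powr (2 - ?n)) \<le> c * norm (a - y) powr (2 - ?n)"
          using bdpow(1)[OF a, of "?n - 2"] n c unfolding mn by (intro mult_left_mono) auto
        then show "((1 - e) * c) * norm (a - w) powr (2 - ?n) \<le> 1 * h a" using hbd[OF a] by (simp add: mult_ac)
      qed
      then show ?thesis by (simp add: mult_ac)
    qed
    have hE2: "h x \<le> (1 + e) * (c * norm (x - w) powr (2 - ?n))" if "x \<in> \<Omega>" for x
    proof -
      have "1 * h x \<le> ((1 + e) * c) * norm (x - w) powr (2 - ?n)"
      proof (rule harmonic_le[OF \<Omega> h(2,1,3) fw(1)[OF w\<Omega>'] cE fw(2)[OF w\<Omega>'] _ that])
        fix a assume a: "a \<in> frontier \<Omega>"
        have "c * norm (a - y) powr (2 - ?n) \<le> c * ((1 + e) * norm (a - w) powr (2 - ?n))"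
          using bdpow(2)[OF a, of "?n - 2"] n c unfolding mn by (intro mult_left_mono) auto
        then show "1 * h a \<le> ((1 + e) * c) * norm (a - w) powr (2 - ?n)" using hbd[OF a] by (simp add: mult_ac)
      qed
      then show ?thesis by (simp add: mult_ac)
    qed
    have h\<Gamma>: "h x \<le> c * norm (x - y) powr (2 - ?n)" if "x \<in> \<Omega>" "x \<noteq> y" for x
      by (rule green_function_nonneg[OF _ \<Omega> y c h hbd that]) (use n5 in auto)
    let ?F = "\<lambda>x. if x \<in> \<Omega> - {y} then (c * norm (x - y) powr (2 - ?n) - h x) powr ?p else 0"
    define D where "D x = a1 * norm (x - y) powr (- s) - gt x - a1 * norm (x - w) powr (- s)" for x
    define f0 where "f0 x = 1 * (a1 * (indicator \<Omega> x * (s * (?n - 2 - s) * norm (x - y) powr (- (s + 2)))) + (- 1) * ?F x) +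
       (- a1) * (indicator \<Omega> x * (s * (?n - 2 - s) * norm (x - w) powr (- (s + 2))))" for x
    \<comment> \<open>As \<open>0 powr b = 0\<close>, a pointwise bound by
      \<open>norm (x - y) powr (- (1/2))\<close> forces the value zero at the pole, whereas
      \<open>f0\<close> retains the term with \<open>w\<close> there. The change concerns a null
      set.\<close>
    define f where "f x = (if x \<in> {y} then 0 else f0 x)" for x
    have s0: "0 < s" "s + 2 < ?n" using s by auto
    have "weak_poisson \<Omega> (\<lambda>x. 1 * (a1 * norm (x - y) powr (- s) + (- 1) * gt x) + (- a1) * norm (x - w) powr (- s)) f0"
      unfolding f0_def
      by (rule weak_poisson_lincomb[OF weak_poisson_lincomb[OF weak_poisson_power[OF \<Omega> s0] gt(3)] weak_poisson_power[OF \<Omega> s0]])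
    then have wD0: "weak_poisson \<Omega> D f0" by (simp add: D_def[abs_def])
    have "f0 \<in> borel_measurable borel" using wD0 by (auto simp: weak_poisson_def)
    then have mf: "f \<in> borel_measurable borel" unfolding f_def by (intro measurable_If_set) auto
    have "AE x in lborel. f0 x = f x" using AE_lborel_singleton[of y] by eventually_elim (simp add: f_def)
    then have wD: "weak_poisson \<Omega> D f" using weak_poisson_cong_rhs[OF wD0 _ mf] by blast
    have f_out: "f x = 0" if "x \<notin> \<Omega>" for x using that by (simp add: f_def f0_def)
    have fy: "f y = 0" by (simp add: f_def)
    have bf: "\<bar>f x\<bar> \<le> ?\<omega> * c powr ?p * (norm (x - w) powr (- (s + 3/2)) * norm (x - y) powr (- (1/2)))" if x: "x \<in> \<Omega>" "x \<noteq> y" for x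
    proof -
      have xc: "x \<in> closure \<Omega>" using x clo by auto
      let ?\<Gamma> = "c * norm (x - y) powr (2 - ?n)" and ?E = "c * norm (x - w) powr (2 - ?n)"
      \<comment> \<open>This is where the value of \<open>a1\<close> matters: the sources of the two
        powers turn into the \<open>?p\<close>-th powers of the fundamental solutions with poles
        \<open>y\<close> and \<open>w\<close>.\<close>
      have pw: "(c * b powr (2 - ?n)) powr ?p = a1 * (s * (?n - 2 - s) * b powr (- (s + 2)))" if "b > 0" for b
      proof -
        have "(2 - ?n) * ?p = - (s + 2)" using s2 by (simp add: algebra_simps)
        then have "(c * b powr (2 - ?n)) powr ?p = c powr ?p * b powr (- (s + 2))"
          using c that by (simp add: powr_mult powr_powr)
        then show ?thesis unfolding a1(3)[symmetric] by (simp only: mult.assoc)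
      qed
      have "f x = ?\<Gamma> powr ?p - (?\<Gamma> - h x) powr ?p - ?E powr ?p"
        using x pw[of "norm (x - y)"] pw[of "norm (x - w)"] q0[OF xc] by (simp add: f_def f0_def)
      moreover have "\<bar>?\<Gamma> powr ?p - (?\<Gamma> - h x) powr ?p - ?E powr ?p\<bar> \<le>
        (4 * (1 + 4 / (1 / (2 * (?n - 2)))) * \<epsilon> + 6 * e) * c powr ?p * (norm (x - w) powr (- ((?n - 2) * ?p - 1/2)) * norm (x - y) powr (- (1/2)))"
        by (rule nonlinearity_estimate) (use n c x q0[OF xc] r2q[OF xc] e \<epsilon> hE1[OF x(1)] hE2[OF x(1)] h\<Gamma>[OF x] in auto)
      moreover have "4 / (1 / (2 * (?n - 2))) = 8 * (?n - 2)" by simp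
      moreover have "(?n - 2) * ?p - 1/2 = s + 3/2" using s2 by simp
      ultimately show ?thesis by (simp only:)
    qed
    define M where "M = ?\<omega> * c powr ?p * d powr (- (s + 3/2))"
    have M0: "M \<ge> 0" using \<omega> cp by (simp add: M_def)
    have bfM: "\<bar>f x\<bar> \<le> M * norm (x - y) powr (- (1/2))" for x
    proof (cases "x \<in> \<Omega> \<and> x \<noteq> y")
      case True
      then have "norm (x - w) powr (- (s + 3/2)) \<le> d powr (- (s + 3/2))"
        using q1[of x] clo d s by (intro powr_mono2') auto
      then have "?\<omega> * c powr ?p * (norm (x - w) powr (- (s + 3/2)) * norm (x - y) powr (- (1/2))) \<le> ?\<omega> * c powr ?p * (d powr (- (s + 3/2)) * norm (x - y) powr (- (1/2)))"
        using \<omega> cp by (intro mult_left_mono mult_right_mono) auto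
      then show ?thesis using bf[of x] True by (simp add: M_def mult.assoc)
    qed (use f_out fy M0 in auto)
    have cD: "continuous_on (closure \<Omega> - {y}) D"
      unfolding D_def using w\<Omega> by (intro continuous_intros gt(1)) auto
    \<comment> \<open>The ball of radius \<open>2 * R = d / 2\<close> lies inside the
      domain.\<close>
    define R where "R = d / 4"
    have R: "R > 0" "ball y (2 * R) \<subseteq> \<Omega>" using d ball by (auto simp: R_def)
    obtain l g where lg: "((D(y := l)) has_derivative (\<lambda>v. g \<bullet> v)) (at y)"
      and gb: "\<And>S. (\<forall>x\<in>ball y (2 * R) - {y}. \<bar>D x\<bar> \<le> S) \<Longrightarrow> norm g \<le> C * (S / R + M * sqrt R)"
      using rs[OF \<Omega> R wD continuous_on_subset[OF cD] bfM f_out bfM M0] clo by blast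
    define D1 where "D1 = D(y := l)"
    have wD1: "weak_poisson \<Omega> D1 f" unfolding D1_def by (rule weak_poisson_fun_upd[OF wD \<Omega>(1)])
    have cD1: "continuous_on (closure \<Omega>) D1"
    proof -
      have "continuous_on (closure \<Omega> - {y}) D1"
        by (rule continuous_on_eq[OF cD]) (simp add: D1_def)
      moreover have "isCont D1 y" using has_derivative_continuous[OF lg] by (simp add: D1_def)
      ultimately show ?thesis
        unfolding continuous_on_eq_continuous_within
      proof (intro ballI)
        fix x assume x: "x \<in> closure \<Omega>"
        assume a: "\<forall>x\<in>closure \<Omega> - {y}. continuous (at x within closure \<Omega> - {y}) D1" and b: "isCont D1 y"
        show "continuous (at x within closure \<Omega>) D1"
        proof (cases "x = y")
          case True
          then show ?thesis using b continuous_at_imp_continuous_at_within by blast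
        next
          case False
          have eq: "at x within (closure \<Omega> - {y}) = at x within closure \<Omega>"
            by (rule at_within_nhd[of x "- {y}"]) (use False in auto)
          have "continuous (at x within (closure \<Omega> - {y})) D1" using a x False by blast
          then show ?thesis unfolding eq .
        qed
      qed
    qed
    define X where "X x = norm (x - y) powr (3/2) + d powr (3/2)" for x
    define V where "V x = X x powr (- (2 * s / 3))" for x
    obtain gV MV where gV: "weak_poisson \<Omega> V gV" "\<And>x. \<bar>gV x\<bar> \<le> MV * norm (x - y) powr (- (1/2))"
      "\<And>x. x \<notin> \<Omega> \<Longrightarrow> gV x = 0"
      "\<And>x. x \<in> \<Omega> \<Longrightarrow> s * (?n - 2 - s) * norm (x - y) powr (- (1/2)) * X x powr (- (2 * s / 3 + 1)) \<le> gV x"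
      unfolding V_def X_def using weak_poisson_barrier[OF \<Omega> s0 d, of y thesis] by blast
    have X: "X x > 0" "d powr (3/2) \<le> X x" for x using d by (auto simp: X_def add_nonneg_pos)
    \<comment> \<open>\<open>4 powr ?n\<close> is the constant of \<open>barrier_compare\<close>,
      with \<open>m = n\<close> covering both exponents \<open>2 * s / 3\<close> and
      \<open>2 * s / 3 + 1\<close>.\<close>
    define A where "A = ?\<omega> * c powr ?p * 4 powr ?n"
    have A: "A > 0" using \<omega> cp by (simp add: A_def)
    have cV: "continuous_on (closure \<Omega>) V" unfolding V_def X_def by (rule continuous_on_barrier) (use d in auto)
    have fV: "\<bar>f x\<bar> \<le> A * gV x" for x
    proof -
      consider "x \<notin> \<Omega>" | "x = y" | "x \<in> \<Omega>" "x \<noteq> y" by blast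
      then show ?thesis
      proof cases
        case 2
        have "0 \<le> gV y" using gV(4)[OF y] by simp
        then show ?thesis using 2 fy A by simp
      next
        case 3
        then have xc: "x \<in> closure \<Omega>" using clo by auto
        have "norm (x - w) powr (- (3/2 * (2 * s / 3 + 1))) \<le> 4 powr ?n * X x powr (- (2 * s / 3 + 1))"
          unfolding X_def by (rule barrier_compare) (use 3 d q1[OF xc] r2q[OF xc] s in auto)
        moreover have "3/2 * (2 * s / 3 + 1) = s + 3/2" by simp
        ultimately have "norm (x - w) powr (- (s + 3/2)) \<le> 4 powr ?n * X x powr (- (2 * s / 3 + 1))" by (simp only:)
        then have "?\<omega> * c powr ?p * (norm (x - w) powr (- (s + 3/2)) * norm (x - y) powr (- (1/2))) \<le>
          ?\<omega> * c powr ?p * ((4 powr ?n * X x powr (- (2 * s / 3 + 1))) * norm (x - y) powr (- (1/2)))"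
          using \<omega> cp by (intro mult_left_mono mult_right_mono) auto
        also have "\<dots> = A * (1 * (norm (x - y) powr (- (1/2)) * X x powr (- (2 * s / 3 + 1))))" by (simp add: A_def mult_ac)
        also have "\<dots> \<le> A * ((s * (?n - 2 - s)) * (norm (x - y) powr (- (1/2)) * X x powr (- (2 * s / 3 + 1))))"
          using A ss by (intro mult_left_mono mult_right_mono) auto
        also have "\<dots> \<le> A * gV x" using gV(4)[OF 3(1)] A by (intro mult_left_mono) (auto simp: mult.assoc)
        finally show ?thesis using bf[OF 3] by linarith
      qed (use f_out gV(3) in auto)
    qed
    \<comment> \<open>Both signs of \<open>t\<close> together bound the absolute value of
      \<open>D1\<close>.\<close>
    have comparison: "0 \<le> A * V x + t * D1 x" if t: "t = 1 \<or> t = -1" and x: "x \<in> \<Omega>" for t x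
    proof (rule weak_min_principle[OF \<Omega> _ weak_poisson_lincomb[OF gV(1) wD1] _ _ _ _ x])
      show "continuous_on (closure \<Omega>) (\<lambda>x. A * V x + t * D1 x)" by (intro continuous_intros cV cD1)
      show "0 \<le> A * gV x + t * f x" for x using fV[of x] t by (auto simp: abs_le_iff)
      show "\<bar>A * gV x + t * f x\<bar> \<le> (A * MV + M) * norm (x - y) powr (- (1/2))" for x
      proof -
        have "\<bar>A * gV x\<bar> \<le> A * (MV * norm (x - y) powr (- (1/2)))" unfolding abs_mult using gV(2)[of x] A by (intro mult_mono) auto
        moreover have "\<bar>t * f x\<bar> = \<bar>f x\<bar>" using t by auto
        ultimately show ?thesis using bfM[of x] by (simp add: distrib_right)
      qed
      show "A * gV x + t * f x = 0" if "x \<notin> \<Omega>" for x using that gV(3) f_out by simp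
      fix x assume x: "x \<in> frontier \<Omega>"
      have xc: "x \<in> closure \<Omega>" and xy: "x \<noteq> y" using x clo yfr by auto
      \<comment> \<open>On the frontier \<open>gt\<close> vanishes, so \<open>D1\<close> is
        \<open>a1\<close> times the difference of the powers with poles \<open>y\<close> and
        \<open>w\<close>, and these agree up to the relative error \<open>e\<close>.\<close>
      have "\<bar>norm (x - y) powr (- s) - norm (x - w) powr (- s)\<bar> \<le> e * norm (x - w) powr (- s)"
        using bdpow[OF x, of s] s by (simp add: abs_le_iff algebra_simps)
      then have "a1 * \<bar>norm (x - y) powr (- s) - norm (x - w) powr (- s)\<bar> \<le> c powr ?p * (?\<omega> * norm (x - w) powr (- s))"
        using a1 \<omega> e by (intro mult_mono order_trans[OF _ mult_right_mono[OF \<omega>(1)]]) auto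
      also have "norm (x - w) powr (- s) \<le> 4 powr ?n * V x"
      proof -
        have "norm (x - w) powr (- (3/2 * (2 * s / 3))) \<le> 4 powr ?n * V x"
          unfolding X_def V_def by (rule barrier_compare) (use xy d q1[OF xc] r2q[OF xc] s in auto)
        then show ?thesis by simp
      qed
      then have "c powr ?p * (?\<omega> * norm (x - w) powr (- s)) \<le> c powr ?p * (?\<omega> * (4 powr ?n * V x))"
        using \<omega> by (intro mult_left_mono) auto
      also have "\<dots> = A * V x" by (simp add: A_def mult_ac)
      finally have "a1 * \<bar>norm (x - y) powr (- s) - norm (x - w) powr (- s)\<bar> \<le> A * V x" .
      moreover have "D1 x = a1 * (norm (x - y) powr (- s) - norm (x - w) powr (- s))"
        using xy gt(2)[OF x] by (simp add: D1_def D_def right_diff_distrib)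
      then have "\<bar>t * D1 x\<bar> = a1 * \<bar>norm (x - y) powr (- s) - norm (x - w) powr (- s)\<bar>" using t a1(1) by (auto simp: abs_mult)
      ultimately show "0 \<le> A * V x + t * D1 x" by linarith
    qed
    have Vd: "V x \<le> d powr (- s)" for x
    proof -
      have "V x \<le> (d powr (3/2)) powr (- (2 * s / 3))" unfolding V_def using X(2) d s by (intro powr_mono2') auto
      then show ?thesis by (simp add: powr_powr)
    qed
    have "\<forall>x\<in>ball y (2 * R) - {y}. \<bar>D x\<bar> \<le> A * d powr (- s)"
    proof
      fix x assume x: "x \<in> ball y (2 * R) - {y}"
      then have x\<Omega>: "x \<in> \<Omega>" using R(2) by blast
      have "\<bar>D1 x\<bar> \<le> A * V x" using comparison[of 1 x] comparison[of "-1" x] x\<Omega> by (simp add: abs_le_iff)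
      also have "\<dots> \<le> A * d powr (- s)" using Vd A by (intro mult_left_mono) auto
      finally show "\<bar>D x\<bar> \<le> A * d powr (- s)" using x by (simp add: D1_def)
    qed
    from gb[OF this] have "norm g \<le> C * (A * d powr (- s) / R + M * sqrt R)" .
    \<comment> \<open>The factor \<open>5\<close> is \<open>4 + 1\<close>: dividing by
      \<open>R = d / 4\<close> gives \<open>4\<close>, and \<open>M * sqrt R\<close> is bounded with
      factor one because \<open>sqrt R <= sqrt d\<close>.\<close>
    also have "\<dots> \<le> C * (4 * (A * d powr (- s - 1)) + A * d powr (- s - 1))"
    proof (intro mult_left_mono add_mono)
      have "d powr (- s) = d * d powr (- s - 1)" by (rule powr_mult_self[symmetric]) (use d in auto)
      then show "A * d powr (- s) / R \<le> 4 * (A * d powr (- s - 1))" using d by (simp add: R_def)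
      have "sqrt R \<le> d powr (1/2)" using d by (simp add: R_def powr_half_sqrt)
      then have "d powr (- (s + 3/2)) * sqrt R \<le> d powr (- (s + 3/2)) * d powr (1/2)" by (intro mult_left_mono) auto
      moreover have "0 \<le> ?\<omega> * c powr ?p" using \<omega>(2) cp by (intro mult_nonneg_nonneg) auto
      ultimately have "?\<omega> * c powr ?p * (d powr (- (s + 3/2)) * sqrt R) \<le> ?\<omega> * c powr ?p * (d powr (- (s + 3/2)) * d powr (1/2))"
        by (rule mult_left_mono)
      then have "M * sqrt R \<le> ?\<omega> * c powr ?p * (d powr (- (s + 3/2)) * d powr (1/2))" by (simp only: M_def mult.assoc)
      also have "d powr (- (s + 3/2)) * d powr (1/2) = d powr (- s - 1)"
      proof -
        have "- (s + 3/2) + 1/2 = - s - 1" by simp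
        then show ?thesis by (simp only: powr_add[symmetric])
      qed
      also have "?\<omega> * c powr ?p * d powr (- s - 1) \<le> A * d powr (- s - 1)"
      proof (rule mult_right_mono)
        have "1 \<le> (4::real) powr ?n" by (rule ge_one_powr_ge_zero) auto
        then show "?\<omega> * c powr ?p \<le> A" unfolding A_def using mult_left_mono[of 1 "4 powr ?n" "?\<omega> * c powr ?p"] \<omega> cp by simp
      qed simp
      finally show "M * sqrt R \<le> A * d powr (- s - 1)" .
    qed (use C in auto)
    also have "\<dots> = 5 * C * 4 powr ?n * ?\<omega> * c powr ?p * d powr (- s - 1)" by (simp add: A_def algebra_simps)
    finally have "norm g \<le> 5 * C * 4 powr ?n * ?\<omega> * c powr ?p * d powr (- s - 1)" .
    with lg show "\<exists>l g. (((\<lambda>x. a1 * norm (x - y) powr (- s) - gt x - a1 * norm (x - w) powr (- s))(y := l)) has_derivative (\<lambda>v. g \<bullet> v)) (at y) \<and>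
        norm g \<le> 5 * C * 4 powr ?n * ?\<omega> * c powr ?p * d powr (- s - 1)"
      unfolding D_def by blast
  qed
qed

text \<open>Between zero and the fundamental solution the Green function has an integrable
  \<open>p\<close>-th power, since \<open>p * (n - 2) < n\<close>. Its value at the pole is replaced
  by zero, and natural powers of the distance become real ones.\<close>

lemma green_tilde_weak_poisson:
  fixes \<Omega> :: "(real^'n) set"
  assumes n: "CARD('n) \<ge> 5" and \<Omega>: "open \<Omega>" "bounded \<Omega>" and y: "y \<in> \<Omega>"
    and p: "0 \<le> p" "p * (real CARD('n) - 2) < real CARD('n)"
    and c: "c > 0" "c = c_const (real CARD('n))"
    and Gt: "is_green_tilde \<Omega> p (green H) Gt"
    and H: "continuous_on \<Omega> (\<lambda>x. H x y)" "\<And>x. x \<in> \<Omega> \<Longrightarrow> 0 \<le> H x y"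
      "\<And>x. x \<in> \<Omega> \<Longrightarrow> x \<noteq> y \<Longrightarrow> H x y \<le> c * norm (x - y) powr (2 - real CARD('n))"
  shows "weak_poisson \<Omega> (\<lambda>x. Gt x y)
    (\<lambda>x. if x \<in> \<Omega> - {y} then (c * norm (x - y) powr (2 - real CARD('n)) - H x y) powr p else 0)"
proof -
  let ?n = "real CARD('n)"
  let ?F = "\<lambda>x. if x \<in> \<Omega> - {y} then (c * norm (x - y) powr (2 - ?n) - H x y) powr p else 0"
  have g: "set_integrable lborel \<Omega> (\<lambda>x. Gt x y)"
    "\<And>\<phi>. test_function \<Omega> \<phi> \<Longrightarrow> (LINT x:\<Omega>|lborel. Gt x y * (- laplacian \<phi> x)) = (LINT x:\<Omega>|lborel. green H x y powr p * \<phi> x)"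
    using Gt y by (auto simp: is_green_tilde_def)
  have iG: "integrable lborel (\<lambda>x. indicator \<Omega> x * Gt x y)" using g(1) by (simp add: set_integrable_def)
  have green: "green H x y = c * norm (x - y) powr (2 - ?n) - H x y" if "x \<noteq> y" for x
  proof -
    have "norm (x - y) ^ (CARD('n) - 2) = norm (x - y) powr (?n - 2)"
      using that n by (subst powr_realpow[symmetric]) (auto simp: of_nat_diff)
    then show ?thesis using c(2) powr_minus_divide[of "norm (x - y)" "?n - 2"] by (simp add: green_def)
  qed
  have mF: "?F \<in> borel_measurable borel"
  proof -
    have cH: "continuous_on (\<Omega> - {y}) (\<lambda>x. H x y)" by (rule continuous_on_subset[OF H(1)]) auto
    have "continuous_on (\<Omega> - {y}) (\<lambda>x. c * norm (x - y) powr (2 - ?n) - H x y)"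
      by (intro continuous_intros cH) auto
    then have "(\<lambda>x. if x \<in> \<Omega> - {y} then c * norm (x - y) powr (2 - ?n) - H x y else 0) \<in> borel_measurable borel"
      by (intro borel_measurable_continuous_on_if) (use \<Omega>(1) in \<open>auto intro: borel_open open_delete\<close>)
    then have "(\<lambda>x. (if x \<in> \<Omega> - {y} then c * norm (x - y) powr (2 - ?n) - H x y else 0) powr p) \<in> borel_measurable borel"
      by (intro powr_real_measurable) auto
    moreover have "(\<lambda>x. (if x \<in> \<Omega> - {y} then c * norm (x - y) powr (2 - ?n) - H x y else 0) powr p) = ?F"
      by (rule ext) (simp split: if_split)
    ultimately show ?thesis by (simp only:)
  qed
  obtain r where r: "r > 0" "\<Omega> \<subseteq> ball y r" using bounded_subset_ballD[OF \<Omega>(2)] by blast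
  have bF: "\<bar>?F x\<bar> \<le> c powr p * norm (x - y) powr (- (p * (?n - 2)))" for x
  proof (cases "x \<in> \<Omega> - {y}")
    case True
    have "(c * norm (x - y) powr (2 - ?n) - H x y) powr p \<le> (c * norm (x - y) powr (2 - ?n)) powr p"
      using True H(2)[of x] H(3)[of x] p by (intro powr_mono2) auto
    also have "\<dots> = c powr p * norm (x - y) powr ((2 - ?n) * p)" using c by (simp add: powr_mult powr_powr)
    also have "(2 - ?n) * p = - (p * (?n - 2))" by (simp add: algebra_simps)
    finally show ?thesis using True by simp
  next
    case False
    then have "?F x = 0" by (rule if_not_P)
    then show ?thesis by simp
  qed
  have iF: "integrable lborel ?F"
  proof (rule integrable_riesz_bound[OF mF, where \<beta>="p * (?n - 2)" and r=r and y=y and A="c powr p"])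
    show "\<bar>?F x\<bar> \<le> c powr p * norm (x - y) powr (- (p * (?n - 2)))" for x by (rule bF)
    show "?F x = 0" if "x \<notin> ball y r" for x using that r(2) by auto
  qed (use p n r in auto)
  show ?thesis
    unfolding weak_poisson_def
  proof (intro conjI allI impI iG iF)
    fix \<phi> assume t: "test_function \<Omega> \<phi>"
    have "integral\<^sup>L lborel (\<lambda>x. indicator \<Omega> x * Gt x y * laplacian \<phi> x) = - (LINT x:\<Omega>|lborel. Gt x y * (- laplacian \<phi> x))"
      by (simp add: set_lebesgue_integral_def mult.assoc)
    also have "\<dots> = - (LINT x:\<Omega>|lborel. green H x y powr p * \<phi> x)" using g(2)[OF t] by simp
    also have "(LINT x:\<Omega>|lborel. green H x y powr p * \<phi> x) = integral\<^sup>L lborel (\<lambda>x. ?F x * \<phi> x)"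
      unfolding set_lebesgue_integral_def
    proof (rule integral_cong_AE)
      have m\<phi>: "\<phi> \<in> borel_measurable borel"
        by (rule borel_measurable_continuous_onI[OF Ck_on_imp_continuous_on[OF test_functionD(1)[OF t]]])
      show m: "(\<lambda>x. ?F x * \<phi> x) \<in> borel_measurable lborel"
        unfolding measurable_lborel2 by (rule borel_measurable_times[OF mF m\<phi>])
      have "(\<lambda>x. indicator \<Omega> x *\<^sub>R (green H x y powr p * \<phi> x)) = (\<lambda>x. if x \<in> {y} then indicator \<Omega> y *\<^sub>R (green H y y powr p * \<phi> y) else ?F x * \<phi> x)"
        by (rule ext) (simp add: green indicator_def)
      moreover have "(\<lambda>x. if x \<in> {y} then indicator \<Omega> y *\<^sub>R (green H y y powr p * \<phi> y) else ?F x * \<phi> x) \<in> borel_measurable lborel"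
        by (rule measurable_If_set) (use m in auto)
      ultimately show "(\<lambda>x. indicator \<Omega> x *\<^sub>R (green H x y powr p * \<phi> x)) \<in> borel_measurable lborel" by (simp only:)
      show "AE x in lborel. indicator \<Omega> x *\<^sub>R (green H x y powr p * \<phi> x) = ?F x * \<phi> x"
        using AE_lborel_singleton[of y]
      proof eventually_elim
        case (elim x)
        then show ?case by (simp add: green indicator_def)
      qed
    qed
    finally show "integral\<^sup>L lborel (\<lambda>x. indicator \<Omega> x * Gt x y * laplacian \<phi> x) = - integral\<^sup>L lborel (\<lambda>x. ?F x * \<phi> x)" .
  qed
qed

section \<open>Choice of the constants and lower bound for the normal derivative\<close>

theorem theorem1p5:
  assumes "CARD('n::finite) \<ge> 5"
  shows "\<exists>\<alpha>::real. \<alpha> > 0 \<and> 1 + \<alpha> \<le> real CARD('n) / (real CARD('n) - 2) \<and>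
    (\<forall>p::real. 1 \<le> p \<and> p < 1 + \<alpha> \<longrightarrow>
      (\<forall>(\<Omega>::(real^'n) set) H Gt.
         smooth_bounded_domain \<Omega> \<and> is_green_regular_part \<Omega> H \<and>
         is_green_tilde \<Omega> p (green H) Gt \<longrightarrow>
         (\<exists>C \<delta>::real. C > 0 \<and> \<delta> > 0 \<and>
            (\<forall>x\<in>\<Omega>. bdry_dist \<Omega> x < \<delta> \<longrightarrow>
               normal_deriv_H_tilde \<Omega> p H Gt x
                 \<ge> C * bdry_dist \<Omega> x powr (1 - (real CARD('n) - 2) * p)))))"
proof -
  let ?n = "real CARD('n)"
  have n: "?n \<ge> 5" using assms by simp
  have dim5: "DIM(real^'n) \<ge> 5" using assms by simp
  have dimn: "real DIM(real^'n) = ?n" by simp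
  have "?n > 2" using n by simp
  from ex_newton_profile[OF this] obtain \<Theta> \<Theta>1 \<Theta>2 E where P:
    "(\<forall>k. Ck_on k \<Theta> UNIV) \<and> (\<forall>k. Ck_on k E UNIV) \<and>
    (\<forall>t. (\<Theta> has_real_derivative \<Theta>1 t) (at t)) \<and> (\<forall>t. (\<Theta>1 has_real_derivative \<Theta>2 t) (at t)) \<and>
    (\<forall>t\<ge>1. \<Theta> t = t powr (1 - ?n / 2)) \<and> (\<forall>t>0. 0 \<le> \<Theta> t \<and> \<Theta> t \<le> t powr (1 - ?n / 2)) \<and>
    (\<forall>t. E t = - (4 * t * \<Theta>2 t + 2 * ?n * \<Theta>1 t)) \<and> (\<forall>t. E t \<ge> 0) \<and>
    (\<forall>t. 1/4 < t \<longrightarrow> t < 1 \<longrightarrow> E t > 0) \<and> (\<forall>t\<ge>1. E t = 0)" by (elim exE)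
  interpret np: newton_profile \<Theta> \<Theta>1 \<Theta>2 E "TYPE(real^'n)"
  proof
    show "DIM(real^'n) > 2" using n by simp
    fix k t
    show "Ck_on k \<Theta> UNIV" "Ck_on k E UNIV" "(\<Theta> has_real_derivative \<Theta>1 t) (at t)" "(\<Theta>1 has_real_derivative \<Theta>2 t) (at t)"
      "0 \<le> E t" "1/4 < t \<Longrightarrow> t < 1 \<Longrightarrow> 0 < E t" "1 \<le> t \<Longrightarrow> E t = 0"
      using P by blast+
    show "E t = - (4 * t * \<Theta>2 t + 2 * real DIM(real^'n) * \<Theta>1 t)"
      "1 \<le> t \<Longrightarrow> \<Theta> t = t powr (1 - real DIM(real^'n) / 2)"
      "0 < t \<Longrightarrow> 0 \<le> \<Theta> t" "0 < t \<Longrightarrow> \<Theta> t \<le> t powr (1 - real DIM(real^'n) / 2)"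
      unfolding dimn using P by blast+
  qed
  obtain C0 where C0: "C0 > 0" and core:
    "\<And>\<Omega> (y::real^'n) w d c h gt \<tau> e \<epsilon> s a1. open \<Omega> \<Longrightarrow> bounded \<Omega> \<Longrightarrow> y \<in> \<Omega> \<Longrightarrow> d > 0 \<Longrightarrow> ball y d \<subseteq> \<Omega> \<Longrightarrow>
      (\<And>a. a \<in> closure \<Omega> \<Longrightarrow> d \<le> norm (a - w)) \<Longrightarrow>
      (\<And>a. a \<in> closure \<Omega> \<Longrightarrow> (norm (a - y))\<^sup>2 \<le> (1 + 8 * \<tau>) * (norm (a - w))\<^sup>2) \<Longrightarrow>
      (\<And>a. a \<in> frontier \<Omega> \<Longrightarrow> (1 - 8 * \<tau>) * (norm (a - w))\<^sup>2 \<le> (norm (a - y))\<^sup>2) \<Longrightarrow>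
      almost_one ?n e \<tau> \<Longrightarrow> 0 < e \<Longrightarrow> e \<le> 1 / 4 \<Longrightarrow> c > 0 \<Longrightarrow>
      continuous_on (closure \<Omega>) h \<Longrightarrow> Ck_on 2 h \<Omega> \<Longrightarrow> (\<And>x. x \<in> \<Omega> \<Longrightarrow> laplacian h x = 0) \<Longrightarrow>
      (\<And>x. x \<in> frontier \<Omega> \<Longrightarrow> h x = c * norm (x - y) powr (2 - ?n)) \<Longrightarrow>
      0 \<le> \<epsilon> \<Longrightarrow> \<epsilon> \<le> 1 / (4 * (?n - 2)) \<Longrightarrow>
      continuous_on (closure \<Omega> - {y}) gt \<Longrightarrow> (\<And>x. x \<in> frontier \<Omega> \<Longrightarrow> gt x = 0) \<Longrightarrow>
      weak_poisson \<Omega> gt (\<lambda>x. if x \<in> \<Omega> - {y} then (c * norm (x - y) powr (2 - ?n) - h x) powr (1 + \<epsilon>) else 0) \<Longrightarrow>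
      s = (?n - 2) * (1 + \<epsilon>) - 2 \<Longrightarrow> a1 = c powr (1 + \<epsilon>) / (s * (?n - 2 - s)) \<Longrightarrow>
      \<exists>l g. (((\<lambda>x. a1 * norm (x - y) powr (- s) - gt x - a1 * norm (x - w) powr (- s))(y := l)) has_derivative (\<lambda>v. g \<bullet> v)) (at y) \<and>
        norm g \<le> C0 * (4 * (1 + 8 * (?n - 2)) * \<epsilon> + 6 * e) * c powr (1 + \<epsilon>) * d powr (- s - 1)"
    by (fact np.core_estimate[OF dim5, unfolded dimn])
  \<comment> \<open>The budget for the error factor \<open>k * \<epsilon> + 6 * e\<close>: if it is
    at most \<open>b\<close>, then \<open>norm g\<close> is at most
    \<open>C * d powr (- s - 1)\<close> with \<open>C = c powr p * 2 powr (- n - 2)\<close>, half of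
    the lower bound found below for the contribution of \<open>W\<close>.\<close>
  define b where "b = 2 powr (- ?n - 2) / C0"
  have b: "b > 0" using C0 by (simp add: b_def)
  define k where "k = 4 * (1 + 8 * (?n - 2))"
  have k: "k > 0" using n by (simp add: k_def)
  \<comment> \<open>The first entry is the bound \<open>\<theta> / 2\<close> of
    \<open>nonlinearity_estimate\<close>; it also keeps \<open>p\<close> below
    \<open>(n - 1) / (n - 2)\<close>, hence in the first case of the regular part. The second entry
    grants \<open>p - 1\<close> one half of the budget \<open>b\<close>, and \<open>6 * e\<close>
    gets the other half.\<close>
  define \<alpha> where "\<alpha> = min (1 / (4 * (?n - 2))) (b / (2 * k))"
  define e where "e = min (1 / 4) (b / 12)"
  have \<alpha>: "\<alpha> > 0" "\<alpha> \<le> 1 / (4 * (?n - 2))" "k * \<alpha> \<le> b / 2"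
    using n b k by (auto simp: \<alpha>_def min_le_iff_disj field_simps min_def)
  have e: "0 < e" "e \<le> 1 / 4" "6 * e \<le> b / 2" using b by (auto simp: e_def)
  have "1 / (4 * (?n - 2)) \<le> 2 / (?n - 2)" using n by (simp add: field_simps)
  moreover have "?n / (?n - 2) = 1 + 2 / (?n - 2)" using n by (simp add: field_simps)
  ultimately have \<alpha>n: "1 + \<alpha> \<le> ?n / (?n - 2)" using \<alpha>(2) by linarith
  have main: "\<exists>C \<delta>::real. C > 0 \<and> \<delta> > 0 \<and> (\<forall>x\<in>\<Omega>. bdry_dist \<Omega> x < \<delta> \<longrightarrow>
      normal_deriv_H_tilde \<Omega> p H Gt x \<ge> C * bdry_dist \<Omega> x powr (1 - (?n - 2) * p))"
    if p: "1 \<le> p" "p < 1 + \<alpha>" and dom: "smooth_bounded_domain \<Omega>" and HH: "is_green_regular_part \<Omega> H"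
      and GG: "is_green_tilde \<Omega> p (green H) Gt" for p :: real and \<Omega> :: "(real^'n) set" and H Gt
  proof -
    have \<Omega>: "open \<Omega>" "bounded \<Omega>" using dom by (auto simp: smooth_bounded_domain_def)
    define \<epsilon> where "\<epsilon> = p - 1"
    have \<epsilon>: "0 \<le> \<epsilon>" "\<epsilon> \<le> \<alpha>" "p = 1 + \<epsilon>" "\<epsilon> \<le> 1 / (4 * (?n - 2))" using p \<alpha>(2) by (auto simp: \<epsilon>_def)
    define c where "c = c_const ?n"
    have c: "c > 0" using n unfolding c_def c_const_def by (intro divide_pos_pos mult_pos_pos unit_ball_vol_pos) auto
    define s where "s = (?n - 2) * p - 2"
    have ne: "0 \<le> (?n - 2) * \<epsilon>" "(?n - 2) * \<epsilon> \<le> 1/4"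
    proof -
      show "0 \<le> (?n - 2) * \<epsilon>" using \<epsilon>(1) n by (intro mult_nonneg_nonneg) auto
      have "(?n - 2) * (1 / (4 * (?n - 2))) = 1/4" using n by (simp add: field_simps)
      then show "(?n - 2) * \<epsilon> \<le> 1/4" using mult_left_mono[OF \<epsilon>(4), of "?n - 2"] n by linarith
    qed
    have s: "1 \<le> s" "1 \<le> ?n - 2 - s" "?n - 2 - s \<le> 2" using ne n by (auto simp: s_def \<epsilon>(3) algebra_simps)
    define a1 where "a1 = c powr p / (s * (?n - 2 - s))"
    have a1: "a1 = \<alpha>1_const ?n p" by (simp add: a1_def \<alpha>1_const_def c_def s_def algebra_simps)
    \<comment> \<open>One factor \<open>s\<close> cancels, and
      \<open>n - 2 - s = 2 - (n - 2) * \<epsilon>\<close> is at most \<open>2\<close>.\<close>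
    have a1s: "c powr p / 2 \<le> a1 * s"
    proof -
      have "a1 * s = c powr p / (?n - 2 - s)" using s by (simp add: a1_def)
      moreover have "c powr p / 2 \<le> c powr p / (?n - 2 - s)" using s c by (intro divide_left_mono mult_pos_pos) auto
      ultimately show ?thesis by simp
    qed
    obtain K where K: "K > 0" and dpos: "\<And>x. x \<in> \<Omega> \<Longrightarrow> 0 < bdry_dist \<Omega> x"
      and bsub: "\<And>x. x \<in> \<Omega> \<Longrightarrow> ball x (bdry_dist \<Omega> x) \<subseteq> \<Omega>"
      and dir: "\<And>x. x \<in> \<Omega> \<Longrightarrow> K * bdry_dist \<Omega> x \<le> 1 / 16 \<Longrightarrow>
        norm (bdry_dir \<Omega> x) = 1 \<and> x + bdry_dist \<Omega> x *\<^sub>R bdry_dir \<Omega> x \<in> frontier \<Omega>"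
      and qc: "\<And>x a. x \<in> \<Omega> \<Longrightarrow> K * bdry_dist \<Omega> x \<le> 1 / 16 \<Longrightarrow> a \<in> closure \<Omega> \<Longrightarrow>
        (a - (x + bdry_dist \<Omega> x *\<^sub>R bdry_dir \<Omega> x)) \<bullet> bdry_dir \<Omega> x \<le> K * (norm (a - (x + bdry_dist \<Omega> x *\<^sub>R bdry_dir \<Omega> x)))\<^sup>2"
      and qf: "\<And>x a. x \<in> \<Omega> \<Longrightarrow> K * bdry_dist \<Omega> x \<le> 1 / 16 \<Longrightarrow> a \<in> frontier \<Omega> \<Longrightarrow>
        \<bar>(a - (x + bdry_dist \<Omega> x *\<^sub>R bdry_dir \<Omega> x)) \<bullet> bdry_dir \<Omega> x\<bar> \<le> K * (norm (a - (x + bdry_dist \<Omega> x *\<^sub>R bdry_dir \<Omega> x)))\<^sup>2"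
      by (fact bdry_geometry[OF dom])
    obtain \<tau>0 where \<tau>0: "\<tau>0 > 0" "\<And>\<tau>. 0 \<le> \<tau> \<Longrightarrow> \<tau> \<le> \<tau>0 \<Longrightarrow> almost_one ?n e \<tau>" using ex_almost_one[OF e(1)] by blast
    \<comment> \<open>The domain acts through \<open>K\<close> alone: \<open>K * d <= 1 / 16\<close>
      gives a unique nearest frontier point and the reflection bounds, and
      \<open>K * d <= \<tau>0\<close> makes the curvature error smaller than the tolerance
      \<open>e\<close>, which was fixed before the domain.\<close>
    define \<delta> where "\<delta> = min (1 / 16) \<tau>0 / K"
    have \<delta>: "\<delta> > 0" using K \<tau>0 by (simp add: \<delta>_def)
    define C where "C = c powr p * 2 powr (- ?n - 2)"
    have C: "C > 0" using c by (simp add: C_def)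
    have "normal_deriv_H_tilde \<Omega> p H Gt x \<ge> C * bdry_dist \<Omega> x powr (1 - (?n - 2) * p)"
      if x: "x \<in> \<Omega>" and small: "bdry_dist \<Omega> x < \<delta>" for x
    proof -
      define d where "d = bdry_dist \<Omega> x"
      define \<nu> where "\<nu> = bdry_dir \<Omega> x"
      define w where "w = x + (2 * d) *\<^sub>R \<nu>"
      have d: "d > 0" "ball x d \<subseteq> \<Omega>" using dpos[OF x] bsub[OF x] by (auto simp: d_def)
      have Kd: "K * d \<le> 1 / 16" "K * d \<le> \<tau>0" "0 \<le> K * d"
        using small K d by (auto simp: \<delta>_def d_def field_simps)
      have \<nu>: "norm \<nu> = 1" using dir[OF x] Kd(1) by (simp add: \<nu>_def d_def)
      have qc': "(a - (x + d *\<^sub>R \<nu>)) \<bullet> \<nu> \<le> K * (norm (a - (x + d *\<^sub>R \<nu>)))\<^sup>2" if "a \<in> closure \<Omega>" for a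
        using qc[OF x _ that] Kd(1) by (simp add: \<nu>_def d_def)
      have qf': "- ((a - (x + d *\<^sub>R \<nu>)) \<bullet> \<nu>) \<le> K * (norm (a - (x + d *\<^sub>R \<nu>)))\<^sup>2" if "a \<in> frontier \<Omega>" for a
        using qf[OF x _ that] Kd(1) by (simp add: \<nu>_def d_def abs_le_iff)
      have clo: "\<Omega> \<subseteq> closure \<Omega>" "frontier \<Omega> \<subseteq> closure \<Omega>" by (auto simp: closure_subset frontier_def)
      note refl = reflection_bounds[OF \<nu> d(1) less_imp_le[OF K] Kd(1) qc', folded w_def]
      have q1: "d \<le> norm (a - w)" if "a \<in> closure \<Omega>" for a using refl(1)[OF that] .
      have q2: "(norm (a - x))\<^sup>2 \<le> (1 + 8 * (K * d)) * (norm (a - w))\<^sup>2" if "a \<in> closure \<Omega>" for a using refl(2)[OF that] .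
      have q3: "(1 - 8 * (K * d)) * (norm (a - w))\<^sup>2 \<le> (norm (a - x))\<^sup>2" if "a \<in> frontier \<Omega>" for a
        using refl(3)[OF _ qf'[OF that]] that clo by blast
      have \<tau>: "almost_one ?n e (K * d)" using \<tau>0(2) Kd by simp
      let ?h = "\<lambda>a. H a x" and ?gt = "\<lambda>a. Gt a x"
      have h: "continuous_on (closure \<Omega>) ?h" "Ck_on 2 ?h \<Omega>" "\<And>a. a \<in> \<Omega> \<Longrightarrow> laplacian ?h a = 0"
        and hbd0: "\<And>a. a \<in> frontier \<Omega> \<Longrightarrow> ?h a = c / norm (a - x) ^ (CARD('n) - 2)"
        using HH x by (auto simp: is_green_regular_part_def harmonic_on_def c_def)
      have xfr: "x \<notin> frontier \<Omega>" using x \<Omega>(1) by (simp add: frontier_def interior_open)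
      have hbd: "?h a = c * norm (a - x) powr (2 - ?n)" if a: "a \<in> frontier \<Omega>" for a
      proof -
        have "a \<noteq> x" using a xfr by auto
        then have "norm (a - x) ^ (CARD('n) - 2) = norm (a - x) powr (?n - 2)"
          using n by (subst powr_realpow[symmetric]) (auto simp: of_nat_diff)
        then show ?thesis using hbd0[OF a] powr_minus_divide[of "norm (a - x)" "?n - 2"] by simp
      qed
      have gt: "continuous_on (closure \<Omega> - {x}) ?gt" "\<And>a. a \<in> frontier \<Omega> \<Longrightarrow> ?gt a = 0"
        using GG x by (auto simp: is_green_tilde_def)
      have hpos: "0 \<le> ?h a" if "a \<in> \<Omega>" for a
        by (rule min_principle_classical[OF \<Omega> h(2,1) _ _ that]) (use h(3) hbd c in auto)
      have h\<Gamma>: "?h a \<le> c * norm (a - x) powr (2 - ?n)" if "a \<in> \<Omega>" "a \<noteq> x" for a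
        using green_function_nonneg[OF _ \<Omega> x c h _ that, unfolded dimn] hbd assms by simp
      have wp: "weak_poisson \<Omega> ?gt (\<lambda>a. if a \<in> \<Omega> - {x} then (c * norm (a - x) powr (2 - ?n) - ?h a) powr (1 + \<epsilon>) else 0)"
        unfolding \<epsilon>(3)[symmetric]
        by (rule green_tilde_weak_poisson[OF assms \<Omega> x _ _ c c_def GG continuous_on_subset[OF h(1) clo(1)] hpos h\<Gamma>])
          (use p s in \<open>auto simp: s_def algebra_simps\<close>)
      define D where "D a = a1 * norm (a - x) powr (- s) - ?gt a - a1 * norm (a - w) powr (- s)" for a
      obtain l g where g: "((D(x := l)) has_derivative (\<lambda>v. g \<bullet> v)) (at x)"
        and gb: "norm g \<le> C0 * (k * \<epsilon> + 6 * e) * c powr p * d powr (- s - 1)"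
        using core[OF \<Omega> x d q1 q2 q3 \<tau> e(1,2) c h hbd \<epsilon>(1,4) gt wp, of s a1] \<epsilon>(3)
        unfolding D_def k_def s_def a1_def by auto
      have k\<epsilon>: "k * \<epsilon> + 6 * e \<le> b" using mult_left_mono[OF \<epsilon>(2), of k] k \<alpha>(3) e(3) by linarith
      have "norm g \<le> C0 * b * c powr p * d powr (- s - 1)"
        by (rule order_trans[OF gb]) (use k\<epsilon> C0 in \<open>auto intro!: mult_right_mono mult_left_mono\<close>)
      also have "C0 * b = 2 powr (- ?n - 2)" using C0 by (simp add: b_def)
      finally have gC: "norm g \<le> C * d powr (- s - 1)" by (simp add: C_def mult_ac)
      define W where "W a = a1 * norm (a - w) powr (- s)" for a
      have xw: "norm (x - w) = 2 * d" using d \<nu> by (simp add: w_def)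
      define gw where "gw = (a1 * (- s) * norm (x - w) powr (- s - 2)) *\<^sub>R (x - w)"
      have W: "(W has_derivative (\<lambda>v. gw \<bullet> v)) (at x)"
      proof -
        have sq: "b powr (- s) = (b\<^sup>2) powr (- (s / 2))" "(b\<^sup>2) powr (- (s / 2) - 1) = b powr (- s - 2)" if "b \<ge> 0" for b :: real
          using powr_powr[of b 2 "- (s / 2)"] powr_powr[of b 2 "- (s / 2) - 1"] that by (simp_all add: algebra_simps)
        have "((\<lambda>a. ((norm (a - w))\<^sup>2) powr (- (s / 2))) has_derivative
          (\<lambda>v. (- (s / 2) * ((norm (x - w))\<^sup>2) powr (- (s / 2) - 1)) * (2 * ((x - w) \<bullet> v)))) (at x)"
          by (rule has_derivative_radial[where h="\<lambda>t. t powr (- (s / 2))"]) (use xw d in \<open>auto intro!: derivative_eq_intros\<close>)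
        then have "((\<lambda>a. norm (a - w) powr (- s)) has_derivative (\<lambda>v. (- (s / 2) * norm (x - w) powr (- s - 2)) * (2 * ((x - w) \<bullet> v)))) (at x)"
          by (simp only: sq[OF norm_ge_zero])
        from has_derivative_mult_right[OF this, of a1] show ?thesis
          unfolding W_def by (rule has_derivative_eq_rhs) (simp add: gw_def fun_eq_iff)
      qed
      \<comment> \<open>On the diagonal \<open>H_tilde\<close> is defined by a limit.
        Differentiability of \<open>D(x := l)\<close> and of \<open>W\<close> shows that the limit
        exists and equals \<open>l + W x\<close>, so the gradient in the claim is
        \<open>g + gw\<close>.\<close>
      have HtD: "H_tilde p H Gt a x = (D(x := l)) a + W a" for a
      proof -
        have pn: "p < (?n - 1) / (?n - 2)" 
        proof -
          have "p * (?n - 2) < ?n - 1" using ne(2) by (simp add: \<epsilon>(3) algebra_simps)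
          then show ?thesis using n by (simp add: pos_less_divide_eq)
        qed
        have off: "H_tilde_off_diag p H Gt a x = D a + W a" if "a \<noteq> x" for a
        proof -
          have "p * (?n - 2) - 2 = s" by (simp add: s_def mult.commute)
          then show ?thesis using pn by (simp add: H_tilde_off_diag_def D_def W_def a1 powr_minus_divide)
        qed
        show ?thesis
        proof (cases "a = x")
          case True
          have "((\<lambda>a. (D(x := l)) a + W a) \<longlongrightarrow> (D(x := l)) x + W x) (at x)"
            using has_derivative_continuous[OF has_derivative_add[OF g W]] by (simp only: continuous_at isCont_def)
          then have "((\<lambda>a. H_tilde_off_diag p H Gt a x) \<longlongrightarrow> (D(x := l)) x + W x) (at x)"
            by (rule Lim_transform_eventually) (auto simp: eventually_at_filter off)
          then have "Lim (at x) (\<lambda>a. H_tilde_off_diag p H Gt a x) = (D(x := l)) x + W x"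
            by (intro tendsto_Lim) auto
          then show ?thesis using True by (simp add: H_tilde_def)
        qed (simp add: H_tilde_def off)
      qed
      have "((\<lambda>a. H_tilde p H Gt a x) has_derivative (\<lambda>v. (g + gw) \<bullet> v)) (at x)"
        unfolding HtD using has_derivative_add[OF g W] by (simp add: inner_add_left)
      then have nd: "normal_deriv_H_tilde \<Omega> p H Gt x = \<nu> \<bullet> g + \<nu> \<bullet> gw"
        unfolding normal_deriv_H_tilde_def by (simp add: gradient_eq inner_add_right \<nu>_def)
      \<comment> \<open>\<open>w\<close> lies beyond the boundary in direction \<nu>, so
        \<open>x - w\<close> is a negative multiple of \<nu> and cancels the minus sign from the
        exponent: \<open>W\<close> increases towards the boundary.\<close>
      have "\<nu> \<bullet> gw = a1 * s * (2 * d) powr (- s - 1)"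
      proof -
        have "x - w = - ((2 * d) *\<^sub>R \<nu>)" by (simp add: w_def)
        then have "\<nu> \<bullet> gw = a1 * s * ((2 * d) * (2 * d) powr (- s - 2))"
          unfolding gw_def xw using \<nu> by (simp add: norm_eq_1)
        also have "(2 * d) * (2 * d) powr (- s - 2) = (2 * d) powr (- s - 1)" by (rule powr_mult_self) (use d in auto)
        finally show ?thesis .
      qed
      also have "\<dots> \<ge> c powr p / 2 * (2 powr (- ?n) * d powr (- s - 1))"
      proof (rule mult_mono[OF a1s])
        have "(2::real) powr (- ?n) \<le> 2 powr (- s - 1)" using s by (intro powr_mono) auto
        then show "2 powr (- ?n) * d powr (- s - 1) \<le> (2 * d) powr (- s - 1)"
          using d by (simp add: powr_mult mult_right_mono)
        show "0 \<le> a1 * s" using order_trans[OF _ a1s, of 0] by simp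
      qed simp
      moreover have "c powr p / 2 * (2 powr (- ?n) * d powr (- s - 1)) = 2 * C * d powr (- s - 1)"
      proof -
        have "(2::real) powr (- ?n) = 4 * 2 powr (- ?n - 2)" by (simp add: powr_diff)
        then show ?thesis by (simp add: C_def)
      qed
      ultimately have gw: "2 * C * d powr (- s - 1) \<le> \<nu> \<bullet> gw" by linarith
      have "\<bar>\<nu> \<bullet> g\<bar> \<le> norm g" using Cauchy_Schwarz_ineq2[of \<nu> g] \<nu> by simp
      then have "C * d powr (- s - 1) \<le> normal_deriv_H_tilde \<Omega> p H Gt x" using gC gw nd by (simp add: abs_le_iff)
      moreover have "- s - 1 = 1 - (?n - 2) * p" by (simp add: s_def)
      ultimately show ?thesis by (simp only: d_def)
    qed
    then show ?thesis using C \<delta> by blast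
  qed
  show ?thesis
  proof (rule exI[of _ \<alpha>], intro conjI \<alpha>(1) \<alpha>n allI impI; elim conjE)
    fix p :: real and \<Omega> :: "(real^'n) set" and H Gt
    assume "1 \<le> p" "p < 1 + \<alpha>" "smooth_bounded_domain \<Omega>" "is_green_regular_part \<Omega> H" "is_green_tilde \<Omega> p (green H) Gt"
    then show "\<exists>C \<delta>::real. C > 0 \<and> \<delta> > 0 \<and> (\<forall>x\<in>\<Omega>. bdry_dist \<Omega> x < \<delta> \<longrightarrow>
      normal_deriv_H_tilde \<Omega> p H Gt x \<ge> C * bdry_dist \<Omega> x powr (1 - (?n - 2) * p))"
      by (rule main)
  qed
qed

end
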